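(* Let $U\subset\mathbb{R}^n$ be open. For any $\sigma\in CS_{\rm com}(U)$ and any $i\in\{1,\dots,n\}$, $$-\!\!\!\!\!\int_{T^*U}\frac{\partial}{\partial\xi_i}\sigma(x,\xi)\,d\xi\,dx=(-1)^{i-1}\int_{S^*(0,1)}\sigma_{-n+1}(x,\xi)\,d\xi_1\wedge\cdots\wedge\widehat{d\xi_i}\wedge\cdots\wedge d\xi_n\wedge dx_1\wedge\cdots\wedge dx_n.$$ In particular, if $\sigma\in CS_{\rm com}^{\notin\mathbb{Z}}(U)$ then $$-\!\!\!\!\!\int_{T^*U}\frac{\partial}{\partial\xi_i}\sigma(x,\xi)\,d\xi\,dx=0\qquad\forall i\in\{1,\dots,n\}.$$
   Context: $U\subset\mathbb{R}^n$ is open, $T^*U=U\times\mathbb{R}^n$ with coordinates $(x,\xi)$, $|\xi|$ the Euclidean norm. Fix a smooth function $\chi$ on $T^*U$ with $\chi=0$ for $|\xi|\le 1/2$ and $\chi=1$ for $|\xi|\ge 1$. A symbol $\sigma$ is classical of order $m\in\mathbb{C}$ if for every positive integer $N$, $\sigma=\sum_{i=0}^N\chi\,\sigma_{m-i}+\sigma_{(N)}$ with $\sigma_{m-i}$ positively homogeneous of degree $m-i$ in $\xi\ne0$ and $\sigma_{(N)}$ a symbol of order $m-N-1$ (i.e. $\mathrm{Re}(m)-N-1$). $CS^m_{\rm com}(U)$ is the set of classical symbols of order $m$ with compact support in $x\in U$; $CS_{\rm com}(U)$ is the algebra generated by them over all $m\in\mathbb{C}$; $CS^{\notin\mathbb{Z}}_{\rm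 com}(U)$ is the class of compactly supported classical symbols of non integer order. $\sigma_{-n+1}$ is the positively homogeneous component of $\sigma$ of degree $-n+1$ (zero if there is none). Cut-off integral: $-\!\!\!\!\int_{T_x^*U}\sigma(x,\xi)\,d\xi$ is the constant term in the asymptotic expansion of $\int_{|\xi|\le R}\sigma(x,\xi)\,d\xi$ as $R\to\infty$ (in powers of $R$ with nonzero exponents, $\log R$ and a constant); $-\!\!\!\!\int_{T^*U}\sigma(x,\xi)\,d\xi\,dx=\int_U dx\,-\!\!\!\!\int_{T_x^*U}\sigma(x,\xi)\,d\xi$. $S^*(0,1)=\{(x,\xi):x\in U,\ |\xi|=1\}$, oriented as the boundary of $\{|\xi|\le1\}$ in $T^*U$ oriented by $d\xi_1\wedge\cdots\wedge d\xi_n\wedge dx_1\wedge\cdots\wedge dx_n$. *)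

theory Defs
  imports "HOL-Analysis.Analysis"
begin

text \<open>
  \<open>T\<^sup>*U\<close> is \<open>U \<times> UNIV\<close> with points \<open>(x, \<xi>)\<close>. All functions are total; only their values on
  \<open>T\<^sup>*U\<close> (for homogeneous functions: on \<open>\<xi> \<noteq> 0\<close>) matter. The index type \<open>'n\<close> is finite and
  linearly ordered, so its elements are the indices \<open>1 < \<dots> < n\<close> with \<open>n = CARD('n)\<close>, and the
  position of \<open>i\<close> is \<open>card {j. j < i} + 1\<close>.
\<close>

type_synonym 'n cotangent = "(real^'n) \<times> (real^'n)"


section \<open>Smooth functions and symbols\<close>

definition dir_deriv :: "'a::real_normed_vector \<Rightarrow> ('a \<Rightarrow> 'b::real_normed_vector) \<Rightarrow> 'a \<Rightarrow> 'b" where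
  "dir_deriv v f p = frechet_derivative f (at p) v"

primrec Ck_on :: "nat \<Rightarrow> 'a::real_normed_vector set \<Rightarrow> ('a \<Rightarrow> 'b::real_normed_vector) \<Rightarrow> bool" where
  "Ck_on 0 S f \<longleftrightarrow> continuous_on S f"
| "Ck_on (Suc k) S f \<longleftrightarrow> (\<forall>p\<in>S. f differentiable (at p)) \<and> (\<forall>v. Ck_on k S (dir_deriv v f))"

text \<open>Meant for open \<open>S\<close> only.\<close>
definition smooth_on :: "'a::real_normed_vector set \<Rightarrow> ('a \<Rightarrow> 'b::real_normed_vector) \<Rightarrow> bool" where
  "smooth_on S f \<longleftrightarrow> (\<forall>k. Ck_on k S f)"

definition deriv_x :: "'n::finite \<Rightarrow> ('n cotangent \<Rightarrow> complex) \<Rightarrow> 'n cotangent \<Rightarrow> complex" where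
  "deriv_x j = dir_deriv (axis j 1, 0)"

definition deriv_xi :: "'n::finite \<Rightarrow> ('n cotangent \<Rightarrow> complex) \<Rightarrow> 'n cotangent \<Rightarrow> complex" where
  "deriv_xi j = dir_deriv (0, axis j 1)"

text \<open>
  The estimates \<open>|\<partial>\<^sub>x\<^sup>\<alpha> \<partial>\<^sub>\<xi>\<^sup>\<beta> \<sigma>(x, \<xi>)| \<le> C (1 + |\<xi>|)\<^bsup>r - |\<beta>|\<^esup>\<close>, locally uniformly in \<open>x\<close>; the
  multi-indices \<open>\<alpha>\<close>, \<open>\<beta>\<close> are given as lists of the indices of the successive derivatives.
\<close>
definition symbol :: "(real^'n::finite) set \<Rightarrow> real \<Rightarrow> ('n cotangent \<Rightarrow> complex) \<Rightarrow> bool" where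
  "symbol U r \<sigma> \<longleftrightarrow> smooth_on (U \<times> UNIV) \<sigma> \<and>
     (\<forall>K \<alpha> \<beta>. compact K \<and> K \<subseteq> U \<longrightarrow>
       (\<exists>C. \<forall>x\<in>K. \<forall>\<xi>. cmod (foldr deriv_x \<alpha> (foldr deriv_xi \<beta> \<sigma>) (x, \<xi>))
                          \<le> C * (1 + norm \<xi>) powr (r - real (length \<beta>))))"

definition cutoff_function :: "(real^'n::finite) set \<Rightarrow> ('n cotangent \<Rightarrow> complex) \<Rightarrow> bool" where
  "cutoff_function U \<psi> \<longleftrightarrow> smooth_on (U \<times> UNIV) \<psi> \<and>
     (\<forall>x\<in>U. \<forall>\<xi>. (norm \<xi> \<le> 1/2 \<longrightarrow> \<psi> (x, \<xi>) = 0) \<and> (norm \<xi> \<ge> 1 \<longrightarrow> \<psi> (x, \<xi>) = 1))"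

definition positively_homogeneous ::
    "(real^'n::finite) set \<Rightarrow> complex \<Rightarrow> ('n cotangent \<Rightarrow> complex) \<Rightarrow> bool" where
  "positively_homogeneous U d f \<longleftrightarrow> smooth_on (U \<times> (- {0})) f \<and>
     (\<forall>x\<in>U. \<forall>\<xi>. \<forall>t>0. \<xi> \<noteq> 0 \<longrightarrow> f (x, t *\<^sub>R \<xi>) = of_real t powr d * f (x, \<xi>))"

definition classical_symbol ::
    "('n::finite cotangent \<Rightarrow> complex) \<Rightarrow> (real^'n) set \<Rightarrow> complex \<Rightarrow> ('n cotangent \<Rightarrow> complex) \<Rightarrow> bool" where
  "classical_symbol \<psi> U m \<sigma> \<longleftrightarrow> symbol U (Re m) \<sigma> \<and>
     (\<exists>s :: nat \<Rightarrow> 'n cotangent \<Rightarrow> complex.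
        (\<forall>i. positively_homogeneous U (m - of_nat i) (s i)) \<and>
        (\<forall>N\<ge>1. symbol U (Re m - real N - 1) (\<lambda>p. \<sigma> p - (\<Sum>i=0..N. \<psi> p * s i p))))"

definition compact_x_support :: "(real^'n::finite) set \<Rightarrow> ('n cotangent \<Rightarrow> complex) \<Rightarrow> bool" where
  "compact_x_support U \<sigma> \<longleftrightarrow>
     (\<exists>K. compact K \<and> K \<subseteq> U \<and> (\<forall>x\<in>U - K. \<forall>\<xi>. \<sigma> (x, \<xi>) = 0))"

definition CS_com_of_order ::
    "('n::finite cotangent \<Rightarrow> complex) \<Rightarrow> (real^'n) set \<Rightarrow> complex \<Rightarrow> ('n cotangent \<Rightarrow> complex) set" where
  "CS_com_of_order \<psi> U m = {\<sigma>. classical_symbol \<psi> U m \<sigma> \<and> compact_x_support U \<sigma>}"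

inductive_set CS_com ::
    "('n::finite cotangent \<Rightarrow> complex) \<Rightarrow> (real^'n) set \<Rightarrow> ('n cotangent \<Rightarrow> complex) set"
  for \<psi> U where
  generator: "\<sigma> \<in> CS_com_of_order \<psi> U m \<Longrightarrow> \<sigma> \<in> CS_com \<psi> U"
| add: "\<sigma> \<in> CS_com \<psi> U \<Longrightarrow> \<tau> \<in> CS_com \<psi> U \<Longrightarrow> (\<lambda>p. \<sigma> p + \<tau> p) \<in> CS_com \<psi> U"
| scale: "\<sigma> \<in> CS_com \<psi> U \<Longrightarrow> (\<lambda>p. a * \<sigma> p) \<in> CS_com \<psi> U"
| mult: "\<sigma> \<in> CS_com \<psi> U \<Longrightarrow> \<tau> \<in> CS_com \<psi> U \<Longrightarrow> (\<lambda>p. \<sigma> p * \<tau> p) \<in> CS_com \<psi> U"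

definition CS_com_nonint ::
    "('n::finite cotangent \<Rightarrow> complex) \<Rightarrow> (real^'n) set \<Rightarrow> ('n cotangent \<Rightarrow> complex) set" where
  "CS_com_nonint \<psi> U = (\<Union>m\<in>- \<int>. CS_com_of_order \<psi> U m)"

text \<open>
  Elements of \<open>CS_com\<close> are sums of classical symbols whose orders need not differ by integers, so
  their homogeneous components are indexed by arbitrary complex degrees \<open>d\<close>, with \<open>c d = 0\<close> if there
  is none. For a classical symbol, \<open>c (m - i)\<close> is the component \<open>s i\<close> above. The family \<open>c\<close> is
  uniquely determined on \<open>\<xi> \<noteq> 0\<close>.
\<close>
definition homogeneous_expansion ::
    "('n::finite cotangent \<Rightarrow> complex) \<Rightarrow> (real^'n) set \<Rightarrow> ('n cotangent \<Rightarrow> complex)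
      \<Rightarrow> (complex \<Rightarrow> 'n cotangent \<Rightarrow> complex) \<Rightarrow> bool" where
  "homogeneous_expansion \<psi> U \<sigma> c \<longleftrightarrow>
     (\<forall>d. positively_homogeneous U d (c d)) \<and>
     (\<forall>r. let D = {d. Re d > r \<and> (\<exists>p\<in>U \<times> (- {0}). c d p \<noteq> 0)}
          in finite D \<and> symbol U r (\<lambda>p. \<sigma> p - (\<Sum>d\<in>D. \<psi> p * c d p)))"

definition homogeneous_component ::
    "('n::finite cotangent \<Rightarrow> complex) \<Rightarrow> (real^'n) set \<Rightarrow> ('n cotangent \<Rightarrow> complex) \<Rightarrow> complex
      \<Rightarrow> 'n cotangent \<Rightarrow> complex" where
  "homogeneous_component \<psi> U \<sigma> d = (SOME c. homogeneous_expansion \<psi> U \<sigma> c) d"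


section \<open>Cut-off integrals\<close>

text \<open>
  Only finitely many terms of an asymptotic expansion as \<open>R \<rightarrow> \<infinity>\<close> do not tend to \<open>0\<close>, so the
  constant term is read off from the expansion up to \<open>o(1)\<close>.
\<close>
definition has_constant_term :: "(real \<Rightarrow> complex) \<Rightarrow> complex \<Rightarrow> bool" where
  "has_constant_term F c \<longleftrightarrow>
     (\<exists>A a b. finite A \<and> 0 \<notin> A \<and>
        ((\<lambda>R. F R - ((\<Sum>z\<in>A. a z * of_real R powr z) + b * of_real (ln R) + c)) \<longlongrightarrow> 0) at_top)"

definition constant_term :: "(real \<Rightarrow> complex) \<Rightarrow> complex" where
  "constant_term F = (THE c. has_constant_term F c)"

definition fibre_ball_integral ::
    "('n::finite cotangent \<Rightarrow> complex) \<Rightarrow> real^'n \<Rightarrow> real \<Rightarrow> complex" where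
  "fibre_ball_integral f x R = (LINT \<xi>:cball 0 R|lborel. f (x, \<xi>))"

definition cutoff_fibre_integral :: "('n::finite cotangent \<Rightarrow> complex) \<Rightarrow> real^'n \<Rightarrow> complex" where
  "cutoff_fibre_integral f x = constant_term (fibre_ball_integral f x)"

definition cutoff_integrable :: "(real^'n::finite) set \<Rightarrow> ('n cotangent \<Rightarrow> complex) \<Rightarrow> bool" where
  "cutoff_integrable U f \<longleftrightarrow>
     (\<forall>x\<in>U. (\<forall>R. set_integrable lborel (cball 0 R) (\<lambda>\<xi>. f (x, \<xi>))) \<and>
             (\<exists>!c. has_constant_term (fibre_ball_integral f x) c)) \<and>
     set_integrable lborel U (cutoff_fibre_integral f)"

definition cutoff_integral :: "(real^'n::finite) set \<Rightarrow> ('n cotangent \<Rightarrow> complex) \<Rightarrow> complex" where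
  "cutoff_integral U f = (LINT x:U|lborel. cutoff_fibre_integral f x)"


section \<open>Integration of forms over the cosphere bundle\<close>

text \<open>
  A \<open>k\<close>-form with constant coefficients is a function of lists of \<open>k\<close> tangent vectors, and
  \<open>(\<lambda>\<^sub>1 \<and> \<dots> \<and> \<lambda>\<^sub>k)(v\<^sub>1, \<dots>, v\<^sub>k) = det (\<lambda>\<^sub>a(v\<^sub>b))\<close>.
\<close>
definition wedge :: "('v \<Rightarrow> real) list \<Rightarrow> 'v list \<Rightarrow> real" where
  "wedge ls vs = (\<Sum>\<pi> | \<pi> permutes {..<length ls}.
     of_int (sign \<pi>) * (\<Prod>a<length ls. (ls ! a) (vs ! \<pi> a)))"

definition dx :: "'n::finite \<Rightarrow> 'n cotangent \<Rightarrow> real" where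
  "dx j v = fst v $ j"

definition dxi :: "'n::finite \<Rightarrow> 'n cotangent \<Rightarrow> real" where
  "dxi j v = snd v $ j"

definition indices :: "'n::{finite,linorder} list" where
  "indices = sorted_list_of_set UNIV"

definition orientation_form :: "'n::{finite,linorder} cotangent list \<Rightarrow> real" where
  "orientation_form = wedge (map dxi indices @ map dx indices)"

definition omit_dxi_form :: "'n::{finite,linorder} \<Rightarrow> 'n cotangent list \<Rightarrow> real" where
  "omit_dxi_form i = wedge (map dxi (filter (\<lambda>j. j \<noteq> i) indices) @ map dx indices)"

text \<open>
  At \<open>p = (x, \<xi>)\<close> with \<open>|\<xi>| = 1\<close> the outward unit normal of \<open>{|\<xi>| \<le> 1}\<close> is \<open>(0, \<xi>)\<close>. In the boundary
  orientation a tangent frame is positive iff prefixing it with the outward normal yields a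
  positive frame of \<open>T\<^sup>*U\<close>.
\<close>
definition positive_orthonormal_frame ::
    "'n::{finite,linorder} cotangent \<Rightarrow> 'n cotangent list \<Rightarrow> bool" where
  "positive_orthonormal_frame p vs \<longleftrightarrow>
     length vs = 2 * CARD('n) - 1 \<and>
     (\<forall>a<length vs. vs ! a \<bullet> (0, snd p) = 0) \<and>
     (\<forall>a<length vs. \<forall>b<length vs. vs ! a \<bullet> vs ! b = (if a = b then 1 else 0)) \<and>
     orientation_form ((0, snd p) # vs) > 0"

text \<open>Surface measure of the unit sphere: \<open>n\<close> times the volume of the cone over a set.\<close>
definition sphere_measure :: "(real^'n::finite) measure" where
  "sphere_measure =
     distr (scale_measure (of_nat CARD('n)) (restrict_space lborel (cball 0 1 - {0})))
       (restrict_space borel (sphere 0 1)) sgn"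

definition cosphere_measure :: "(real^'n::finite) set \<Rightarrow> 'n cotangent measure" where
  "cosphere_measure U = restrict_space lborel U \<Otimes>\<^sub>M sphere_measure"

text \<open>
  The integral of the \<open>(2n - 1)\<close>-form \<open>f \<omega>\<close> over \<open>S\<^sup>*(0,1)\<close> with its boundary orientation. On this
  oriented hypersurface a top-degree form is its value on a positive orthonormal frame times the
  Riemannian volume form; the value does not depend on the chosen frame.
\<close>
definition cosphere_integral ::
    "(real^'n::{finite,linorder}) set \<Rightarrow> ('n cotangent \<Rightarrow> complex) \<Rightarrow> ('n cotangent list \<Rightarrow> real)
      \<Rightarrow> complex" where
  "cosphere_integral U f \<omega> =
     (LINT p|cosphere_measure U. f p * of_real (\<omega> (SOME vs. positive_orthonormal_frame p vs)))"

end

theory Submission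
  imports Defs "Jordan_Normal_Form.Determinant"
begin

text \<open>
  For fixed \<open>x\<close>, the divergence theorem on the ball of radius \<open>R\<close> turns the integral of
  \<open>\<partial>\<sigma>/\<partial>\<xi>\<^sub>i\<close> into \<open>R\<^bsup>n-1\<^esup>\<close> times the integral of \<open>\<sigma>(x, R\<omega>) \<omega>\<^sub>i\<close> over the unit sphere. Inserting the
  expansion of \<open>\<sigma>\<close> into homogeneous components up to order \<open>-n\<close>, the component of degree \<open>d\<close>
  contributes a multiple of \<open>R\<^bsup>d+n-1\<^esup>\<close> and the remainder tends to \<open>0\<close>, so the constant term is the
  contribution of \<open>d = 1 - n\<close>. On the unit cosphere bundle, \<open>\<omega>\<^sub>i\<close> times the Riemannian volume form is,
  up to the sign \<open>(-1)\<^bsup>i-1\<^esup>\<close>, the form omitting \<open>d\<xi>\<^sub>i\<close>, because an orthogonal matrix of determinant one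
  is its own cofactor matrix.
\<close>

text \<open>Elements of \<open>CS_com\<close> are polynomials in classical symbols of unrelated
  orders and need not be classical. This forces expansions over finite sets of complex degrees, made
  separately for each remainder order r. The components in the statement are chosen by
  \<open>SOME\<close>, so a single family valid for all r has to be glued from these. The gluing and
  the constant term rest on one uniqueness fact. Complex degrees may share a real part, so terms
  such as R^(it) oscillate without decaying and cannot be separated by size; a difference operator
  separates them instead. The divergence theorem uses no parametrisation of the sphere:
  \<open>sphere_measure\<close> is a cone measure, so the flux is an integral over the unit ball of
  a function constant along rays, reached as a limit of thin shells. The sign (-1)^(i-1) occurs
  twice, in the formula and in the value of \<open>omit_dxi_form i\<close> on a frame, and cancels.
  For non-integer order m the classical expansion is used directly, since its degrees m - i never
  meet 1 - n.\<close>

no_notation Matrix.vec_index (infixl \<open>$\<close> 100)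
no_notation Matrix.scalar_prod (infix \<open>\<bullet>\<close> 70)


section \<open>Smooth functions and symbols\<close>

lemma has_derivative_cong_open:
  assumes "open S" "p \<in> S" "\<And>q. q \<in> S \<Longrightarrow> f q = g q"
  shows "(f has_derivative D) (at p) \<longleftrightarrow> (g has_derivative D) (at p)"
  using assms by (metis has_derivative_transform_within_open)

lemma dir_deriv_cong:
  assumes "open S" "p \<in> S" "\<And>q. q \<in> S \<Longrightarrow> f q = g q"
  shows "dir_deriv v f p = dir_deriv v g p"
proof -
  have "(f has_derivative D) (at p) \<longleftrightarrow> (g has_derivative D) (at p)" for D
    using assms by (rule has_derivative_cong_open)
  then show ?thesis unfolding dir_deriv_def frechet_derivative_def by simp
qed

lemma dir_deriv_eqI: "(f has_derivative D) (at p) \<Longrightarrow> dir_deriv v f p = D v"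
  unfolding dir_deriv_def using frechet_derivative_at by metis

lemma dir_deriv_works:
  "f differentiable (at p) \<Longrightarrow> (f has_derivative (\<lambda>v. dir_deriv v f p)) (at p)"
  unfolding dir_deriv_def using frechet_derivative_works by metis

lemma Ck_on_cong:
  assumes "open S" "\<And>q. q \<in> S \<Longrightarrow> f q = g q"
  shows "Ck_on k S f \<longleftrightarrow> Ck_on k S g"
  using assms(2)
proof (induction k arbitrary: f g)
  case 0
  then show ?case by (simp cong: continuous_on_cong)
next
  case (Suc k)
  have "Ck_on k S (dir_deriv v f) \<longleftrightarrow> Ck_on k S (dir_deriv v g)" for v
    using Suc by (intro Suc.IH dir_deriv_cong[OF assms(1)]) auto
  moreover have "f differentiable (at p) \<longleftrightarrow> g differentiable (at p)" if "p \<in> S" for p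
    using has_derivative_cong_open[OF assms(1) that, of f g] Suc.prems
    unfolding differentiable_def by auto
  ultimately show ?case by simp
qed

lemma Ck_on_SucD: "Ck_on (Suc k) S f \<Longrightarrow> Ck_on k S f"
proof (induction k arbitrary: f)
  case 0
  then show ?case
    by (auto intro!: continuous_at_imp_continuous_on differentiable_imp_continuous_within)
next
  case (Suc k)
  then show ?case by (metis Ck_on.simps(2))
qed

lemma Ck_on_const: "open S \<Longrightarrow> Ck_on k S (\<lambda>_. c)"
proof (induction k arbitrary: c)
  case (Suc k)
  have "dir_deriv v (\<lambda>_. c) = (\<lambda>_. 0)" for v :: 'a
    by (intro ext dir_deriv_eqI) simp
  with Suc show ?case by simp
qed simp

lemma dir_deriv_add:
  assumes "f differentiable (at p)" "g differentiable (at p)"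
  shows "dir_deriv v (\<lambda>q. f q + g q) p = dir_deriv v f p + dir_deriv v g p"
  using dir_deriv_eqI[OF has_derivative_add[OF assms[THEN dir_deriv_works]]] .

lemma dir_deriv_mult:
  fixes f g :: "'a::real_normed_vector \<Rightarrow> 'b::real_normed_algebra"
  assumes "f differentiable (at p)" "g differentiable (at p)"
  shows "dir_deriv v (\<lambda>q. f q * g q) p = dir_deriv v f p * g p + f p * dir_deriv v g p"
  using dir_deriv_eqI[OF has_derivative_mult[OF assms[THEN dir_deriv_works]]] by (simp add: add.commute)

lemma Ck_on_add:
  assumes "open S"
  shows "Ck_on k S f \<Longrightarrow> Ck_on k S g \<Longrightarrow> Ck_on k S (\<lambda>q. f q + g q)"
proof (induction k arbitrary: f g)
  case 0
  then show ?case by (simp add: continuous_on_add)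
next
  case (Suc k)
  have "Ck_on k S (dir_deriv v (\<lambda>q. f q + g q))" for v
    using Suc by (subst Ck_on_cong[OF assms dir_deriv_add]) auto
  with Suc.prems show ?case by (auto intro: differentiable_add)
qed

lemma Ck_on_mult:
  fixes f g :: "'a::real_normed_vector \<Rightarrow> 'b::real_normed_algebra"
  assumes "open S"
  shows "Ck_on k S f \<Longrightarrow> Ck_on k S g \<Longrightarrow> Ck_on k S (\<lambda>q. f q * g q)"
proof (induction k arbitrary: f g)
  case 0
  then show ?case by (simp add: continuous_on_mult)
next
  case (Suc k)
  note Ck_on_SucD[OF Suc.prems(1)] Ck_on_SucD[OF Suc.prems(2)]
  then have "Ck_on k S (dir_deriv v (\<lambda>q. f q * g q))" for v
    using Suc by (subst Ck_on_cong[OF assms dir_deriv_mult]) (auto intro!: Ck_on_add[OF assms])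
  with Suc.prems show ?case by (auto intro: differentiable_mult)
qed

lemma Ck_on_Un:
  assumes "open S" "open T"
  shows "Ck_on k S f \<Longrightarrow> Ck_on k T f \<Longrightarrow> Ck_on k (S \<union> T) f"
proof (induction k arbitrary: f)
  case 0
  then show ?case using assms by (simp add: continuous_on_open_Un)
qed auto

lemma Ck_on_subset: "Ck_on k S f \<Longrightarrow> T \<subseteq> S \<Longrightarrow> Ck_on k T f"
  by (induction k arbitrary: f) (auto intro: continuous_on_subset)

lemma smooth_on_cong:
  "open S \<Longrightarrow> (\<And>q. q \<in> S \<Longrightarrow> f q = g q) \<Longrightarrow> smooth_on S f \<longleftrightarrow> smooth_on S g"
  unfolding smooth_on_def using Ck_on_cong by blast

lemma smooth_on_const: "open S \<Longrightarrow> smooth_on S (\<lambda>_. c)"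
  unfolding smooth_on_def by (simp add: Ck_on_const)

lemma smooth_on_add:
  "open S \<Longrightarrow> smooth_on S f \<Longrightarrow> smooth_on S g \<Longrightarrow> smooth_on S (\<lambda>q. f q + g q)"
  unfolding smooth_on_def by (simp add: Ck_on_add)

lemma smooth_on_mult:
  fixes f g :: "'a::real_normed_vector \<Rightarrow> 'b::real_normed_algebra"
  shows "open S \<Longrightarrow> smooth_on S f \<Longrightarrow> smooth_on S g \<Longrightarrow> smooth_on S (\<lambda>q. f q * g q)"
  unfolding smooth_on_def by (simp add: Ck_on_mult)

lemma smooth_on_Un:
  "open S \<Longrightarrow> open T \<Longrightarrow> smooth_on S f \<Longrightarrow> smooth_on T f \<Longrightarrow> smooth_on (S \<union> T) f"
  unfolding smooth_on_def by (simp add: Ck_on_Un)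

lemma smooth_on_subset: "smooth_on S f \<Longrightarrow> T \<subseteq> S \<Longrightarrow> smooth_on T f"
  unfolding smooth_on_def using Ck_on_subset by blast

lemma smooth_on_dir_deriv: "smooth_on S f \<Longrightarrow> smooth_on S (dir_deriv v f)"
  unfolding smooth_on_def by (metis Ck_on.simps(2))

lemma smooth_on_imp_differentiable: "smooth_on S f \<Longrightarrow> p \<in> S \<Longrightarrow> f differentiable (at p)"
  unfolding smooth_on_def by (metis Ck_on.simps(2))

lemma smooth_on_imp_continuous: "smooth_on S f \<Longrightarrow> continuous_on S f"
  unfolding smooth_on_def by (metis Ck_on.simps(1))

lemma smooth_on_foldr_dir_deriv:
  "smooth_on S f \<Longrightarrow> smooth_on S (foldr (\<lambda>j. dir_deriv (w j)) \<alpha> f)"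
  by (induction \<alpha>) (auto intro: smooth_on_dir_deriv)

lemma foldr_dir_deriv_cong:
  assumes "open S" "\<And>q. q \<in> S \<Longrightarrow> f q = g q" "p \<in> S"
  shows "foldr (\<lambda>j. dir_deriv (w j)) \<alpha> f p = foldr (\<lambda>j. dir_deriv (w j)) \<alpha> g p"
  using assms(3) by (induction \<alpha> arbitrary: p) (auto intro: dir_deriv_cong[OF assms(1)] assms)

lemma foldr_dir_deriv_add:
  assumes "open S" "smooth_on S f" "smooth_on S g" "p \<in> S"
  shows "foldr (\<lambda>j. dir_deriv (w j)) \<alpha> (\<lambda>q. f q + g q) p
       = foldr (\<lambda>j. dir_deriv (w j)) \<alpha> f p + foldr (\<lambda>j. dir_deriv (w j)) \<alpha> g p"
  using assms(4)
proof (induction \<alpha> arbitrary: p)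
  case (Cons j \<alpha>)
  have "dir_deriv (w j) (foldr (\<lambda>j. dir_deriv (w j)) \<alpha> (\<lambda>q. f q + g q)) p
      = dir_deriv (w j) (\<lambda>q. foldr (\<lambda>j. dir_deriv (w j)) \<alpha> f q
          + foldr (\<lambda>j. dir_deriv (w j)) \<alpha> g q) p"
    by (rule dir_deriv_cong[OF assms(1) Cons.prems Cons.IH])
  also have "\<dots> = dir_deriv (w j) (foldr (\<lambda>j. dir_deriv (w j)) \<alpha> f) p
          + dir_deriv (w j) (foldr (\<lambda>j. dir_deriv (w j)) \<alpha> g) p"
    using assms Cons.prems
    by (intro dir_deriv_add smooth_on_imp_differentiable[of S] smooth_on_foldr_dir_deriv)
  finally show ?case by simp
qed simp

lemma deriv_x_eq: "deriv_x = (\<lambda>j. dir_deriv (axis j 1, 0))"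
  by (auto simp: deriv_x_def)

lemma deriv_xi_eq: "deriv_xi = (\<lambda>j. dir_deriv (0, axis j 1))"
  by (auto simp: deriv_xi_def)

lemma foldr_deriv_cong:
  assumes "open S" "\<And>q. q \<in> S \<Longrightarrow> f q = g q" "p \<in> S"
  shows "foldr deriv_x \<alpha> f p = foldr deriv_x \<alpha> g p" "foldr deriv_xi \<alpha> f p = foldr deriv_xi \<alpha> g p"
  unfolding deriv_x_eq deriv_xi_eq by (intro foldr_dir_deriv_cong[of S] assms; assumption)+

lemma foldr_deriv_add:
  assumes "open S" "smooth_on S f" "smooth_on S g" "p \<in> S"
  shows "foldr deriv_x \<alpha> (\<lambda>q. f q + g q) p = foldr deriv_x \<alpha> f p + foldr deriv_x \<alpha> g p"
    "foldr deriv_xi \<alpha> (\<lambda>q. f q + g q) p = foldr deriv_xi \<alpha> f p + foldr deriv_xi \<alpha> g p"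
  unfolding deriv_x_eq deriv_xi_eq by (intro foldr_dir_deriv_add[of S] assms)+

lemma smooth_on_foldr_deriv_xi: "smooth_on S f \<Longrightarrow> smooth_on S (foldr deriv_xi \<beta> f)"
  unfolding deriv_xi_eq by (rule smooth_on_foldr_dir_deriv)

lemma smooth_on_deriv_x: "smooth_on S f \<Longrightarrow> smooth_on S (deriv_x j f)"
  unfolding deriv_x_def by (rule smooth_on_dir_deriv)

lemma smooth_on_deriv_xi: "smooth_on S f \<Longrightarrow> smooth_on S (deriv_xi j f)"
  unfolding deriv_xi_def by (rule smooth_on_dir_deriv)

section \<open>Symbol classes: derivatives, sums and products\<close>

definition bounded_order :: "(real^'n::finite) set \<Rightarrow> real \<Rightarrow> ('n cotangent \<Rightarrow> complex) \<Rightarrow> bool" where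
  "bounded_order K r f \<longleftrightarrow> (\<exists>C. \<forall>x\<in>K. \<forall>\<xi>. cmod (f (x, \<xi>)) \<le> C * (1 + norm \<xi>) powr r)"

text \<open>Estimates in the x-derivatives alone. Viewing \<open>symbol\<close> as a family of
  these, one for each list of \<xi>-derivatives, lets the product rule be run in two independent
  inductions.\<close>

definition x_symbol :: "(real^'n::finite) set \<Rightarrow> real \<Rightarrow> ('n cotangent \<Rightarrow> complex) \<Rightarrow> bool" where
  "x_symbol U r f \<longleftrightarrow> smooth_on (U \<times> UNIV) f \<and>
     (\<forall>K \<alpha>. compact K \<and> K \<subseteq> U \<longrightarrow> bounded_order K r (foldr deriv_x \<alpha> f))"

lemma positively_homogeneousD:
  "positively_homogeneous U d h \<Longrightarrow> x \<in> U \<Longrightarrow> t > 0 \<Longrightarrow> \<xi> \<noteq> 0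
    \<Longrightarrow> h (x, t *\<^sub>R \<xi>) = of_real t powr d * h (x, \<xi>)"
  unfolding positively_homogeneous_def by blast

lemma bounded_order_cong:
  "(\<And>x \<xi>. x \<in> K \<Longrightarrow> f (x, \<xi>) = g (x, \<xi>)) \<Longrightarrow> bounded_order K r f \<longleftrightarrow> bounded_order K r g"
  unfolding bounded_order_def by simp

lemma bounded_order_nonneg:
  assumes "bounded_order K r f"
  obtains C where "C \<ge> 0" "\<And>x \<xi>. x \<in> K \<Longrightarrow> cmod (f (x, \<xi>)) \<le> C * (1 + norm \<xi>) powr r"
proof -
  obtain C where C: "\<And>x \<xi>. x \<in> K \<Longrightarrow> cmod (f (x, \<xi>)) \<le> C * (1 + norm \<xi>) powr r"
    using assms unfolding bounded_order_def by blast
  have "cmod (f (x, \<xi>)) \<le> \<bar>C\<bar> * (1 + norm \<xi>) powr r" if "x \<in> K" for x \<xi>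
    using C[OF that, of \<xi>] by (smt (verit) mult_right_mono powr_ge_zero)
  then show thesis using that[of "\<bar>C\<bar>"] by simp
qed

lemma bounded_order_add:
  assumes "bounded_order K r f" "bounded_order K r g"
  shows "bounded_order K r (\<lambda>p. f p + g p)"
proof -
  obtain C D where
    C: "\<And>x \<xi>. x \<in> K \<Longrightarrow> cmod (f (x, \<xi>)) \<le> C * (1 + norm \<xi>) powr r" and
    D: "\<And>x \<xi>. x \<in> K \<Longrightarrow> cmod (g (x, \<xi>)) \<le> D * (1 + norm \<xi>) powr r"
    using assms unfolding bounded_order_def by blast
  have "cmod (f (x, \<xi>) + g (x, \<xi>)) \<le> (C + D) * (1 + norm \<xi>) powr r" if "x \<in> K" for x \<xi>
    using norm_triangle_ineq[of "f (x, \<xi>)" "g (x, \<xi>)"] C[OF that, of \<xi>] D[OF that, of \<xi>]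
    by (simp add: algebra_simps)
  then show ?thesis unfolding bounded_order_def by blast
qed

lemma bounded_order_mult:
  assumes "bounded_order K r f" "bounded_order K s g"
  shows "bounded_order K (r + s) (\<lambda>p. f p * g p)"
proof -
  obtain C where C: "C \<ge> 0" "\<And>x \<xi>. x \<in> K \<Longrightarrow> cmod (f (x, \<xi>)) \<le> C * (1 + norm \<xi>) powr r"
    using bounded_order_nonneg[OF assms(1)] by blast
  obtain D where D: "D \<ge> 0" "\<And>x \<xi>. x \<in> K \<Longrightarrow> cmod (g (x, \<xi>)) \<le> D * (1 + norm \<xi>) powr s"
    using bounded_order_nonneg[OF assms(2)] by blast
  have "cmod (f (x, \<xi>) * g (x, \<xi>)) \<le> (C * D) * (1 + norm \<xi>) powr (r + s)" if "x \<in> K" for x \<xi>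
  proof -
    have "cmod (f (x, \<xi>) * g (x, \<xi>)) \<le> (C * (1 + norm \<xi>) powr r) * (D * (1 + norm \<xi>) powr s)"
      unfolding norm_mult using C D that by (intro mult_mono) auto
    then show ?thesis by (simp add: powr_add mult_ac)
  qed
  then show ?thesis unfolding bounded_order_def by blast
qed

lemma bounded_order_mono:
  assumes "bounded_order K r f" "r \<le> s"
  shows "bounded_order K s f"
proof -
  obtain C where C: "C \<ge> 0" "\<And>x \<xi>. x \<in> K \<Longrightarrow> cmod (f (x, \<xi>)) \<le> C * (1 + norm \<xi>) powr r"
    using bounded_order_nonneg[OF assms(1)] by blast
  have "cmod (f (x, \<xi>)) \<le> C * (1 + norm \<xi>) powr s" if "x \<in> K" for x \<xi>
    using C(2)[OF that, of \<xi>] mult_left_mono[OF powr_mono[OF assms(2), of "1 + norm \<xi>"] C(1)]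
    by simp
  then show ?thesis unfolding bounded_order_def by blast
qed

lemma symbol_iff_x_symbol:
  "symbol U r \<sigma> \<longleftrightarrow> smooth_on (U \<times> UNIV) \<sigma> \<and>
     (\<forall>\<beta>. x_symbol U (r - real (length \<beta>)) (foldr deriv_xi \<beta> \<sigma>))"
  unfolding symbol_def x_symbol_def bounded_order_def using smooth_on_foldr_deriv_xi by blast

lemma symbol_imp_smooth: "symbol U r \<sigma> \<Longrightarrow> smooth_on (U \<times> UNIV) \<sigma>"
  unfolding symbol_def by blast

lemma symbol_imp_bounded_order:
  assumes "symbol U r \<sigma>" "compact K" "K \<subseteq> U"
  shows "bounded_order K r \<sigma>"
  using assms(1)[unfolded symbol_def, THEN conjunct2, rule_format, of K "[]" "[]"] assms(2,3)
  unfolding bounded_order_def by simp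

text \<open>Quantities comparable up to a factor 2 have comparable powers, whatever the sign of the
  exponent. This exchanges 1 + |\<xi>| with |\<xi>| outside the unit ball and with 1 inside
  it.\<close>

lemma powr_comparison:
  fixes a b s :: real
  assumes "0 < a" "0 < b" "a \<le> 2 * b" "b \<le> 2 * a"
  shows "a powr s \<le> 2 powr \<bar>s\<bar> * b powr s"
proof (cases "s \<ge> 0")
  case True
  have "a powr s \<le> (2 * b) powr s" using True assms by (intro powr_mono2) auto
  then show ?thesis using True assms by (simp add: powr_mult)
next
  case False
  have "a powr s \<le> (b / 2) powr s" using False assms by (intro powr_mono2') auto
  then show ?thesis using False assms by (simp add: powr_divide powr_minus field_simps)
qed

context
  fixes U :: "(real^'n::finite) set"
  assumes U: "open U"
begin

lemma open_TU: "open (U \<times> (UNIV :: (real^'n) set))"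
  using U by (simp add: open_Times)

lemma open_TU0: "open (U \<times> (- {0} :: (real^'n) set))"
  using U by (simp add: open_Times open_Compl)

lemma x_symbol_cong:
  assumes "\<And>p. p \<in> U \<times> UNIV \<Longrightarrow> f p = g p"
  shows "x_symbol U r f \<longleftrightarrow> x_symbol U r g"
proof -
  have "bounded_order K r (foldr deriv_x \<alpha> f) \<longleftrightarrow> bounded_order K r (foldr deriv_x \<alpha> g)"
    if "K \<subseteq> U" for K \<alpha>
    using that by (intro bounded_order_cong foldr_deriv_cong(1)[OF open_TU] assms) auto
  then show ?thesis
    unfolding x_symbol_def using smooth_on_cong[OF open_TU, of f g] assms by auto
qed

lemma symbol_cong:
  assumes "\<And>p. p \<in> U \<times> UNIV \<Longrightarrow> f p = g p"
  shows "symbol U r f \<longleftrightarrow> symbol U r g"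
proof -
  have "x_symbol U s (foldr deriv_xi \<beta> f) \<longleftrightarrow> x_symbol U s (foldr deriv_xi \<beta> g)" for s \<beta>
    by (intro x_symbol_cong foldr_deriv_cong(2)[OF open_TU] assms)
  then show ?thesis
    unfolding symbol_iff_x_symbol using smooth_on_cong[OF open_TU, of f g] assms by simp
qed

lemma x_symbol_deriv_x:
  assumes "x_symbol U r f"
  shows "x_symbol U r (deriv_x j f)"
proof -
  have "bounded_order K r (foldr deriv_x \<alpha> (deriv_x j f))" if "compact K" "K \<subseteq> U" for K \<alpha>
    using assms[unfolded x_symbol_def, THEN conjunct2, rule_format, of K "\<alpha> @ [j]"] that by simp
  with assms show ?thesis unfolding x_symbol_def by (auto intro: smooth_on_deriv_x)
qed

lemma x_symbol_add:
  assumes "x_symbol U r f" "x_symbol U r g"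
  shows "x_symbol U r (\<lambda>p. f p + g p)"
proof -
  have "bounded_order K r (foldr deriv_x \<alpha> (\<lambda>p. f p + g p))" if K: "compact K" "K \<subseteq> U" for K \<alpha>
  proof -
    have "bounded_order K r (\<lambda>p. foldr deriv_x \<alpha> f p + foldr deriv_x \<alpha> g p)"
      using assms K unfolding x_symbol_def by (intro bounded_order_add) auto
    moreover have "foldr deriv_x \<alpha> (\<lambda>p. f p + g p) (x, \<xi>)
      = foldr deriv_x \<alpha> f (x, \<xi>) + foldr deriv_x \<alpha> g (x, \<xi>)" if "x \<in> K" for x \<xi>
      using assms that K unfolding x_symbol_def by (intro foldr_deriv_add(1)[OF open_TU]) auto
    ultimately show ?thesis by (simp cong: bounded_order_cong)
  qed
  moreover have "smooth_on (U \<times> UNIV) (\<lambda>p. f p + g p)"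
    using assms unfolding x_symbol_def by (intro smooth_on_add[OF open_TU]) auto
  ultimately show ?thesis unfolding x_symbol_def by simp
qed

text \<open>\<open>foldr\<close> applies the last entry of the list first. Peeling it off replaces
  the pair f, g by the two pairs with one factor differentiated, which satisfy the same hypotheses;
  this induction stands in for the general Leibniz formula.\<close>

lemma x_symbol_mult:
  assumes "x_symbol U r f" "x_symbol U s g"
  shows "x_symbol U (r + s) (\<lambda>p. f p * g p)"
proof -
  have "bounded_order K (r + s) (foldr deriv_x \<alpha> (\<lambda>p. f p * g p))"
    if K: "compact K" "K \<subseteq> U" for K \<alpha>
    using assms
  proof (induction \<alpha> arbitrary: f g rule: rev_induct)
    case Nil
    then have "bounded_order K r (foldr deriv_x [] f)" "bounded_order K s (foldr deriv_x [] g)"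
      using K unfolding x_symbol_def by blast+
    then show ?case by (simp add: bounded_order_mult)
  next
    case (snoc j \<alpha>)
    have sm: "smooth_on (U \<times> UNIV) f" "smooth_on (U \<times> UNIV) g"
      using snoc.prems unfolding x_symbol_def by blast+
    have "foldr deriv_x \<alpha> (deriv_x j (\<lambda>p. f p * g p)) (x, \<xi>) =
      foldr deriv_x \<alpha> (\<lambda>p. deriv_x j f p * g p) (x, \<xi>) +
      foldr deriv_x \<alpha> (\<lambda>p. f p * deriv_x j g p) (x, \<xi>)" (is "?L = ?R") if "x \<in> K" for x \<xi>
    proof -
      have "?L = foldr deriv_x \<alpha> (\<lambda>p. deriv_x j f p * g p + f p * deriv_x j g p) (x, \<xi>)"
        using sm K that unfolding deriv_x_def[of j]
        by (intro foldr_deriv_cong(1)[OF open_TU] dir_deriv_mult)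
           (auto intro: smooth_on_imp_differentiable)
      also have "\<dots> = ?R"
        using sm K that
        by (intro foldr_deriv_add(1)[OF open_TU] smooth_on_mult[OF open_TU] smooth_on_deriv_x) auto
      finally show ?thesis .
    qed
    moreover have "bounded_order K (r + s) (\<lambda>p.
      foldr deriv_x \<alpha> (\<lambda>p. deriv_x j f p * g p) p + foldr deriv_x \<alpha> (\<lambda>p. f p * deriv_x j g p) p)"
      by (intro bounded_order_add snoc.IH x_symbol_deriv_x snoc.prems)
    ultimately show ?case by (simp cong: bounded_order_cong)
  qed
  moreover have "smooth_on (U \<times> UNIV) (\<lambda>p. f p * g p)"
    using assms unfolding x_symbol_def by (intro smooth_on_mult[OF open_TU]) auto
  ultimately show ?thesis unfolding x_symbol_def by simp
qed

lemma x_symbol_mono: "x_symbol U r f \<Longrightarrow> r \<le> s \<Longrightarrow> x_symbol U s f"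
  unfolding x_symbol_def by (auto intro: bounded_order_mono)

lemma symbol_deriv_xi:
  assumes "symbol U r f"
  shows "symbol U (r - 1) (deriv_xi j f)"
proof -
  have "x_symbol U (r - 1 - real (length \<beta>)) (foldr deriv_xi \<beta> (deriv_xi j f))" for \<beta>
    using assms[unfolded symbol_iff_x_symbol, THEN conjunct2, rule_format, of "\<beta> @ [j]"]
    by (simp add: algebra_simps)
  with assms show ?thesis unfolding symbol_iff_x_symbol by (auto intro: smooth_on_deriv_xi)
qed

lemma symbol_add:
  assumes "symbol U r f" "symbol U r g"
  shows "symbol U r (\<lambda>p. f p + g p)"
proof -
  have "x_symbol U (r - real (length \<beta>)) (foldr deriv_xi \<beta> (\<lambda>p. f p + g p))" for \<beta>
  proof -
    have "x_symbol U (r - real (length \<beta>)) (\<lambda>p. foldr deriv_xi \<beta> f p + foldr deriv_xi \<beta> g p)"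
      using assms unfolding symbol_iff_x_symbol by (intro x_symbol_add) auto
    moreover have "foldr deriv_xi \<beta> (\<lambda>p. f p + g p) p
      = foldr deriv_xi \<beta> f p + foldr deriv_xi \<beta> g p" if "p \<in> U \<times> UNIV" for p
      using assms that unfolding symbol_iff_x_symbol by (intro foldr_deriv_add(2)[OF open_TU]) auto
    ultimately show ?thesis by (simp cong: x_symbol_cong)
  qed
  moreover have "smooth_on (U \<times> UNIV) (\<lambda>p. f p + g p)"
    using assms unfolding symbol_iff_x_symbol by (intro smooth_on_add[OF open_TU]) auto
  ultimately show ?thesis unfolding symbol_iff_x_symbol by simp
qed

text \<open>The induction of \<open>x_symbol_mult\<close> again. A \<xi>-derivative lowers by one
  the order of the factor that it hits, so the orders r and s have to be generalised along with f
  and g.\<close>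

lemma symbol_mult:
  assumes "symbol U r f" "symbol U s g"
  shows "symbol U (r + s) (\<lambda>p. f p * g p)"
proof -
  have "x_symbol U (r + s - real (length \<beta>)) (foldr deriv_xi \<beta> (\<lambda>p. f p * g p))" for \<beta>
    using assms
  proof (induction \<beta> arbitrary: f g r s rule: rev_induct)
    case Nil
    then have "x_symbol U r (foldr deriv_xi [] f)" "x_symbol U s (foldr deriv_xi [] g)"
      unfolding symbol_iff_x_symbol by (metis diff_zero list.size(3) of_nat_0)+
    then show ?case by (simp add: x_symbol_mult)
  next
    case (snoc j \<beta>)
    have sm: "smooth_on (U \<times> UNIV) f" "smooth_on (U \<times> UNIV) g"
      using snoc.prems unfolding symbol_iff_x_symbol by blast+
    have "foldr deriv_xi \<beta> (deriv_xi j (\<lambda>p. f p * g p)) p =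
      foldr deriv_xi \<beta> (\<lambda>p. deriv_xi j f p * g p) p +
      foldr deriv_xi \<beta> (\<lambda>p. f p * deriv_xi j g p) p" (is "?L = ?R") if "p \<in> U \<times> UNIV" for p
    proof -
      have "?L = foldr deriv_xi \<beta> (\<lambda>p. deriv_xi j f p * g p + f p * deriv_xi j g p) p"
        using sm that unfolding deriv_xi_def[of j]
        by (intro foldr_deriv_cong(2)[OF open_TU] dir_deriv_mult)
           (auto intro: smooth_on_imp_differentiable)
      also have "\<dots> = ?R"
        using sm that
        by (intro foldr_deriv_add(2)[OF open_TU] smooth_on_mult[OF open_TU] smooth_on_deriv_xi) auto
      finally show ?thesis .
    qed
    moreover have "x_symbol U (r + s - real (length (\<beta> @ [j]))) (\<lambda>p.
        foldr deriv_xi \<beta> (\<lambda>p. deriv_xi j f p * g p) p +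
        foldr deriv_xi \<beta> (\<lambda>p. f p * deriv_xi j g p) p)"
    proof (rule x_symbol_add)
      show "x_symbol U (r + s - real (length (\<beta> @ [j]))) (foldr deriv_xi \<beta> (\<lambda>p. deriv_xi j f p * g p))"
        using snoc.IH[OF symbol_deriv_xi[OF snoc.prems(1), of j] snoc.prems(2)] by (simp add: algebra_simps)
      show "x_symbol U (r + s - real (length (\<beta> @ [j]))) (foldr deriv_xi \<beta> (\<lambda>p. f p * deriv_xi j g p))"
        using snoc.IH[OF snoc.prems(1) symbol_deriv_xi[OF snoc.prems(2), of j]] by (simp add: algebra_simps)
    qed
    ultimately show ?case by (simp cong: x_symbol_cong)
  qed
  moreover have "smooth_on (U \<times> UNIV) (\<lambda>p. f p * g p)"
    using assms unfolding symbol_iff_x_symbol by (intro smooth_on_mult[OF open_TU]) auto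
  ultimately show ?thesis unfolding symbol_iff_x_symbol by simp
qed

lemma symbol_mono: "symbol U r f \<Longrightarrow> r \<le> s \<Longrightarrow> symbol U s f"
  unfolding symbol_iff_x_symbol by (auto intro: x_symbol_mono)

section \<open>Homogeneous functions, cut off near the zero section, as symbols\<close>

text \<open>Both sides of h(x, t \<xi>) = t^d h(x, \<xi>) are differentiated in (x, \<xi>). The
  chain rule puts a factor t on the fibre part of the direction, and uniqueness of the derivative
  equates the results.\<close>

lemma positively_homogeneous_dir_deriv:
  fixes t :: real
  assumes h: "positively_homogeneous U d h" and "x \<in> U" "t > 0" "\<xi> \<noteq> 0"
  shows "h differentiable (at (x, t *\<^sub>R \<xi>))"
    "dir_deriv (v, t *\<^sub>R w) h (x, t *\<^sub>R \<xi>) = of_real t powr d * dir_deriv (v, w) h (x, \<xi>)"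
proof -
  have diff: "h differentiable (at (x, \<xi>))" "h differentiable (at (x, t *\<^sub>R \<xi>))"
    using assms unfolding positively_homogeneous_def by (auto intro!: smooth_on_imp_differentiable)
  show "h differentiable (at (x, t *\<^sub>R \<xi>))" by (fact diff)
  have lin: "((\<lambda>q. (fst q, t *\<^sub>R snd q)) has_derivative (\<lambda>v. (fst v, t *\<^sub>R snd v))) (at (x, \<xi>))"
    by (auto intro!: derivative_eq_intros)
  have "(h has_derivative (\<lambda>v. dir_deriv v h (x, t *\<^sub>R \<xi>))) (at (fst (x, \<xi>), t *\<^sub>R snd (x, \<xi>)))"
    using dir_deriv_works[OF diff(2)] by simp
  from has_derivative_compose[OF lin this]
  have *: "((\<lambda>q. h (fst q, t *\<^sub>R snd q)) has_derivative
      (\<lambda>v. dir_deriv (fst v, t *\<^sub>R snd v) h (x, t *\<^sub>R \<xi>))) (at (x, \<xi>))" .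
  have "((\<lambda>q. of_real t powr d * h q) has_derivative
      (\<lambda>v. dir_deriv (fst v, t *\<^sub>R snd v) h (x, t *\<^sub>R \<xi>))) (at (x, \<xi>))"
  proof (rule has_derivative_transform_within_open[OF * open_TU0])
    show "(x, \<xi>) \<in> U \<times> - {0}" using assms by simp
    fix q :: "'n cotangent" assume "q \<in> U \<times> - {0}"
    then show "h (fst q, t *\<^sub>R snd q) = of_real t powr d * h q"
      using positively_homogeneousD[OF h, of "fst q" t "snd q"] assms by (simp add: mem_Times_iff)
  qed
  moreover have "((\<lambda>q. of_real t powr d * h q) has_derivative
      (\<lambda>v. of_real t powr d * dir_deriv v h (x, \<xi>))) (at (x, \<xi>))"
    using dir_deriv_works[OF diff(1)] by (rule has_derivative_mult_right)
  ultimately have "(\<lambda>v. dir_deriv (fst v, t *\<^sub>R snd v) h (x, t *\<^sub>R \<xi>)) =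
      (\<lambda>v. of_real t powr d * dir_deriv v h (x, \<xi>))"
    by (rule has_derivative_unique)
  from fun_cong[OF this, of "(v, w)"]
  show "dir_deriv (v, t *\<^sub>R w) h (x, t *\<^sub>R \<xi>) = of_real t powr d * dir_deriv (v, w) h (x, \<xi>)"
    by simp
qed

lemma positively_homogeneous_deriv_x:
  assumes h: "positively_homogeneous U d h"
  shows "positively_homogeneous U d (deriv_x j h)"
  using h positively_homogeneous_dir_deriv(2)[OF h, of _ _ _ "axis j 1" 0] smooth_on_deriv_x
  unfolding positively_homogeneous_def deriv_x_def by auto

lemma positively_homogeneous_deriv_xi:
  assumes h: "positively_homogeneous U d h"
  shows "positively_homogeneous U (d - 1) (deriv_xi j h)"
  unfolding positively_homogeneous_def
proof (intro conjI ballI allI impI)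
  show "smooth_on (U \<times> - {0}) (deriv_xi j h)"
    using h unfolding positively_homogeneous_def by (auto intro: smooth_on_deriv_xi)
  fix x \<xi> :: "real^'n" and t :: real assume *: "x \<in> U" "t > 0" "\<xi> \<noteq> 0"
  note D = positively_homogeneous_dir_deriv[OF h *]
  \<comment> \<open>Linearity moves t out of the direction; dividing by it is what lowers the degree
    by one.\<close>
  have "dir_deriv (0, t *\<^sub>R axis j 1) h (x, t *\<^sub>R \<xi>)
      = t *\<^sub>R dir_deriv (0, axis j 1) h (x, t *\<^sub>R \<xi>)"
    using linear_scale[OF has_derivative_linear[OF dir_deriv_works[OF D(1)]], of t "(0, axis j 1)"]
    by simp
  then show "deriv_xi j h (x, t *\<^sub>R \<xi>) = of_real t powr (d - 1) * deriv_xi j h (x, \<xi>)"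
    using D(2)[of 0 "axis j 1"] * unfolding deriv_xi_def
    by (simp add: powr_diff scaleR_conv_of_real field_simps)
qed

text \<open>The typical member is a cutoff function times a homogeneous function. Agreement is
  required on the open region |\<xi>| > 1, so that it passes to derivatives.\<close>

definition eventually_homogeneous :: "complex \<Rightarrow> ('n cotangent \<Rightarrow> complex) \<Rightarrow> bool" where
  "eventually_homogeneous d f \<longleftrightarrow> smooth_on (U \<times> UNIV) f \<and>
     (\<exists>h. positively_homogeneous U d h \<and> (\<forall>x\<in>U. \<forall>\<xi>. norm \<xi> > 1 \<longrightarrow> f (x, \<xi>) = h (x, \<xi>)))"

lemma eventually_homogeneous_deriv:
  assumes "eventually_homogeneous d f"
  shows "eventually_homogeneous d (deriv_x j f)" "eventually_homogeneous (d - 1) (deriv_xi j f)"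
proof -
  obtain h where h: "positively_homogeneous U d h" "\<And>x \<xi>. x \<in> U \<Longrightarrow> norm \<xi> > 1 \<Longrightarrow> f (x, \<xi>) = h (x, \<xi>)"
    and sm: "smooth_on (U \<times> UNIV) f"
    using assms unfolding eventually_homogeneous_def by blast
  have op: "open (U \<times> {\<xi> :: real^'n. norm \<xi> > 1})"
    by (intro open_Times U open_Collect_less continuous_intros)
  have "dir_deriv v f (x, \<xi>) = dir_deriv v h (x, \<xi>)" if "x \<in> U" "norm \<xi> > 1" for x \<xi> v
    using that h by (intro dir_deriv_cong[OF op]) auto
  then show "eventually_homogeneous d (deriv_x j f)" "eventually_homogeneous (d - 1) (deriv_xi j f)"
    using positively_homogeneous_deriv_x[OF h(1), of j] positively_homogeneous_deriv_xi[OF h(1), of j] sm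
    unfolding eventually_homogeneous_def deriv_x_def deriv_xi_def
    by (auto intro: smooth_on_dir_deriv)
qed

text \<open>Compactness bounds h on K times the unit sphere and f on K times the closed unit ball;
  homogeneity carries the first bound outwards along rays.\<close>

lemma eventually_homogeneous_bounded_order:
  assumes "eventually_homogeneous d f" "compact K" "K \<subseteq> U"
  shows "bounded_order K (Re d) f"
proof -
  let ?r = "Re d"
  obtain h where h: "positively_homogeneous U d h" "\<And>x \<xi>. x \<in> U \<Longrightarrow> norm \<xi> > 1 \<Longrightarrow> f (x, \<xi>) = h (x, \<xi>)"
    and sm: "smooth_on (U \<times> UNIV) f"
    using assms unfolding eventually_homogeneous_def by blast
  have "continuous_on (K \<times> sphere 0 1) h"
    using h(1) assms(3) unfolding positively_homogeneous_def
    by (auto intro: continuous_on_subset[OF smooth_on_imp_continuous])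
  then have "bounded (h ` (K \<times> sphere 0 1))"
    using assms(2) by (intro compact_imp_bounded compact_continuous_image compact_Times) auto
  then obtain B where B: "\<And>x \<omega>. x \<in> K \<Longrightarrow> norm \<omega> = 1 \<Longrightarrow> cmod (h (x, \<omega>)) \<le> B"
    unfolding bounded_iff by fastforce
  have "continuous_on (K \<times> cball 0 1) f"
    using sm assms(3) by (auto intro: continuous_on_subset[OF smooth_on_imp_continuous])
  then have "bounded (f ` (K \<times> cball 0 1))"
    using assms(2) by (intro compact_imp_bounded compact_continuous_image compact_Times) auto
  then obtain B' where B': "\<And>x \<xi>. x \<in> K \<Longrightarrow> norm \<xi> \<le> 1 \<Longrightarrow> cmod (f (x, \<xi>)) \<le> B'"
    unfolding bounded_iff by fastforce
  have "cmod (f (x, \<xi>)) \<le> 2 powr \<bar>?r\<bar> * (\<bar>B\<bar> + \<bar>B'\<bar>) * (1 + norm \<xi>) powr ?r" if x: "x \<in> K" for x \<xi>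
  proof (cases "norm \<xi> \<le> 1")
    case True
    have "1 \<le> 2 powr \<bar>?r\<bar> * (1 + norm \<xi>) powr ?r"
      using powr_comparison[of 1 "1 + norm \<xi>" ?r] True by (simp add: add_pos_nonneg)
    then have "\<bar>B'\<bar> * 1 \<le> (\<bar>B\<bar> + \<bar>B'\<bar>) * (2 powr \<bar>?r\<bar> * (1 + norm \<xi>) powr ?r)"
      by (intro mult_mono) auto
    then show ?thesis using B'[OF x True] by (simp add: mult_ac)
  next
    case False
    then have \<xi>: "norm \<xi> > 1" by simp
    let ?\<omega> = "\<xi> /\<^sub>R norm \<xi>"
    have "norm \<xi> *\<^sub>R ?\<omega> = \<xi>" using \<xi> by (simp add: field_simps)
    then have "f (x, \<xi>) = h (x, norm \<xi> *\<^sub>R ?\<omega>)" using h(2) x assms(3) \<xi> by auto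
    also have "\<dots> = of_real (norm \<xi>) powr d * h (x, ?\<omega>)"
      using x assms(3) \<xi> by (intro positively_homogeneousD[OF h(1)]) auto
    finally have "cmod (f (x, \<xi>)) = norm \<xi> powr ?r * cmod (h (x, ?\<omega>))"
      using \<xi> by (simp add: norm_mult norm_powr_real_powr)
    also have "\<dots> \<le> (2 powr \<bar>?r\<bar> * (1 + norm \<xi>) powr ?r) * (\<bar>B\<bar> + \<bar>B'\<bar>)"
    proof (intro mult_mono powr_comparison)
      have "norm \<xi> \<noteq> 0" using \<xi> by linarith
      then have "cmod (h (x, ?\<omega>)) \<le> B" by (intro B[OF x]) simp
      then show "cmod (h (x, ?\<omega>)) \<le> \<bar>B\<bar> + \<bar>B'\<bar>" by simp
    qed (use \<xi> in auto)
    finally show ?thesis by (simp add: mult_ac)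
  qed
  then show ?thesis unfolding bounded_order_def by blast
qed

text \<open>The class is stable under all derivatives and the degree drops by one with each
  \<xi>-derivative, so the single size bound \<open>eventually_homogeneous_bounded_order\<close>
  yields every symbol estimate.\<close>

lemma eventually_homogeneous_imp_symbol:
  assumes "eventually_homogeneous d f"
  shows "symbol U (Re d) f"
proof -
  have 1: "eventually_homogeneous (d - of_nat (length \<beta>)) (foldr deriv_xi \<beta> f)" for \<beta>
  proof (induction \<beta>)
    case (Cons j \<beta>)
    then show ?case using eventually_homogeneous_deriv(2)[OF Cons.IH, of j] by (simp add: algebra_simps)
  qed (simp add: assms)
  have 2: "eventually_homogeneous e (foldr deriv_x \<alpha> g)" if "eventually_homogeneous e g" for e g \<alpha>
    by (induction \<alpha>) (auto simp: that eventually_homogeneous_deriv)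
  have "x_symbol U (Re d - real (length \<beta>)) (foldr deriv_xi \<beta> f)" for \<beta>
    unfolding x_symbol_def
    using eventually_homogeneous_bounded_order[OF 2[OF 1]] 1 unfolding eventually_homogeneous_def by auto
  then show ?thesis
    using assms unfolding symbol_iff_x_symbol eventually_homogeneous_def by blast
qed

end


section \<open>Uniqueness of constant terms\<close>

text \<open>In the variable \<open>t = ln R\<close>, the operator taking \<open>f t\<close> to \<open>f (t + h) - exp (w h) f t\<close> annihilates
  \<open>exp (w t)\<close> but, if \<open>exp (w h) \<noteq> 1\<close>, no nonzero \<open>b t + c\<close>.\<close>
lemma exponential_sum_tendsto_0:
  fixes a :: "complex \<Rightarrow> complex" and b c :: complex
  assumes "finite A" "0 \<notin> A"
    and "((\<lambda>t. (\<Sum>z\<in>A. a z * exp (z * of_real t)) + b * of_real t + c) \<longlongrightarrow> 0) at_top"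
  shows "b = 0 \<and> c = 0"
proof -
  have shift: "((\<lambda>t. F (h + t) - k * F t) \<longlongrightarrow> 0) at_top"
    if "(F \<longlongrightarrow> 0) at_top" for F :: "real \<Rightarrow> complex" and h k
  proof -
    have "filterlim (\<lambda>t. h + t) at_top at_top"
      by (rule filterlim_tendsto_add_at_top[OF tendsto_const filterlim_ident])
    from filterlim_compose[OF that this] tendsto_mult_right_zero[OF that, of k]
    show ?thesis using tendsto_diff by fastforce
  qed
  show ?thesis
    using assms
  proof (induction A arbitrary: a b c)
    case empty
    then have lim: "((\<lambda>t. b * of_real t + c) \<longlongrightarrow> 0) at_top" by simp
    from shift[OF this, of 1 1] have "((\<lambda>t::real. b) \<longlongrightarrow> 0) at_top"
      by (simp add: algebra_simps)
    then have "b = 0" by (simp add: tendsto_const_iff)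
    with lim show ?case by (simp add: tendsto_const_iff)
  next
    case (insert w A)
    then have w: "w \<noteq> 0" by auto
    \<comment> \<open>This makes |w h| = 1, whereas the nonzero solutions of exp z = 1 have modulus
      at least 2 pi. Hence the multiplier k differs from 1.\<close>
    define h where "h = 1 / norm w"
    define k where "k = exp (w * of_real h)"
    have "k \<noteq> 1"
    proof
      assume "k = 1"
      then obtain n :: int where n: "Re (w * of_real h) = 0" "Im (w * of_real h) = of_int (2 * n) * pi"
        unfolding k_def exp_eq_1 by blast
      have "norm (w * of_real h) = 1" using w by (simp add: h_def norm_mult norm_divide)
      then have "\<bar>of_int (2 * n) * pi\<bar> = 1" using n by (simp add: cmod_eq_Im)
      then have "real_of_int \<bar>2 * n\<bar> * pi = 1" by (simp add: abs_mult)
      moreover have "n \<noteq> 0" using calculation by auto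
      then have "2 \<le> real_of_int \<bar>2 * n\<bar>" by linarith
      then have "2 * pi \<le> real_of_int \<bar>2 * n\<bar> * pi" by (intro mult_right_mono) auto
      ultimately show False using pi_gt3 by linarith
    qed
    let ?F = "\<lambda>t. (\<Sum>z\<in>insert w A. a z * exp (z * of_real t)) + b * of_real t + c"
    have "?F (h + t) - k * ?F t = (\<Sum>z\<in>A. (a z * (exp (z * of_real h) - k)) * exp (z * of_real t))
        + (b * (1 - k)) * of_real t + (b * of_real h + c * (1 - k))" for t
    proof -
      have "(\<Sum>z\<in>A. a z * exp (z * of_real (h + t))) - k * (\<Sum>z\<in>A. a z * exp (z * of_real t))
        = (\<Sum>z\<in>A. (a z * (exp (z * of_real h) - k)) * exp (z * of_real t))"
        by (simp add: sum_distrib_left sum_subtractf[symmetric] exp_add algebra_simps)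
      moreover have "a w * exp (w * of_real (h + t)) = k * (a w * exp (w * of_real t))"
        by (simp add: k_def exp_add algebra_simps)
      ultimately show ?thesis using insert.hyps by (simp add: algebra_simps)
    qed
    \<comment> \<open>The exponent w has disappeared and the affine part is still affine, so the
      induction hypothesis applies; since k \<noteq> 1, its first equation gives b = 0 and then the
      second gives c = 0.\<close>
    with shift[OF insert.prems(2), of h k]
    have "b * (1 - k) = 0 \<and> b * of_real h + c * (1 - k) = 0"
      by (intro insert.IH) (use insert.prems in auto)
    then show ?case using \<open>k \<noteq> 1\<close> by auto
  qed
qed

lemma powr_sum_tendsto_0:
  fixes a :: "complex \<Rightarrow> complex" and b c :: complex
  assumes "finite A" "0 \<notin> A"
    and "((\<lambda>R. (\<Sum>z\<in>A. a z * of_real R powr z) + b * of_real (ln R) + c) \<longlongrightarrow> 0) at_top"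
  shows "c = 0"
proof -
  have "((\<lambda>t. (\<Sum>z\<in>A. a z * of_real (exp t) powr z) + b * of_real (ln (exp t)) + c) \<longlongrightarrow> 0) at_top"
    by (rule filterlim_compose[OF assms(3) exp_at_top])
  moreover have "complex_of_real (exp t) powr z = exp (z * of_real t)" for t z
    by (simp add: powr_def Ln_of_real flip: exp_of_real)
  ultimately have "((\<lambda>t. (\<Sum>z\<in>A. a z * exp (z * of_real t)) + b * of_real t + c) \<longlongrightarrow> 0) at_top"
    by simp
  from exponential_sum_tendsto_0[OF assms(1,2) this] show ?thesis ..
qed

lemma has_constant_term_unique:
  assumes "has_constant_term F c" "has_constant_term F c'"
  shows "c = c'"
proof -
  obtain A a b where A: "finite A" "0 \<notin> A"
    "((\<lambda>R. F R - ((\<Sum>z\<in>A. a z * of_real R powr z) + b * of_real (ln R) + c)) \<longlongrightarrow> 0) at_top"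
    using assms(1) unfolding has_constant_term_def by blast
  obtain A' a' b' where A': "finite A'" "0 \<notin> A'"
    "((\<lambda>R. F R - ((\<Sum>z\<in>A'. a' z * of_real R powr z) + b' * of_real (ln R) + c')) \<longlongrightarrow> 0) at_top"
    using assms(2) unfolding has_constant_term_def by blast
  \<comment> \<open>Both coefficient families are extended by 0 to the union of the exponent sets,
    so that the two expansions can be subtracted.\<close>
  let ?e = "\<lambda>z. (if z \<in> A' then a' z else 0) - (if z \<in> A then a z else 0)"
  have split: "(\<Sum>z\<in>A \<union> A'. ?e z * g z) = (\<Sum>z\<in>A'. a' z * g z) - (\<Sum>z\<in>A. a z * g z)" for g
  proof -
    have "(\<Sum>z\<in>A \<union> A'. ?e z * g z) = (\<Sum>z\<in>A \<union> A'. (if z \<in> A' then a' z * g z else 0))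
      - (\<Sum>z\<in>A \<union> A'. (if z \<in> A then a z * g z else 0))"
      unfolding sum_subtractf[symmetric] by (rule sum.cong) (auto simp: algebra_simps)
    then show ?thesis using A A' by (simp add: sum.If_cases Int_absorb1 Int_commute)
  qed
  have "((\<lambda>R. (\<Sum>z\<in>A \<union> A'. ?e z * of_real R powr z) + (b' - b) * of_real (ln R) + (c' - c)) \<longlongrightarrow> 0) at_top"
    using tendsto_diff[OF A(3) A'(3)] unfolding split by (simp add: algebra_simps)
  from powr_sum_tendsto_0[OF _ _ this] A A' show ?thesis by auto
qed

lemma constant_term_eqI: "has_constant_term F c \<Longrightarrow> constant_term F = c"
  unfolding constant_term_def using has_constant_term_unique by blast


section \<open>Expansions into homogeneous components\<close>

lemma positively_homogeneous_zero: "open U \<Longrightarrow> positively_homogeneous U d (\<lambda>_. 0)"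
  unfolding positively_homogeneous_def by (simp add: smooth_on_const open_TU0)

lemma positively_homogeneous_add:
  assumes "open U" "positively_homogeneous U d f" "positively_homogeneous U d g"
  shows "positively_homogeneous U d (\<lambda>p. f p + g p)"
  using assms smooth_on_add[OF open_TU0[OF assms(1)], of f g]
  unfolding positively_homogeneous_def by (auto simp: algebra_simps)

lemma positively_homogeneous_mult:
  assumes "open U" "positively_homogeneous U d f" "positively_homogeneous U e g"
  shows "positively_homogeneous U (d + e) (\<lambda>p. f p * g p)"
  using assms smooth_on_mult[OF open_TU0[OF assms(1)], of f g]
  unfolding positively_homogeneous_def by (auto simp: powr_add algebra_simps)

lemma positively_homogeneous_cmult:
  assumes "open U" "positively_homogeneous U d f"
  shows "positively_homogeneous U d (\<lambda>p. a * f p)"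
  using assms smooth_on_mult[OF open_TU0[OF assms(1)] smooth_on_const[OF open_TU0[OF assms(1)]], of f a]
  unfolding positively_homogeneous_def by (auto simp: algebra_simps)

lemma positively_homogeneous_sum:
  assumes "open U" "\<And>i. i \<in> I \<Longrightarrow> positively_homogeneous U d (f i)"
  shows "positively_homogeneous U d (\<lambda>p. \<Sum>i\<in>I. f i p)"
  using assms(2)
  by (induction I rule: infinite_finite_induct)
     (auto intro: positively_homogeneous_zero positively_homogeneous_add assms(1))

lemma positively_homogeneous_minus:
  assumes "open U" "positively_homogeneous U d f" "positively_homogeneous U d g"
  shows "positively_homogeneous U d (\<lambda>p. f p - g p)"
  using positively_homogeneous_add[OF assms(1,2) positively_homogeneous_cmult[OF assms(1,3), of "- 1"]]
  by simp

section \<open>Truncated homogeneous expansions and their stability under the algebra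
  operations\<close>

locale cutoff =
  fixes U :: "(real^'n::finite) set" and \<psi> :: "'n cotangent \<Rightarrow> complex"
  assumes U: "open U" and \<psi>: "cutoff_function U \<psi>"
begin

lemma \<psi>_eq_0: "x \<in> U \<Longrightarrow> norm \<xi> \<le> 1/2 \<Longrightarrow> \<psi> (x, \<xi>) = 0"
  using \<psi> unfolding cutoff_function_def by blast

lemma \<psi>_eq_1: "x \<in> U \<Longrightarrow> norm \<xi> \<ge> 1 \<Longrightarrow> \<psi> (x, \<xi>) = 1"
  using \<psi> unfolding cutoff_function_def by blast

text \<open>h may be singular on the zero section, but the product vanishes for |\<xi>| < 1/2. That
  region and \<xi> \<noteq> 0 form an open cover, and smoothness is local.\<close>

lemma smooth_on_\<psi>_mult:
  assumes "smooth_on (U \<times> - {0}) h"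
  shows "smooth_on (U \<times> UNIV) (\<lambda>p. \<psi> p * h p)"
proof -
  have op: "open (U \<times> ball (0 :: real^'n) (1/2))" using U by (intro open_Times) auto
  have "smooth_on (U \<times> - {0}) (\<lambda>p. \<psi> p * h p)"
    using \<psi> assms unfolding cutoff_function_def
    by (intro smooth_on_mult[OF open_TU0[OF U]]) (auto intro: smooth_on_subset)
  moreover have "smooth_on (U \<times> ball 0 (1/2)) (\<lambda>p. \<psi> p * h p)"
    by (subst smooth_on_cong[OF op, of _ "\<lambda>_. 0"]) (auto simp: \<psi>_eq_0 intro: smooth_on_const[OF op])
  ultimately have "smooth_on ((U \<times> - {0}) \<union> (U \<times> ball 0 (1/2))) (\<lambda>p. \<psi> p * h p)"
    by (intro smooth_on_Un open_TU0[OF U] op)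
  moreover have "(U \<times> - {0}) \<union> (U \<times> ball 0 (1/2)) = U \<times> (UNIV :: (real^'n) set)" by auto
  ultimately show ?thesis by simp
qed

lemma symbol_\<psi>_mult:
  assumes "positively_homogeneous U d h"
  shows "symbol U (Re d) (\<lambda>p. \<psi> p * h p)"
proof (rule eventually_homogeneous_imp_symbol[OF U])
  show "eventually_homogeneous U d (\<lambda>p. \<psi> p * h p)"
    unfolding eventually_homogeneous_def[OF U] using assms
    by (auto simp: \<psi>_eq_1 positively_homogeneous_def intro!: smooth_on_\<psi>_mult exI[of _ h])
qed

lemma symbol_const: "symbol U 0 (\<lambda>_. a)"
proof -
  have "symbol U (Re 0) (\<lambda>_. a)"
    by (rule eventually_homogeneous_imp_symbol[OF U])
       (auto simp: eventually_homogeneous_def[OF U] positively_homogeneous_def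
          smooth_on_const open_TU[OF U] open_TU0[OF U] intro!: exI[of _ "\<lambda>_. a"])
  then show ?thesis by simp
qed

text \<open>Symbols vanishing for \<open>|\<xi>| > 1\<close> have every order, being homogeneous of every degree there.\<close>
lemma symbol_compact_fibres:
  assumes "smooth_on (U \<times> UNIV) f" "\<And>x \<xi>. x \<in> U \<Longrightarrow> norm \<xi> > 1 \<Longrightarrow> f (x, \<xi>) = 0"
  shows "symbol U r f"
proof -
  have "symbol U (Re (of_real r)) f"
    by (rule eventually_homogeneous_imp_symbol[OF U])
       (use assms positively_homogeneous_zero[OF U, of "of_real r"] in \<open>auto simp: eventually_homogeneous_def[OF U]\<close>)
  then show ?thesis by simp
qed

lemma symbol_zero: "symbol U r (\<lambda>_. 0)"
  by (rule symbol_compact_fibres) (auto intro: smooth_on_const open_TU[OF U])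

lemma symbol_cmult: "symbol U r f \<Longrightarrow> symbol U r (\<lambda>p. a * f p)"
  using symbol_mult[OF U symbol_const[of a]] by fastforce

lemma symbol_minus: "symbol U r f \<Longrightarrow> symbol U r g \<Longrightarrow> symbol U r (\<lambda>p. f p - g p)"
  using symbol_add[OF U, of r f "\<lambda>p. - 1 * g p"] symbol_cmult[of r g "- 1"] by simp

lemma symbol_sum:
  "(\<And>i. i \<in> I \<Longrightarrow> symbol U r (f i)) \<Longrightarrow> symbol U r (\<lambda>p. \<Sum>i\<in>I. f i p)"
  by (induction I rule: infinite_finite_induct) (auto intro: symbol_zero symbol_add[OF U])

text \<open>A product of two cut-off components carries \<open>\<psi>\<close> squared, while an
  expansion allows \<open>\<psi>\<close> only once. The discrepancy vanishes for |\<xi>| \<ge> 1 and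
  is therefore a symbol of every order.\<close>

lemma symbol_\<psi>_defect:
  assumes h: "positively_homogeneous U d h"
  shows "symbol U r (\<lambda>p. (\<psi> p * \<psi> p - \<psi> p) * h p)"
proof (rule symbol_compact_fibres)
  have 1: "symbol U (Re d) (\<lambda>p. \<psi> p * h p)" by (rule symbol_\<psi>_mult[OF h])
  have s: "smooth_on (U \<times> UNIV) (\<lambda>p. \<psi> p - 1)"
    using smooth_on_add[OF open_TU[OF U], of \<psi> "\<lambda>_. - 1"] \<psi>
      smooth_on_const[OF open_TU[OF U], of "- 1 :: complex"]
    unfolding cutoff_function_def by simp
  have "smooth_on (U \<times> UNIV) (\<lambda>p. (\<psi> p - 1) * (\<psi> p * h p))"
    by (intro smooth_on_mult[OF open_TU[OF U]] s symbol_imp_smooth[OF 1])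
  then show "smooth_on (U \<times> UNIV) (\<lambda>p. (\<psi> p * \<psi> p - \<psi> p) * h p)"
    by (simp add: algebra_simps)
qed (simp add: \<psi>_eq_1)

text \<open>An expansion truncated at one order r. Nothing links the data for different r, and D may
  contain degrees below r; this looseness is what makes the notion easy to preserve under sums and
  products.\<close>

definition approximates ::
    "real \<Rightarrow> ('n cotangent \<Rightarrow> complex) \<Rightarrow> complex set \<Rightarrow> (complex \<Rightarrow> 'n cotangent \<Rightarrow> complex) \<Rightarrow> bool" where
  "approximates r \<sigma> D c \<longleftrightarrow> finite D \<and> (\<forall>d\<in>D. positively_homogeneous U d (c d)) \<and>
     symbol U r (\<lambda>p. \<sigma> p - (\<Sum>d\<in>D. \<psi> p * c d p))"

text \<open>Some crude common order M is all that is wanted: in a product, the remainder of one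
  factor has to be chosen relative to the order of the other factor.\<close>

lemma approximates_symbol:
  assumes "approximates r \<sigma> D c"
  obtains M where "symbol U M (\<lambda>p. \<Sum>d\<in>D. \<psi> p * c d p)" "symbol U M \<sigma>"
proof -
  let ?M = "Max (insert r (Re ` D))" and ?s = "\<lambda>p. \<Sum>d\<in>D. \<psi> p * c d p"
  have fin: "finite D" and r: "symbol U r (\<lambda>p. \<sigma> p - ?s p)"
    using assms unfolding approximates_def by blast+
  have "symbol U ?M ?s"
  proof (rule symbol_sum)
    fix d assume d: "d \<in> D"
    then have "symbol U (Re d) (\<lambda>p. \<psi> p * c d p)"
      using assms unfolding approximates_def by (intro symbol_\<psi>_mult) blast
    then show "symbol U ?M (\<lambda>p. \<psi> p * c d p)"
      by (rule symbol_mono[OF U]) (use fin d in auto)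
  qed
  moreover have "symbol U ?M (\<lambda>p. \<sigma> p - ?s p)"
    using r by (rule symbol_mono[OF U]) (use fin in auto)
  ultimately show thesis
    using that[of ?M] symbol_add[OF U, of ?M "\<lambda>p. \<sigma> p - ?s p" ?s] by simp
qed

lemma approximates_add:
  assumes "approximates r \<sigma> D c" "approximates r \<tau> E e"
  shows "approximates r (\<lambda>p. \<sigma> p + \<tau> p) (D \<union> E)
     (\<lambda>d p. (if d \<in> D then c d p else 0) + (if d \<in> E then e d p else 0))"
proof -
  have fin: "finite D" "finite E" using assms unfolding approximates_def by blast+
  have "positively_homogeneous U d (\<lambda>p. (if d \<in> D then c d p else 0) + (if d \<in> E then e d p else 0))" for d
  proof (rule positively_homogeneous_add[OF U])
    show "positively_homogeneous U d (\<lambda>p. if d \<in> D then c d p else 0)"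
      using assms positively_homogeneous_zero[OF U] unfolding approximates_def by (cases "d \<in> D") auto
    show "positively_homogeneous U d (\<lambda>p. if d \<in> E then e d p else 0)"
      using assms positively_homogeneous_zero[OF U] unfolding approximates_def by (cases "d \<in> E") auto
  qed
  moreover have "(\<Sum>d\<in>D \<union> E. \<psi> p * ((if d \<in> D then c d p else 0) + (if d \<in> E then e d p else 0)))
      = (\<Sum>d\<in>D. \<psi> p * c d p) + (\<Sum>d\<in>E. \<psi> p * e d p)" for p
  proof -
    have "(\<Sum>d\<in>D \<union> E. \<psi> p * ((if d \<in> D then c d p else 0) + (if d \<in> E then e d p else 0)))
      = (\<Sum>d\<in>D \<union> E. if d \<in> D then \<psi> p * c d p else 0) + (\<Sum>d\<in>D \<union> E. if d \<in> E then \<psi> p * e d p else 0)"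
      unfolding sum.distrib[symmetric] by (rule sum.cong) (auto simp: algebra_simps)
    then show ?thesis using fin by (simp add: sum.If_cases Int_absorb1 Int_commute)
  qed
  moreover have "symbol U r (\<lambda>p. (\<sigma> p - (\<Sum>d\<in>D. \<psi> p * c d p)) + (\<tau> p - (\<Sum>d\<in>E. \<psi> p * e d p)))"
    using assms unfolding approximates_def by (intro symbol_add[OF U]) blast+
  ultimately show ?thesis using fin unfolding approximates_def by (simp add: algebra_simps)
qed

lemma approximates_cmult:
  assumes "approximates r \<sigma> D c"
  shows "approximates r (\<lambda>p. a * \<sigma> p) D (\<lambda>d p. a * c d p)"
  using assms symbol_cmult[of r "\<lambda>p. \<sigma> p - (\<Sum>d\<in>D. \<psi> p * c d p)" a]
  unfolding approximates_def
  by (auto intro: positively_homogeneous_cmult[OF U] simp: right_diff_distrib sum_distrib_left mult_ac)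

text \<open>With S and T the truncated sums of \<sigma> and \<tau>, one has \<sigma> \<tau> - S T =
  \<sigma> (\<tau> - T) + T (\<sigma> - S), and the hypotheses give both terms order r. S T is then
  a sum of products of components, up to the defect of \<open>\<psi>\<close> squared.\<close>

lemma approximates_mult:
  assumes \<sigma>: "symbol U (r - r1) \<sigma>" "approximates r1 \<tau> E e"
    and \<tau>: "symbol U (r - r2) (\<lambda>p. \<Sum>d\<in>E. \<psi> p * e d p)" "approximates r2 \<sigma> D c"
  shows "\<exists>D c. approximates r (\<lambda>p. \<sigma> p * \<tau> p) D c"
proof -
  have fin: "finite (D \<times> E)"
    and hom: "\<And>d. d \<in> D \<Longrightarrow> positively_homogeneous U d (c d)" "\<And>d. d \<in> E \<Longrightarrow> positively_homogeneous U d (e d)"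
    using assms unfolding approximates_def by auto
  \<comment> \<open>Different pairs of degrees may have the same sum, so the products are collected
    by total degree.\<close>
  let ?P = "\<lambda>(a, b). a + b" and ?g = "\<lambda>(a, b) p. c a p * e b p"
  let ?h = "\<lambda>d p. \<Sum>x\<in>{x \<in> D \<times> E. ?P x = d}. ?g x p"
  have hom_g: "positively_homogeneous U (?P x) (?g x)" if "x \<in> D \<times> E" for x
    using that hom by (auto intro: positively_homogeneous_mult[OF U])
  have "positively_homogeneous U d (?h d)" for d
    using hom_g by (intro positively_homogeneous_sum[OF U]) auto
  moreover have group: "(\<Sum>d\<in>?P ` (D \<times> E). \<psi> p * ?h d p) = (\<Sum>x\<in>D \<times> E. \<psi> p * ?g x p)" for p
    unfolding sum_distrib_left by (rule sum.image_gen[OF fin, symmetric])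
  moreover have "symbol U r (\<lambda>p. \<sigma> p * \<tau> p - (\<Sum>d\<in>?P ` (D \<times> E). \<psi> p * ?h d p))"
  proof -
    let ?S = "\<lambda>p. \<Sum>d\<in>D. \<psi> p * c d p" and ?T = "\<lambda>p. \<Sum>d\<in>E. \<psi> p * e d p"
    have "symbol U (r - r1 + r1) (\<lambda>p. \<sigma> p * (\<tau> p - ?T p))"
      using assms unfolding approximates_def by (intro symbol_mult[OF U]) blast+
    moreover have "symbol U (r - r2 + r2) (\<lambda>p. ?T p * (\<sigma> p - ?S p))"
      using assms unfolding approximates_def by (intro symbol_mult[OF U]) blast+
    moreover have "symbol U r (\<lambda>p. \<Sum>x\<in>D \<times> E. (\<psi> p * \<psi> p - \<psi> p) * ?g x p)"
      by (intro symbol_sum symbol_\<psi>_defect[OF hom_g])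
    ultimately have "symbol U r (\<lambda>p. (\<sigma> p * (\<tau> p - ?T p) + ?T p * (\<sigma> p - ?S p))
        + (\<Sum>x\<in>D \<times> E. (\<psi> p * \<psi> p - \<psi> p) * ?g x p))"
      by (intro symbol_add[OF U]) simp_all
    moreover have "(\<sigma> p * (\<tau> p - ?T p) + ?T p * (\<sigma> p - ?S p))
        + (\<Sum>x\<in>D \<times> E. (\<psi> p * \<psi> p - \<psi> p) * ?g x p)
        = \<sigma> p * \<tau> p - (\<Sum>d\<in>?P ` (D \<times> E). \<psi> p * ?h d p)" for p
    proof -
      have "?S p * ?T p = (\<Sum>x\<in>D \<times> E. \<psi> p * \<psi> p * ?g x p)"
        unfolding sum_product sum.cartesian_product by (rule sum.cong) auto
      then have "(\<Sum>x\<in>D \<times> E. (\<psi> p * \<psi> p - \<psi> p) * ?g x p)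
          = ?S p * ?T p - (\<Sum>x\<in>D \<times> E. \<psi> p * ?g x p)"
        by (simp only: left_diff_distrib sum_subtractf)
      then show ?thesis unfolding group by (simp only:) (simp add: algebra_simps)
    qed
    ultimately show ?thesis by (simp only:)
  qed
  ultimately have "approximates r (\<lambda>p. \<sigma> p * \<tau> p) (?P ` (D \<times> E)) ?h"
    unfolding approximates_def using fin by blast
  then show ?thesis by blast
qed

text \<open>The degree set is kept explicit because the non-integer case reads off from it that 1 -
  n does not occur.\<close>

lemma classical_symbol_approximates:
  assumes "classical_symbol \<psi> U m \<sigma>"
  shows "\<exists>N c. approximates r \<sigma> ((\<lambda>i. m - of_nat i) ` {0..N::nat}) c"
proof -
  obtain s where s: "\<And>i. positively_homogeneous U (m - of_nat i) (s i)"
    "\<And>N. N \<ge> 1 \<Longrightarrow> symbol U (Re m - real N - 1) (\<lambda>p. \<sigma> p - (\<Sum>i=0..N. \<psi> p * s i p))"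
    using assms unfolding classical_symbol_def by blast
  obtain N0 :: nat where N0: "Re m - r \<le> real N0" using real_arch_simple by blast
  \<comment> \<open>The successor secures N \<ge> 1, the range in which a classical symbol controls
    the remainder.\<close>
  define N where "N = Suc N0"
  define c where "c = (\<lambda>d. s (inv_into UNIV (\<lambda>i. m - of_nat i) d))"
  have inj: "inj (\<lambda>i::nat. m - of_nat i)" by (auto simp: inj_def)
  have c: "c (m - of_nat i) = s i" for i unfolding c_def using inv_f_f[OF inj, of i] by simp
  have "symbol U r (\<lambda>p. \<sigma> p - (\<Sum>i=0..N. \<psi> p * s i p))"
    by (rule symbol_mono[OF U s(2)]) (use N0 in \<open>auto simp: N_def\<close>)
  moreover have "(\<Sum>d\<in>(\<lambda>i. m - of_nat i) ` {0..N}. \<psi> p * c d p) = (\<Sum>i=0..N. \<psi> p * s i p)" for p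
    by (subst sum.reindex) (use inj in \<open>auto simp: inj_def inj_on_def c\<close>)
  ultimately have "approximates r \<sigma> ((\<lambda>i. m - of_nat i) ` {0..N}) c"
    unfolding approximates_def using s(1) c by auto
  then show ?thesis by blast
qed

lemma CS_com_approximates:
  assumes "\<sigma> \<in> CS_com \<psi> U"
  shows "\<exists>D c. approximates r \<sigma> D c"
  using assms
proof (induction arbitrary: r)
  case (generator \<sigma> m)
  then show ?case using classical_symbol_approximates unfolding CS_com_of_order_def by blast
next
  case (add \<sigma> \<tau>)
  then show ?case using approximates_add by meson
next
  case (scale \<sigma> a)
  then show ?case using approximates_cmult by meson
next
  case (mult \<sigma> \<tau>)
  \<comment> \<open>The choices are ordered so as not to be circular: an arbitrary truncation of
    \<sigma> yields its order M, then \<tau> is truncated at r - M, and the order M' of that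
    truncated sum dictates a second truncation of \<sigma>.\<close>
  obtain D0 c0 where "approximates 0 \<sigma> D0 c0" using mult.IH(1) by blast
  then obtain M where M: "symbol U M \<sigma>" by (rule approximates_symbol)
  obtain E e where E: "approximates (r - M) \<tau> E e" using mult.IH(2) by blast
  then obtain M' where M': "symbol U M' (\<lambda>p. \<Sum>d\<in>E. \<psi> p * e d p)" by (rule approximates_symbol)
  obtain D c where D: "approximates (r - M') \<sigma> D c" using mult.IH(1) by blast
  show ?case by (rule approximates_mult[OF _ E _ D]) (use M M' in simp_all)
qed

section \<open>Uniqueness of components and existence of a full expansion\<close>

text \<open>Along the ray R \<xi>, division by R^e turns the sum into \<open>c e (x, \<xi>)\<close>
  plus powers R^(d - e) with nonzero exponents, and the bound forces this to tend to 0. Uniqueness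
  of constant terms then applies, even when several degrees share the real part of e.\<close>

lemma homogeneous_sum_bounded_order_imp_0:
  assumes "finite D" and hom: "\<And>d. d \<in> D \<Longrightarrow> positively_homogeneous U d (c d)"
    and bnd: "bounded_order {x} r (\<lambda>p. \<Sum>d\<in>D. \<psi> p * c d p)"
    and "x \<in> U" "\<xi> \<noteq> 0" "e \<in> D" "Re e > r"
  shows "c e (x, \<xi>) = 0"
proof -
  obtain C where C: "C \<ge> 0"
    "\<And>\<xi>. cmod (\<Sum>d\<in>D. \<psi> (x, \<xi>) * c d (x, \<xi>)) \<le> C * (1 + norm \<xi>) powr r"
    using bounded_order_nonneg[OF bnd] by (metis singletonI)
  let ?k = "norm \<xi>" and ?A = "(\<lambda>d. d - e) ` (D - {e})"
  let ?F = "\<lambda>R. (\<Sum>d\<in>D. c d (x, \<xi>) * of_real R powr (d - e))"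
  have k: "?k > 0" using assms by simp
  have "(?F \<longlongrightarrow> 0) at_top"
  proof (rule Lim_null_comparison)
    let ?B = "\<lambda>R. C * 2 powr \<bar>r\<bar> * ?k powr r * R powr (r - Re e)"
    show "eventually (\<lambda>R. norm (?F R) \<le> ?B R) at_top"
      \<comment> \<open>From this radius on, R \<xi> has norm at least 1, where
        \<open>\<psi>\<close> equals 1.\<close>
      using eventually_ge_at_top[of "1 / ?k"]
    proof eventually_elim
      case (elim R)
      have "1 / ?k > 0" using k by simp
      then have R: "R > 0" using elim by linarith
      have Rk: "R * ?k \<ge> 1" using elim k by (simp add: field_simps)
      have R\<xi>: "norm (R *\<^sub>R \<xi>) = R * ?k" using R by simp
      have "(\<Sum>d\<in>D. \<psi> (x, R *\<^sub>R \<xi>) * c d (x, R *\<^sub>R \<xi>)) = (\<Sum>d\<in>D. of_real R powr d * c d (x, \<xi>))"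
        using R Rk R\<xi> assms by (intro sum.cong) (auto simp: \<psi>_eq_1 positively_homogeneousD[OF hom])
      also have "\<dots> = of_real R powr e * ?F R"
        unfolding sum_distrib_left using R by (intro sum.cong) (auto simp: powr_diff field_simps)
      finally have "R powr Re e * norm (?F R) = cmod (\<Sum>d\<in>D. \<psi> (x, R *\<^sub>R \<xi>) * c d (x, R *\<^sub>R \<xi>))"
        using R by (simp add: norm_mult norm_powr_real_powr)
      also have "\<dots> \<le> C * (1 + R * ?k) powr r" using C(2)[of "R *\<^sub>R \<xi>"] unfolding R\<xi> .
      also have "\<dots> \<le> C * (2 powr \<bar>r\<bar> * (R * ?k) powr r)"
        using C(1) R Rk by (intro mult_left_mono powr_comparison) auto
      finally have "R powr Re e * norm (?F R) \<le> R powr Re e * ?B R"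
        using R k by (simp add: powr_mult powr_diff field_simps)
      then show ?case using R by simp
    qed
    have "((\<lambda>R. R powr (r - Re e)) \<longlongrightarrow> 0) at_top"
      using assms by (intro tendsto_neg_powr filterlim_ident) simp
    from tendsto_mult_right_zero[OF this]
    show "(?B \<longlongrightarrow> 0) at_top" .
  qed
  moreover have "eventually (\<lambda>R. ?F R = (\<Sum>z\<in>?A. c (z + e) (x, \<xi>) * of_real R powr z)
      + 0 * of_real (ln R) + c e (x, \<xi>)) at_top"
    using eventually_gt_at_top[of "0::real"]
  proof eventually_elim
    case (elim R)
    have "?F R = c e (x, \<xi>) * of_real R powr (e - e) + (\<Sum>d\<in>D - {e}. c d (x, \<xi>) * of_real R powr (d - e))"
      using assms(1,6) by (rule sum.remove)
    also have "(\<Sum>d\<in>D - {e}. c d (x, \<xi>) * of_real R powr (d - e))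
        = (\<Sum>z\<in>?A. c (z + e) (x, \<xi>) * of_real R powr z)"
      by (subst sum.reindex) (auto simp: inj_on_def)
    finally show ?case using elim by simp
  qed
  ultimately have "((\<lambda>R. (\<Sum>z\<in>?A. c (z + e) (x, \<xi>) * of_real R powr z)
      + 0 * of_real (ln R) + c e (x, \<xi>)) \<longlongrightarrow> 0) at_top"
    by (rule Lim_transform_eventually)
  then show ?thesis by (rule powr_sum_tendsto_0[rotated 2]) (use assms(1) in auto)
qed

text \<open>The finite expansions of different orders agree by uniqueness of homogeneous components,
  so the component of degree \<open>d\<close> may be read off from the one of order \<open>Re d - 1\<close>.\<close>
lemma homogeneous_expansion_exists:
  assumes "\<sigma> \<in> CS_com \<psi> U"
  shows "\<exists>c. homogeneous_expansion \<psi> U \<sigma> c"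
proof -
  obtain D C where DC: "\<And>r. approximates r \<sigma> (D r) (C r)"
    using CS_com_approximates[OF assms] by metis
  \<comment> \<open>Extension by 0 outside \<open>D r\<close> lets families for different r be
    compared degree by degree.\<close>
  define n where "n = (\<lambda>r d p. if d \<in> D r then C r d p else 0)"
  have fin: "finite (D r)" and hom: "d \<in> D r \<Longrightarrow> positively_homogeneous U d (C r d)"
    and rem: "symbol U r (\<lambda>p. \<sigma> p - (\<Sum>d\<in>D r. \<psi> p * C r d p))" for r d
    using DC[of r] unfolding approximates_def by blast+
  have n_hom: "positively_homogeneous U d (n r d)" for r d
    unfolding n_def using hom by (cases "d \<in> D r") (auto intro: positively_homogeneous_zero[OF U])
  have n_sum: "(\<Sum>d\<in>E. \<psi> p * n r d p) = (\<Sum>d\<in>D r. \<psi> p * C r d p)" if "finite E" "D r \<subseteq> E" for E r p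
  proof -
    have "(\<Sum>d\<in>E. \<psi> p * n r d p) = (\<Sum>d\<in>D r. \<psi> p * n r d p)"
      by (intro sum.mono_neutral_right that) (auto simp: n_def)
    also have "\<dots> = (\<Sum>d\<in>D r. \<psi> p * C r d p)" by (intro sum.cong) (auto simp: n_def)
    finally show ?thesis .
  qed
  \<comment> \<open>Two truncations of the same symbol differ by a symbol of order max r s, so their
    components of degree above that order coincide.\<close>
  have agree: "n r d (x, \<xi>) = n s d (x, \<xi>)" if d: "Re d > r" "Re d > s" and x: "x \<in> U" "\<xi> \<noteq> 0" for r s d x \<xi>
  proof (cases "d \<in> D r \<union> D s")
    case True
    let ?E = "D r \<union> D s" and ?m = "max r s"
    have "symbol U ?m (\<lambda>p. (\<sigma> p - (\<Sum>d\<in>D s. \<psi> p * C s d p)) - (\<sigma> p - (\<Sum>d\<in>D r. \<psi> p * C r d p)))"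
      by (intro symbol_minus[OF symbol_mono[OF U rem] symbol_mono[OF U rem]]) auto
    also have "(\<lambda>p. (\<sigma> p - (\<Sum>d\<in>D s. \<psi> p * C s d p)) - (\<sigma> p - (\<Sum>d\<in>D r. \<psi> p * C r d p)))
      = (\<lambda>p. \<Sum>d\<in>?E. \<psi> p * (n r d p - n s d p))"
      unfolding right_diff_distrib sum_subtractf using n_sum[of ?E r] n_sum[of ?E s] fin by simp
    finally have "bounded_order {x} ?m (\<lambda>p. \<Sum>d\<in>?E. \<psi> p * (n r d p - n s d p))"
      by (rule symbol_imp_bounded_order) (use x in auto)
    from homogeneous_sum_bounded_order_imp_0[OF _ _ this x True] fin d
    have "n r d (x, \<xi>) - n s d (x, \<xi>) = 0"
      by (simp add: positively_homogeneous_minus[OF U n_hom n_hom])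
    then show ?thesis by simp
  qed (auto simp: n_def)
  define c where "c = (\<lambda>d. n (Re d - 1) d)"
  have c_eq: "c d (x, \<xi>) = n r d (x, \<xi>)" if "Re d > r" "x \<in> U" "\<xi> \<noteq> 0" for d r x \<xi>
    unfolding c_def by (rule agree) (use that in auto)
  have "homogeneous_expansion \<psi> U \<sigma> c"
    unfolding homogeneous_expansion_def Let_def
  proof (intro conjI allI)
    show "positively_homogeneous U d (c d)" for d unfolding c_def by (rule n_hom)
    fix r
    let ?E = "{d. Re d > r \<and> (\<exists>p\<in>U \<times> - {0}. c d p \<noteq> 0)}"
    have sub: "?E \<subseteq> D r"
    proof
      fix d assume "d \<in> ?E"
      then obtain x \<xi> where "Re d > r" "x \<in> U" "\<xi> \<noteq> 0" "c d (x, \<xi>) \<noteq> 0" by blast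
      then have "n r d (x, \<xi>) \<noteq> 0" using c_eq by simp
      then show "d \<in> D r" unfolding n_def by (auto split: if_splits)
    qed
    then show "finite ?E" using fin finite_subset by blast
    \<comment> \<open>A degree with Re d \<le> r is absorbed by the remainder. For Re d > r the two
      coefficients agree off the zero section, where membership in \<open>?E\<close> only
      distinguishes vanishing components, and \<open>\<psi>\<close> is 0 on the zero section, so the
      term is identically 0.\<close>
    have "symbol U r (\<lambda>p. \<psi> p * (C r d p - (if d \<in> ?E then c d p else 0)))" if d: "d \<in> D r" for d
    proof (cases "Re d \<le> r")
      case True
      then have "symbol U r (\<lambda>p. \<psi> p * C r d p)"
        using symbol_\<psi>_mult[OF hom[OF d]] symbol_mono[OF U] by blast
      then show ?thesis using True by simp
    next
      case False
      have "\<psi> p * (C r d p - (if d \<in> ?E then c d p else 0)) = 0" if p: "p \<in> U \<times> UNIV" for p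
      proof (cases "snd p = 0")
        case True
        then show ?thesis using p \<psi>_eq_0[of "fst p" 0] by (cases p) simp
      next
        case nz: False
        obtain x \<xi> where xp: "p = (x, \<xi>)" "x \<in> U" "\<xi> \<noteq> 0" using p nz by (cases p) auto
        have "c d (x, \<xi>) = C r d (x, \<xi>)" using c_eq[of r d x \<xi>] False xp d by (simp add: n_def)
        moreover have "c d (x, \<xi>) = 0" if "d \<notin> ?E" using that xp False by auto
        ultimately show ?thesis using xp by auto
      qed
      then show ?thesis using symbol_zero symbol_cong[OF U] by (metis (no_types, lifting))
    qed
    then have "symbol U r (\<lambda>p. \<Sum>d\<in>D r. \<psi> p * (C r d p - (if d \<in> ?E then c d p else 0)))"
      by (rule symbol_sum)
    then have "symbol U r (\<lambda>p. (\<sigma> p - (\<Sum>d\<in>D r. \<psi> p * C r d p))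
        + (\<Sum>d\<in>D r. \<psi> p * (C r d p - (if d \<in> ?E then c d p else 0))))"
      by (intro symbol_add[OF U] rem)
    moreover have restrict: "(\<Sum>d\<in>D r. \<psi> p * (if d \<in> ?E then c d p else 0)) = (\<Sum>d\<in>?E. \<psi> p * c d p)" for p
    proof -
      have "(\<Sum>d\<in>D r. \<psi> p * (if d \<in> ?E then c d p else 0)) = (\<Sum>d\<in>?E. \<psi> p * (if d \<in> ?E then c d p else 0))"
        by (intro sum.mono_neutral_right fin sub) auto
      also have "\<dots> = (\<Sum>d\<in>?E. \<psi> p * c d p)" by (rule sum.cong) auto
      finally show ?thesis .
    qed
    have "(\<sigma> p - (\<Sum>d\<in>D r. \<psi> p * C r d p))
        + (\<Sum>d\<in>D r. \<psi> p * (C r d p - (if d \<in> ?E then c d p else 0)))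
      = \<sigma> p - (\<Sum>d\<in>?E. \<psi> p * c d p)" for p
      unfolding right_diff_distrib sum_subtractf restrict by simp
    ultimately show "symbol U r (\<lambda>p. \<sigma> p - (\<Sum>d\<in>?E. \<psi> p * c d p))" by (simp only:)
  qed
  then show ?thesis by blast
qed

end


section \<open>The divergence theorem on balls\<close>

lemma integral_lborel_translation:
  fixes u :: "'a::euclidean_space \<Rightarrow> 'b::{banach, second_countable_topology}"
  assumes "integrable lborel u"
  shows "integrable lborel (\<lambda>x. u (a + x))" "(\<integral>x. u (a + x) \<partial>lborel) = (\<integral>x. u x \<partial>lborel)"
proof -
  note [measurable] = borel_measurable_integrable[OF assms, simplified]
  have "integrable (distr lborel borel ((+) a)) u"
    using assms by (simp add: lborel_distr_plus)
  then show "integrable lborel (\<lambda>x. u (a + x))"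
    by (subst (asm) integrable_distr_eq) auto
  have "(\<integral>x. u x \<partial>lborel) = (\<integral>x. u x \<partial>distr lborel borel ((+) a))"
    by (simp add: lborel_distr_plus)
  also have "\<dots> = (\<integral>x. u (a + x) \<partial>lborel)" by (subst integral_distr) auto
  finally show "(\<integral>x. u (a + x) \<partial>lborel) = (\<integral>x. u x \<partial>lborel)" ..
qed

lemma integral_lborel_scaling:
  fixes u :: "'a::euclidean_space \<Rightarrow> 'b::{banach, second_countable_topology}"
  assumes [measurable]: "u \<in> borel_measurable borel" and "c > 0"
  shows "(\<integral>x. u x \<partial>lborel) = c ^ DIM('a) *\<^sub>R (\<integral>x. u (c *\<^sub>R x) \<partial>lborel)"
proof -
  have "(\<integral>x. u x \<partial>lborel)
    = (\<integral>x. u x \<partial>density (distr lborel borel (\<lambda>x. 0 + c *\<^sub>R x)) (\<lambda>_. \<bar>c\<bar> ^ DIM('a)))"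
    using assms lborel_affine[of c "0::'a"] by simp
  also have "\<dots> = (\<integral>x. c ^ DIM('a) *\<^sub>R u x \<partial>distr lborel borel (\<lambda>x. 0 + c *\<^sub>R x))"
    using assms by (subst integral_density) (auto simp: abs_of_pos)
  also have "\<dots> = (\<integral>x. c ^ DIM('a) *\<^sub>R u (c *\<^sub>R x) \<partial>lborel)"
    by (subst integral_distr) auto
  finally show ?thesis by simp
qed

text \<open>Translation invariance makes the integral of every difference quotient vanish.\<close>
lemma integral_directional_derivative_eq_0:
  fixes u :: "'a::euclidean_space \<Rightarrow> 'b::{banach, second_countable_topology}"
  assumes u: "integrable lborel u" and [measurable]: "g \<in> borel_measurable borel"
    and lip: "\<And>x s. 0 < s \<Longrightarrow> s \<le> 1 \<Longrightarrow> norm (u (x + s *\<^sub>R v) - u x) \<le> L * s"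
    and supp: "\<And>x s. 0 < s \<Longrightarrow> s \<le> 1 \<Longrightarrow> x \<notin> cball 0 r \<Longrightarrow> u (x + s *\<^sub>R v) = u x"
    and deriv: "AE x in lborel. (\<lambda>n. (u (x + (1 / real (Suc n)) *\<^sub>R v) - u x) /\<^sub>R (1 / real (Suc n))) \<longlonglongrightarrow> g x"
  shows "(\<integral>x. g x \<partial>lborel) = 0"
proof -
  note [measurable] = borel_measurable_integrable[OF u, simplified]
  let ?q = "\<lambda>n x. (u (x + (1 / real (Suc n)) *\<^sub>R v) - u x) /\<^sub>R (1 / real (Suc n))"
  have "(\<integral>x. ?q n x \<partial>lborel) = 0" for n
    using u integral_lborel_translation[OF u, of "(1 / real (Suc n)) *\<^sub>R v"]
    by (simp add: add.commute)
  moreover have "(\<lambda>n. \<integral>x. ?q n x \<partial>lborel) \<longlonglongrightarrow> (\<integral>x. g x \<partial>lborel)"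
  proof (rule integral_dominated_convergence)
    \<comment> \<open>The Lipschitz bound limits every quotient by L, and \<open>supp\<close> makes
      the quotients vanish outside the ball, so this function dominates all of them.\<close>
    show "integrable lborel (\<lambda>x. L * indicator (cball 0 r) x :: real)"
      using emeasure_lborel_cball_finite by (intro integrable_mult_right integrable_real_indicator) auto
    show "AE x in lborel. (\<lambda>n. ?q n x) \<longlonglongrightarrow> g x" by (rule deriv)
    show "AE x in lborel. norm (?q n x) \<le> L * indicator (cball 0 r) x" for n
    proof (rule AE_I2)
      fix x
      show "norm (?q n x) \<le> L * indicator (cball 0 r) x"
      proof (cases "x \<in> cball 0 r")
        case True
        have "norm (u (x + (1 / real (Suc n)) *\<^sub>R v) - u x) \<le> L * (1 / real (Suc n))"
          by (rule lip) auto
        then show ?thesis using True unfolding norm_scaleR by (simp add: field_simps)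
      next
        case False
        then show ?thesis using supp[of "1 / real (Suc n)" x] by simp
      qed
    qed
  qed simp_all
  ultimately show ?thesis by (simp add: LIMSEQ_const_iff)
qed

lemma directional_difference_quotient_tendsto:
  assumes "(u has_derivative D) (at x)"
  shows "(\<lambda>n. (u (x + (1 / real (Suc n)) *\<^sub>R v) - u x) /\<^sub>R (1 / real (Suc n))) \<longlonglongrightarrow> D v"
proof -
  have "((\<lambda>s. x + s *\<^sub>R v) has_derivative (\<lambda>s. s *\<^sub>R v)) (at 0)"
    by (auto intro!: derivative_eq_intros)
  moreover have "(u has_derivative D) (at (x + 0 *\<^sub>R v))" using assms by simp
  ultimately have "((\<lambda>s. u (x + s *\<^sub>R v)) has_derivative (\<lambda>s. D (s *\<^sub>R v))) (at 0)"
    by (rule has_derivative_compose)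
  moreover have "D (s *\<^sub>R v) = s *\<^sub>R D v" for s
    using linear_scale[OF has_derivative_linear[OF assms]] .
  ultimately have "((\<lambda>s. norm (u (x + s *\<^sub>R v) - u x - s *\<^sub>R D v) / norm s) \<longlongrightarrow> 0) (at 0)"
    by (simp add: has_derivative_at)
  moreover have "norm (u (x + s *\<^sub>R v) - u x - s *\<^sub>R D v) / norm s
      = norm ((u (x + s *\<^sub>R v) - u x) /\<^sub>R s - D v)" if "s \<noteq> 0" for s
  proof -
    have "(u (x + s *\<^sub>R v) - u x) /\<^sub>R s - D v = (u (x + s *\<^sub>R v) - u x - s *\<^sub>R D v) /\<^sub>R s"
      using that by (simp add: scaleR_diff_right)
    then show ?thesis by (simp add: divide_inverse mult.commute)
  qed
  ultimately have "((\<lambda>s. norm ((u (x + s *\<^sub>R v) - u x) /\<^sub>R s - D v)) \<longlongrightarrow> 0) (at 0)"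
    by (subst (asm) tendsto_cong) (auto simp: eventually_at_filter)
  then have "((\<lambda>s. (u (x + s *\<^sub>R v) - u x) /\<^sub>R s) \<longlongrightarrow> D v) (at 0)"
    by (rule LIM_zero_cancel[OF tendsto_norm_zero_cancel])
  moreover have "filterlim (\<lambda>n. 1 / real (Suc n)) (at 0) sequentially"
    by (rule filterlim_atI[OF LIMSEQ_Suc[OF lim_1_over_n]]) simp
  ultimately show ?thesis by (rule filterlim_compose)
qed

lemma set_integrable_compact:
  fixes f :: "'a::euclidean_space \<Rightarrow> 'b::{banach, second_countable_topology}"
  shows "compact S \<Longrightarrow> continuous_on S f \<Longrightarrow> set_integrable lborel S f"
  unfolding set_integrable_def by (rule borel_integrable_compact)

lemma set_integral_cball_scaling:
  fixes w :: "'a::euclidean_space \<Rightarrow> 'b::{banach, second_countable_topology}"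
  assumes "r > 0" and w[measurable]: "w \<in> borel_measurable borel"
    and hom: "\<And>c x. c > 0 \<Longrightarrow> w (c *\<^sub>R x) = w x"
  shows "(LINT x:cball 0 r|lborel. w x) = r ^ DIM('a) *\<^sub>R (LINT x:cball 0 1|lborel. w x)"
proof -
  have [measurable]: "cball 0 r \<in> sets (borel :: 'a measure)" by simp
  have "(LINT x:cball 0 r|lborel. w x)
      = r ^ DIM('a) *\<^sub>R (\<integral>x. indicator (cball 0 r) (r *\<^sub>R x) *\<^sub>R w (r *\<^sub>R x) \<partial>lborel)"
    unfolding set_lebesgue_integral_def using assms(1) by (intro integral_lborel_scaling) measurable
  also have "(\<lambda>x. indicator (cball 0 r) (r *\<^sub>R x) *\<^sub>R w (r *\<^sub>R x)) = (\<lambda>x::'a. indicator (cball 0 1) x *\<^sub>R w x)"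
    using assms by (auto simp: indicator_def fun_eq_iff)
  finally show ?thesis unfolding set_lebesgue_integral_def .
qed

text \<open>For a function constant along rays, the shell is a difference of two scaled unit balls.
  Dividing by the thickness will produce the derivative of R^N, with N the dimension.\<close>

lemma set_integral_shell_scaling:
  fixes w :: "'a::euclidean_space \<Rightarrow> 'b::{banach, second_countable_topology}"
  assumes "R > 0" "\<epsilon> > 0" and int: "\<And>r. set_integrable lborel (cball 0 r) w"
    and w: "w \<in> borel_measurable borel" and hom: "\<And>c x. c > 0 \<Longrightarrow> w (c *\<^sub>R x) = w x"
  shows "(LINT x:cball 0 (R + \<epsilon>) - cball 0 R|lborel. w x)
    = ((R + \<epsilon>) ^ DIM('a) - R ^ DIM('a)) *\<^sub>R (LINT x:cball 0 1|lborel. w x)"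
proof -
  have "cball 0 (R + \<epsilon>) = cball (0::'a) R \<union> (cball 0 (R + \<epsilon>) - cball 0 R)"
    using assms(2) by auto
  then have "(LINT x:cball 0 (R + \<epsilon>)|lborel. w x)
      = (LINT x:cball 0 R \<union> (cball 0 (R + \<epsilon>) - cball 0 R)|lborel. w x)"
    by simp
  also have "\<dots> = (LINT x:cball 0 R|lborel. w x) + (LINT x:cball 0 (R + \<epsilon>) - cball 0 R|lborel. w x)"
    by (intro set_integral_Un int set_integrable_subset[OF int[of "R + \<epsilon>"]]) auto
  finally show ?thesis
    using assms(1,2) set_integral_cball_scaling[OF _ w hom, of R]
      set_integral_cball_scaling[OF _ w hom, of "R + \<epsilon>"]
    by (simp add: scaleR_diff_left)
qed

section \<open>From thin shells to the flux through a sphere\<close>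

text \<open>Continuity is asked for each fixed direction w, which is the form in which
  \<open>Ck_on\<close> provides it; finite dimension turns this into local bounds on the operator
  norm.\<close>

locale C1_function =
  fixes f :: "'a::euclidean_space \<Rightarrow> 'b::{banach, second_countable_topology}" and f' :: "'a \<Rightarrow> 'a \<Rightarrow> 'b"
  assumes deriv: "(f has_derivative f' x) (at x)"
    and cont: "continuous_on UNIV (\<lambda>x. f' x w)"
begin

lemma continuous: "continuous_on S f"
  using deriv by (auto intro!: continuous_at_imp_continuous_on has_derivative_continuous)

text \<open>Bounds for the partial derivatives on the compact ball add up to an operator norm bound,
  and the ball is convex, so the mean value inequality applies.\<close>

lemma lipschitz_cball:
  obtains L where "L \<ge> 0" "\<And>x y. x \<in> cball 0 r \<Longrightarrow> y \<in> cball 0 r \<Longrightarrow> norm (f x - f y) \<le> L * norm (x - y)"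
proof -
  have "\<exists>B. \<forall>x\<in>cball 0 r. norm (f' x b) \<le> B" for b
    using compact_imp_bounded[OF compact_continuous_image[OF continuous_on_subset[OF cont[of b]], of "cball 0 r"]]
    unfolding bounded_iff by auto
  then obtain B where B: "\<And>b x. x \<in> cball 0 r \<Longrightarrow> norm (f' x b) \<le> B b" by metis
  let ?L = "\<Sum>b\<in>Basis. \<bar>B b\<bar>"
  have "onorm (f' x) \<le> ?L" if x: "x \<in> cball 0 r" for x
  proof (rule onorm_le)
    fix h
    have "f' x h = f' x (\<Sum>b\<in>Basis. (h \<bullet> b) *\<^sub>R b)" by (simp add: euclidean_representation)
    also have "\<dots> = (\<Sum>b\<in>Basis. (h \<bullet> b) *\<^sub>R f' x b)"
      using has_derivative_linear[OF deriv] by (simp add: linear_sum linear_scale)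
    finally have "norm (f' x h) \<le> (\<Sum>b\<in>Basis. norm ((h \<bullet> b) *\<^sub>R f' x b))"
      by (simp only: norm_sum)
    also have "\<dots> \<le> (\<Sum>b\<in>Basis. norm h * \<bar>B b\<bar>)"
    proof (rule sum_mono)
      fix b :: 'a assume "b \<in> Basis"
      then show "norm ((h \<bullet> b) *\<^sub>R f' x b) \<le> norm h * \<bar>B b\<bar>"
        using B[OF x, of b] Basis_le_norm[of b h] by (auto intro!: mult_mono)
    qed
    finally show "norm (f' x h) \<le> ?L * norm h" by (simp add: sum_distrib_left mult.commute)
  qed
  then have "norm (f x - f y) \<le> ?L * norm (x - y)" if "x \<in> cball 0 r" "y \<in> cball 0 r" for x y
    using that by (intro differentiable_bound[of "cball 0 r" f f'] has_derivative_at_withinI[OF deriv]) auto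
  then show thesis by (intro that[of ?L]) (auto intro: sum_nonneg)
qed

text \<open>The cut-off \<open>\<phi>\<close> descends linearly from 1 to 0 between the spheres of radii \<open>R\<close> and \<open>R + \<epsilon>\<close>,
  so the product rule for \<open>\<phi> f\<close> produces the averaged boundary term on the right.\<close>
lemma integral_radial_cutoff:
  assumes "R > 0" "\<epsilon> > 0" and v: "norm v = 1"
  defines "\<phi> \<equiv> \<lambda>x::'a. max 0 (min 1 ((R + \<epsilon> - norm x) / \<epsilon>))"
  shows "(\<integral>x. \<phi> x *\<^sub>R f' x v \<partial>lborel)
       = (LINT x:cball 0 (R + \<epsilon>) - cball 0 R|lborel. ((x \<bullet> v) / norm x) *\<^sub>R f x) /\<^sub>R \<epsilon>"
proof -
  let ?A = "cball 0 (R + \<epsilon>) - cball 0 R :: 'a set"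
  let ?h = "\<lambda>x. ((x \<bullet> v) / norm x) *\<^sub>R f x"
  let ?u = "\<lambda>x. \<phi> x *\<^sub>R f x"
  \<comment> \<open>The derivative of \<open>?u\<close> along v off the two boundary spheres: the
    gradient of \<open>\<phi>\<close> is \<open>- sgn x / \<epsilon>\<close> inside the shell and 0
    on the other two regions.\<close>
  let ?g = "\<lambda>x. \<phi> x *\<^sub>R f' x v - (indicator ?A x *\<^sub>R ?h x) /\<^sub>R \<epsilon>"
  have [measurable]: "f \<in> borel_measurable borel" "(\<lambda>x. f' x v) \<in> borel_measurable borel"
    using continuous cont by (auto intro: borel_measurable_continuous_onI)
  have contf: "continuous_on S \<phi>" for S unfolding \<phi>_def using assms by (intro continuous_intros) auto
  have [measurable]: "\<phi> \<in> borel_measurable borel" using contf by (rule borel_measurable_continuous_onI)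
  have \<phi>01: "0 \<le> \<phi> x" "\<phi> x \<le> 1" for x unfolding \<phi>_def by auto
  have \<phi>0: "\<phi> x = 0" if "norm x \<ge> R + \<epsilon>" for x
    unfolding \<phi>_def using that assms by (simp add: divide_nonpos_pos min_absorb2)
  have \<phi>1: "\<phi> x = 1" if "norm x \<le> R" for x
    unfolding \<phi>_def using that assms by (simp add: min_absorb1)
  have \<phi>mid: "\<phi> x = (R + \<epsilon> - norm x) / \<epsilon>" if "norm x \<ge> R" "norm x \<le> R + \<epsilon>" for x
    unfolding \<phi>_def using that assms by (simp add: min_def max_def)
  have \<phi>lip: "\<bar>\<phi> x - \<phi> y\<bar> \<le> norm (x - y) / \<epsilon>" for x y
  proof -
    have "\<bar>max 0 (min 1 a) - max 0 (min 1 b)\<bar> \<le> \<bar>a - b\<bar>" for a b :: real by linarith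
    then have "\<bar>\<phi> x - \<phi> y\<bar> \<le> \<bar>(R + \<epsilon> - norm x) / \<epsilon> - (R + \<epsilon> - norm y) / \<epsilon>\<bar>"
      unfolding \<phi>_def .
    also have "\<dots> = \<bar>norm x - norm y\<bar> / \<epsilon>" using assms(2) by (simp add: diff_divide_distrib[symmetric] abs_minus_commute)
    also have "\<dots> \<le> norm (x - y) / \<epsilon>" using assms(2) by (intro divide_right_mono norm_triangle_ineq3) auto
    finally show ?thesis .
  qed
  have int1: "integrable lborel (\<lambda>x. \<phi> x *\<^sub>R w x)" if "continuous_on UNIV w" for w :: "'a \<Rightarrow> 'b"
  proof -
    have "integrable lborel (\<lambda>x. indicator (cball 0 (R + \<epsilon>)) x *\<^sub>R (\<phi> x *\<^sub>R w x))"
      using that by (intro borel_integrable_compact continuous_intros contf) (auto intro: continuous_on_subset)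
    moreover have "(\<lambda>x. indicator (cball 0 (R + \<epsilon>)) x *\<^sub>R (\<phi> x *\<^sub>R w x)) = (\<lambda>x. \<phi> x *\<^sub>R w x)"
      using \<phi>0 by (force simp: indicator_def fun_eq_iff)
    ultimately show ?thesis by simp
  qed
  have int2: "set_integrable lborel ?A ?h"
  proof -
    have "set_integrable lborel (cball 0 (R + \<epsilon>) - ball 0 R) ?h"
      using assms by (intro set_integrable_compact compact_diff continuous_intros continuous) auto
    then show ?thesis by (rule set_integrable_subset) auto
  qed
  \<comment> \<open>The radius leaves room for x with |x| \<le> R + \<epsilon> + 1 together with a
    step of length at most 1; for larger |x| both end points lie where \<open>\<phi>\<close> is
    0.\<close>
  obtain L where L: "L \<ge> 0"
    "\<And>x y. x \<in> cball 0 (R + \<epsilon> + 2) \<Longrightarrow> y \<in> cball 0 (R + \<epsilon> + 2) \<Longrightarrow> norm (f x - f y) \<le> L * norm (x - y)"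
    using lipschitz_cball by metis
  obtain M where M: "\<And>x. x \<in> cball 0 (R + \<epsilon> + 2) \<Longrightarrow> norm (f x) \<le> M"
    using compact_imp_bounded[OF compact_continuous_image[OF continuous, of "cball 0 (R + \<epsilon> + 2)"]]
    unfolding bounded_iff by fastforce
  have near: "norm x - s \<le> norm (x + s *\<^sub>R v)" "norm (x + s *\<^sub>R v) \<le> norm x + s" if "0 < s" for x s
    using norm_triangle_ineq[of x "s *\<^sub>R v"] norm_diff_ineq[of x "s *\<^sub>R v"] that v by auto
  have "(\<integral>x. ?g x \<partial>lborel) = 0"
  proof (rule integral_directional_derivative_eq_0)
    show "integrable lborel ?u" by (rule int1[OF continuous])
    have [measurable]: "cball 0 R \<in> sets (borel :: 'a measure)" "cball 0 (R + \<epsilon>) \<in> sets (borel :: 'a measure)"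
      by simp_all
    show "?g \<in> borel_measurable borel" by measurable
    fix x s assume s: "0 < s" "s \<le> (1::real)"
    show "?u (x + s *\<^sub>R v) = ?u x" if "x \<notin> cball 0 (R + \<epsilon> + 1)"
      using that near[OF s(1), of x] s \<phi>0[of x] \<phi>0[of "x + s *\<^sub>R v"] by simp
    show "norm (?u (x + s *\<^sub>R v) - ?u x) \<le> (L + \<bar>M\<bar> / \<epsilon>) * s"
    proof (cases "x \<in> cball 0 (R + \<epsilon> + 1)")
      case True
      let ?y = "x + s *\<^sub>R v"
      have xy: "x \<in> cball 0 (R + \<epsilon> + 2)" "?y \<in> cball 0 (R + \<epsilon> + 2)"
        using True near[OF s(1), of x] s by auto
      have "?u ?y - ?u x = \<phi> ?y *\<^sub>R (f ?y - f x) + (\<phi> ?y - \<phi> x) *\<^sub>R f x"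
        by (simp add: algebra_simps)
      then have "norm (?u ?y - ?u x) \<le> \<bar>\<phi> ?y\<bar> * norm (f ?y - f x) + \<bar>\<phi> ?y - \<phi> x\<bar> * norm (f x)"
        using norm_triangle_ineq by (metis norm_scaleR)
      also have "\<dots> \<le> 1 * (L * norm (?y - x)) + norm (?y - x) / \<epsilon> * \<bar>M\<bar>"
        using L(2)[OF xy(2,1)] M[OF xy(1)] \<phi>lip[of ?y x] \<phi>01[of ?y] assms(2) L(1)
        by (intro add_mono mult_mono) auto
      finally show ?thesis using v s by (simp add: algebra_simps)
    next
      case False
      then have "?u (x + s *\<^sub>R v) = ?u x"
        using near[OF s(1), of x] s \<phi>0[of x] \<phi>0[of "x + s *\<^sub>R v"] by simp
      then show ?thesis using L(1) assms(2) s by simp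
    qed
  next
    \<comment> \<open>\<open>\<phi>\<close> has kinks exactly on these two spheres, which are null
      sets.\<close>
    have ns: "AE x in lborel. x \<notin> sphere 0 R \<union> sphere (0::'a) (R + \<epsilon>)"
      using negligible_sphere[of "0::'a" R] negligible_sphere[of "0::'a" "R + \<epsilon>"]
      by (intro AE_not_in null_sets.Un) (auto simp: negligible_iff_null_sets null_sets_completion_iff)
    show "AE x in lborel. (\<lambda>n. (?u (x + (1 / real (Suc n)) *\<^sub>R v) - ?u x) /\<^sub>R (1 / real (Suc n))) \<longlonglongrightarrow> ?g x"
      using ns
    proof (eventually_elim)
      fix x :: 'a assume x: "x \<notin> sphere 0 R \<union> sphere 0 (R + \<epsilon>)"
      consider "norm x < R" | "R < norm x" "norm x < R + \<epsilon>" | "norm x > R + \<epsilon>"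
        using x by fastforce
      then have "\<exists>D. (?u has_derivative D) (at x) \<and> D v = ?g x"
      proof cases
        case 1
        have "(?u has_derivative f' x) (at x)"
          by (rule has_derivative_transform_within_open[OF deriv[of x] open_ball[of 0 R]])
             (use 1 \<phi>1 in auto)
        moreover have "f' x v = ?g x" using 1 \<phi>1[of x] by simp
        ultimately show ?thesis by blast
      next
        case 2
        then have x0: "x \<noteq> 0" using assms by auto
        let ?D = "\<lambda>h. \<phi> x *\<^sub>R f' x h + (- (h \<bullet> sgn x) / \<epsilon>) *\<^sub>R f x"
        have "((\<lambda>y. ((R + \<epsilon> - norm y) / \<epsilon>) *\<^sub>R f y) has_derivative ?D) (at x)"
          using x0 assms(2) 2 \<phi>mid[of x]
          by (auto intro!: derivative_eq_intros deriv has_derivative_norm)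
        moreover have op: "open {y::'a. R < norm y \<and> norm y < R + \<epsilon>}"
          by (intro open_Collect_conj open_Collect_less continuous_intros)
        ultimately have "(?u has_derivative ?D) (at x)"
          by (rule has_derivative_transform_within_open) (use 2 \<phi>mid in auto)
        moreover have "?D v = ?g x" using 2 by (simp add: sgn_div_norm inner_commute divide_inverse mult_ac)
        ultimately show ?thesis by blast
      next
        case 3
        have "((\<lambda>_. 0) has_derivative (\<lambda>_. 0 :: 'b)) (at x)" by simp
        moreover have op: "open {y::'a. R + \<epsilon> < norm y}"
          by (intro open_Collect_less continuous_intros)
        ultimately have "(?u has_derivative (\<lambda>_. 0)) (at x)"
          by (rule has_derivative_transform_within_open) (use 3 \<phi>0 in auto)
        moreover have "0 = ?g x" using 3 \<phi>0[of x] by simp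
        ultimately show ?thesis by blast
      qed
      then obtain D where "(?u has_derivative D) (at x)" and D: "D v = ?g x" by blast
      from directional_difference_quotient_tendsto[OF this(1), of v]
      show "(\<lambda>n. (?u (x + (1 / real (Suc n)) *\<^sub>R v) - ?u x) /\<^sub>R (1 / real (Suc n))) \<longlonglongrightarrow> ?g x"
        unfolding D .
    qed
  qed
  then have zero: "0 = (\<integral>x. ?g x \<partial>lborel)" ..
  have int3: "integrable lborel (\<lambda>x. (indicator ?A x *\<^sub>R ?h x) /\<^sub>R \<epsilon>)"
    by (rule integrable_scaleR_right[OF int2[unfolded set_integrable_def]])
  note zero
  also have "(\<integral>x. ?g x \<partial>lborel)
      = (\<integral>x. \<phi> x *\<^sub>R f' x v \<partial>lborel) - (\<integral>x. (indicator ?A x *\<^sub>R ?h x) /\<^sub>R \<epsilon> \<partial>lborel)"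
    by (rule Bochner_Integration.integral_diff[OF int1[OF cont[of v]] int3])
  also have "(\<integral>x. (indicator ?A x *\<^sub>R ?h x) /\<^sub>R \<epsilon> \<partial>lborel) = (LINT x:?A|lborel. ?h x) /\<^sub>R \<epsilon>"
    unfolding set_lebesgue_integral_def by (rule integral_scaleR_right)
  finally show ?thesis by (simp only: right_minus_eq eq_commute[of 0])
qed

text \<open>The width of the radial cutoff tends to 0. The left side of
  \<open>integral_radial_cutoff\<close> converges by dominated convergence. On the right, f x is
  replaced by its value at the radial projection to the sphere of radius R, after which the
  integrand is constant along rays and shell scaling evaluates the limit.\<close>

theorem integral_cball_derivative:
  assumes "R > 0" and v: "norm v = 1"
  shows "(LINT x:cball 0 R|lborel. f' x v)
       = (real DIM('a) * R ^ (DIM('a) - 1)) *\<^sub>R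
           (LINT x:cball 0 1|lborel. (sgn x \<bullet> v) *\<^sub>R f (R *\<^sub>R sgn x))"
proof -
  let ?N = "DIM('a)"
  let ?\<epsilon> = "\<lambda>n. 1 / real (Suc n)"
  let ?A = "\<lambda>n. cball 0 (R + ?\<epsilon> n) - cball 0 R :: 'a set"
  let ?\<phi> = "\<lambda>n x::'a. max 0 (min 1 ((R + ?\<epsilon> n - norm x) / ?\<epsilon> n))"
  let ?h = "\<lambda>x. (sgn x \<bullet> v) *\<^sub>R f (R *\<^sub>R sgn x)"
  let ?k = "\<lambda>x. ((x \<bullet> v) / norm x) *\<^sub>R f x"
  let ?P = "\<lambda>n. (R + ?\<epsilon> n) ^ ?N - R ^ ?N"
  have [measurable]: "f \<in> borel_measurable borel" "(\<lambda>x. f' x v) \<in> borel_measurable borel"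
    using continuous cont by (auto intro: borel_measurable_continuous_onI)
  have [measurable]: "cball 0 R \<in> sets (borel :: 'a measure)" by simp
  have [measurable]: "(sgn :: 'a \<Rightarrow> 'a) \<in> borel_measurable borel"
    unfolding sgn_div_norm by measurable
  obtain M where M: "\<And>x. x \<in> cball 0 R \<Longrightarrow> norm (f x) \<le> M"
    using compact_imp_bounded[OF compact_continuous_image[OF continuous, of "cball 0 R"]]
    unfolding bounded_iff by fastforce
  have inner_v: "\<bar>sgn x \<bullet> v\<bar> \<le> 1" for x :: 'a
    using Cauchy_Schwarz_ineq2[of "sgn x" v] v by (auto simp: norm_sgn split: if_splits)
  have hM: "norm (?h x) \<le> M" for x
  proof -
    have "norm (?h x) \<le> 1 * M"
      unfolding norm_scaleR using inner_v[of x] assms(1)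
      by (intro mult_mono M) (auto simp: norm_sgn)
    then show ?thesis by simp
  qed
  have inth: "set_integrable lborel (cball 0 r) ?h" for r
    unfolding set_integrable_def using hM emeasure_lborel_cball_finite
    by (intro integrableI_bounded_set_indicator[of _ _ _ M]) auto
  \<comment> \<open>Shell volume per unit thickness, up to the unit ball volume: a difference
    quotient of the N-th power at R, and the source of the factor N R^(N-1).\<close>
  have P: "(\<lambda>n. ?P n / ?\<epsilon> n) \<longlonglongrightarrow> real ?N * R ^ (?N - 1)"
  proof -
    have "((\<lambda>x. x ^ ?N) has_derivative (*) (real ?N * R ^ (?N - Suc 0))) (at R)"
      using DERIV_pow[of ?N R] unfolding has_field_derivative_def .
    from directional_difference_quotient_tendsto[OF this, of 1]
    show ?thesis by (simp add: divide_inverse mult.commute)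
  qed
  have P0: "?P \<longlonglongrightarrow> 0"
    using tendsto_mult[OF P lim_1_over_n[THEN LIMSEQ_Suc]] by simp
  have lhs: "(\<lambda>n. \<integral>x. ?\<phi> n x *\<^sub>R f' x v \<partial>lborel) \<longlonglongrightarrow> (LINT x:cball 0 R|lborel. f' x v)"
    unfolding set_lebesgue_integral_def
  proof (rule integral_dominated_convergence)
    have "integrable lborel (\<lambda>x. indicator (cball 0 (R + 1)) x *\<^sub>R f' x v)"
      by (intro borel_integrable_compact continuous_on_subset[OF cont]) auto
    then show "integrable lborel (\<lambda>x. norm (indicator (cball 0 (R + 1)) x *\<^sub>R f' x v))"
      by (rule integrable_norm)
    show "AE x in lborel. norm (?\<phi> n x *\<^sub>R f' x v) \<le> norm (indicator (cball 0 (R + 1)) x *\<^sub>R f' x v)" for n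
    proof (rule AE_I2)
      fix x :: 'a
      have "?\<phi> n x \<le> indicator (cball 0 (R + 1)) x"
      proof (cases "norm x \<le> R + 1")
        case False
        have "?\<epsilon> n \<le> 1" by simp
        then have "R + ?\<epsilon> n - norm x \<le> 0" using False by linarith
        then have "(R + ?\<epsilon> n - norm x) / ?\<epsilon> n \<le> 0" by (rule divide_nonpos_pos) simp
        then show ?thesis using False by simp
      qed simp
      then show "norm (?\<phi> n x *\<^sub>R f' x v) \<le> norm (indicator (cball 0 (R + 1)) x *\<^sub>R f' x v)"
        unfolding norm_scaleR by (intro mult_right_mono) auto
    qed
    show "AE x in lborel. (\<lambda>n. ?\<phi> n x *\<^sub>R f' x v) \<longlonglongrightarrow> indicator (cball 0 R) x *\<^sub>R f' x v"
    proof (intro AE_I2 tendsto_scaleR tendsto_const)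
      fix x :: 'a
      show "(\<lambda>n. ?\<phi> n x) \<longlonglongrightarrow> indicator (cball 0 R) x"
      proof (cases "norm x \<le> R")
        case True
        have "?\<phi> n x = 1" for n
        proof -
          have "1 \<le> (R + ?\<epsilon> n - norm x) / ?\<epsilon> n" using True by (subst le_divide_eq_1_pos) auto
          then show ?thesis by simp
        qed
        with True show ?thesis by simp
      next
        case False
        then have "eventually (\<lambda>n. ?\<epsilon> n < norm x - R) sequentially"
          by (intro order_tendstoD(2)[OF lim_1_over_n[THEN LIMSEQ_Suc]]) simp
        then have "eventually (\<lambda>n. ?\<phi> n x = 0) sequentially"
        proof eventually_elim
          case (elim n)
          then have "(R + ?\<epsilon> n - norm x) / ?\<epsilon> n \<le> 0" by (intro divide_nonpos_pos) simp_all
          then show ?case by simp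
        qed
        with False show ?thesis by (simp add: tendsto_eventually)
      qed
    qed
  qed simp_all
  obtain L where L: "L \<ge> 0"
    "\<And>x y. x \<in> cball 0 (R + 1) \<Longrightarrow> y \<in> cball 0 (R + 1) \<Longrightarrow> norm (f x - f y) \<le> L * norm (x - y)"
    using lipschitz_cball by metis
  define V where "V = (LINT x:cball (0::'a) 1|lborel. (1::real))"
  have int1: "set_integrable lborel (cball 0 r) (\<lambda>x::'a. 1::real)" for r
    by (rule set_integrable_compact) auto
  \<comment> \<open>The pointwise error \<open>L * ?\<epsilon> n\<close> cancels the division by the
    thickness, leaving L times the shell volume \<open>?P n * V\<close>, which tends to 0.\<close>
  have diff: "norm ((LINT x:?A n|lborel. ?k x) /\<^sub>R ?\<epsilon> n - (LINT x:?A n|lborel. ?h x) /\<^sub>R ?\<epsilon> n) \<le> L * (?P n * V)" for n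
  proof -
    have intk: "set_integrable lborel (?A n) ?k"
    proof -
      have "set_integrable lborel (cball 0 (R + ?\<epsilon> n) - ball 0 R) ?k"
        using assms by (intro set_integrable_compact compact_diff continuous_intros continuous) auto
      then show ?thesis by (rule set_integrable_subset) auto
    qed
    have inthA: "set_integrable lborel (?A n) ?h"
      by (rule set_integrable_subset[OF inth[of "R + ?\<epsilon> n"]]) auto
    have intL: "set_integrable lborel (?A n) (\<lambda>x. L * ?\<epsilon> n)"
      by (rule set_integrable_subset[OF set_integrable_compact[OF compact_cball[of 0 "R + ?\<epsilon> n"]]]) auto
    \<comment> \<open>A point of the shell lies within \<open>?\<epsilon> n\<close> of its radial
      projection \<open>R *\<^sub>R sgn x\<close>.\<close>
    have le: "norm (?k x - ?h x) \<le> L * ?\<epsilon> n" if x: "x \<in> ?A n" for x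
    proof -
      have nx: "R < norm x" "norm x \<le> R + ?\<epsilon> n" "x \<noteq> 0" using x assms(1) by auto
      have "?\<epsilon> n \<le> 1" by simp
      then have in1: "x \<in> cball 0 (R + 1)" "R *\<^sub>R sgn x \<in> cball 0 (R + 1)"
        using nx assms(1) by (auto simp: norm_sgn intro: order_trans[OF nx(2)])
      have k: "(x \<bullet> v) / norm x = sgn x \<bullet> v" by (simp add: sgn_div_norm divide_inverse mult.commute)
      have "norm (?k x - ?h x) = \<bar>sgn x \<bullet> v\<bar> * norm (f x - f (R *\<^sub>R sgn x))"
        unfolding k scaleR_diff_right[symmetric] norm_scaleR ..
      also have "\<dots> \<le> 1 * (L * norm (x - R *\<^sub>R sgn x))"
        using inner_v[of x] L in1 by (intro mult_mono) auto
      also have "x - R *\<^sub>R sgn x = (norm x - R) *\<^sub>R sgn x"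
        using nx by (simp add: sgn_div_norm left_diff_distrib scaleR_diff_left)
      also have "norm \<dots> = norm x - R" using nx by (simp add: norm_sgn)
      also have "1 * (L * (norm x - R)) \<le> L * ?\<epsilon> n"
        using nx(2) mult_left_mono[OF _ L(1), of "norm x - R" "?\<epsilon> n"] by linarith
      finally show ?thesis .
    qed
    have "norm (LINT x:?A n|lborel. ?k x - ?h x) \<le> (LINT x:?A n|lborel. norm (?k x - ?h x))"
      by (intro set_integral_norm_bound set_integral_diff intk inthA)
    also have "\<dots> \<le> (LINT x:?A n|lborel. L * ?\<epsilon> n)"
      using le by (intro set_integral_mono intL set_integrable_norm set_integral_diff intk inthA) auto
    also have "\<dots> = L * ?\<epsilon> n * (LINT x:?A n|lborel. 1)" by (subst set_integral_mult_right[symmetric]) simp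
    also have "(LINT x:?A n|lborel. (1::real)) = ?P n * V"
      unfolding V_def using assms(1) by (intro trans[OF set_integral_shell_scaling[OF _ _ int1]]) auto
    finally have bound: "norm (LINT x:?A n|lborel. ?k x - ?h x) \<le> L * ?\<epsilon> n * (?P n * V)" .
    have scale: "norm (D /\<^sub>R e) \<le> L * q" if "norm D \<le> L * e * q" "e > 0" for D :: 'b and e q :: real
      using that by (simp add: field_simps)
    have "(LINT x:?A n|lborel. ?k x) /\<^sub>R ?\<epsilon> n - (LINT x:?A n|lborel. ?h x) /\<^sub>R ?\<epsilon> n
       = (LINT x:?A n|lborel. ?k x - ?h x) /\<^sub>R ?\<epsilon> n"
      by (subst set_integral_diff(2)[OF intk inthA]) (simp add: scaleR_diff_right)
    then show ?thesis using scale[OF bound] by simp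
  qed
  have lim_diff: "(\<lambda>n. (LINT x:?A n|lborel. ?k x) /\<^sub>R ?\<epsilon> n - (LINT x:?A n|lborel. ?h x) /\<^sub>R ?\<epsilon> n) \<longlonglongrightarrow> 0"
    using diff by (intro Lim_null_comparison[OF _ tendsto_mult_right_zero[OF tendsto_mult_left_zero[OF P0]]])
      (auto simp: eventually_sequentially)
  have lim_h: "(\<lambda>n. (LINT x:?A n|lborel. ?h x) /\<^sub>R ?\<epsilon> n) \<longlonglongrightarrow> (real ?N * R ^ (?N - 1)) *\<^sub>R (LINT x:cball 0 1|lborel. ?h x)"
  proof -
    have "(LINT x:?A n|lborel. ?h x) /\<^sub>R ?\<epsilon> n = (?P n / ?\<epsilon> n) *\<^sub>R (LINT x:cball 0 1|lborel. ?h x)" for n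
      using assms(1) by (subst set_integral_shell_scaling[OF _ _ inth])
        (auto simp: sgn_scaleR divide_inverse mult.commute)
    then show ?thesis by (simp only:) (intro tendsto_scaleR P tendsto_const)
  qed
  have "(\<lambda>n. \<integral>x. ?\<phi> n x *\<^sub>R f' x v \<partial>lborel)
      = (\<lambda>n. (LINT x:?A n|lborel. ?k x) /\<^sub>R ?\<epsilon> n)"
    by (rule ext, rule integral_radial_cutoff[OF assms(1) _ v]) simp
  with lhs have "(\<lambda>n. (LINT x:?A n|lborel. ?k x) /\<^sub>R ?\<epsilon> n) \<longlonglongrightarrow> (LINT x:cball 0 R|lborel. f' x v)"
    by (simp only:)
  then show ?thesis using Lim_transform[OF lim_h lim_diff] by (rule LIMSEQ_unique)
qed

end


section \<open>Integration over spheres and cosphere bundles\<close>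

lemma scale_measure_eq_density: "scale_measure r M = density M (\<lambda>_. r)"
  by (rule measure_eqI) (auto simp: emeasure_density_const)

lemma sgn_measurable_sphere:
  "sgn \<in> measurable (restrict_space lborel (cball 0 1 - {0})) (restrict_space borel (sphere (0::real^'n::finite) 1))"
proof (rule measurable_restrict_space2)
  show "sgn \<in> space (restrict_space lborel (cball 0 1 - {0})) \<rightarrow> sphere (0::real^'n) 1"
    by (auto simp: space_restrict_space norm_sgn)
  have "(sgn :: real^'n \<Rightarrow> _) \<in> borel_measurable borel" unfolding sgn_div_norm by measurable
  then show "sgn \<in> borel_measurable (restrict_space lborel (cball 0 1 - {0} :: (real^'n) set))"
    by (intro measurable_restrict_space1) simp
qed

lemma space_sphere_measure: "space sphere_measure = sphere (0::real^'n::finite) 1"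
  unfolding sphere_measure_def by (simp add: space_restrict_space)

lemma sets_sphere_measure: "sets sphere_measure = sets (restrict_space borel (sphere (0::real^'n::finite) 1))"
  unfolding sphere_measure_def by simp

lemma finite_sphere_measure: "finite_measure (sphere_measure :: (real^'n::finite) measure)"
proof -
  let ?M = "scale_measure (of_nat CARD('n)) (restrict_space lborel (cball 0 1 - {0})) :: (real^'n) measure"
  have "emeasure lborel (cball 0 1 - {0} :: (real^'n) set) \<le> emeasure lborel (cball (0::real^'n) 1)"
    by (rule emeasure_mono) auto
  then have "emeasure lborel (cball 0 1 - {0} :: (real^'n) set) < \<infinity>"
    using emeasure_lborel_cball_finite[of "0::real^'n" 1] by (rule le_less_trans)
  then have "finite_measure ?M"
    by (intro finite_measureI)
       (auto simp: space_scale_measure space_restrict_space emeasure_restrict_space ennreal_mult_eq_top_iff)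
  then show ?thesis
    unfolding sphere_measure_def
    by (rule finite_measure.finite_measure_distr)
       (use sgn_measurable_sphere in \<open>simp cong: measurable_cong_sets\<close>)
qed

interpretation sphere_measure: finite_measure "sphere_measure :: (real^'n::finite) measure"
  by (rule finite_sphere_measure)

lemma sphere_measurable_continuous:
  "continuous_on (sphere 0 1) g \<Longrightarrow> g \<in> borel_measurable sphere_measure"
  unfolding measurable_cong_sets[OF sets_sphere_measure refl] by (rule borel_measurable_continuous_on_restrict)

lemma sphere_integrable_continuous:
  fixes g :: "real^'n::finite \<Rightarrow> 'b::{banach, second_countable_topology}"
  assumes "continuous_on (sphere 0 1) g"
  shows "integrable sphere_measure g"
proof -
  have "bounded (g ` sphere 0 1)"
    using assms by (intro compact_imp_bounded compact_continuous_image) auto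
  then obtain B where "\<And>\<omega>. \<omega> \<in> sphere 0 1 \<Longrightarrow> norm (g \<omega>) \<le> B"
    unfolding bounded_iff by blast
  then show ?thesis
    by (intro sphere_measure.integrable_const_bound[of _ B] sphere_measurable_continuous[OF assms] AE_I2)
       (simp add: space_sphere_measure)
qed

text \<open>Since \<open>sgn 0 = 0\<close>, the integrand on the right vanishes at the origin.\<close>
lemma sphere_integral_eq:
  fixes g :: "real^'n::finite \<Rightarrow> 'b::{banach, second_countable_topology}"
  assumes g: "g \<in> borel_measurable sphere_measure"
  shows "(\<integral>\<omega>. (\<omega> \<bullet> v) *\<^sub>R g \<omega> \<partial>sphere_measure)
    = real CARD('n) *\<^sub>R (LINT \<xi>:cball 0 1|lborel. (sgn \<xi> \<bullet> v) *\<^sub>R g (sgn \<xi>))"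
proof -
  let ?R = "restrict_space lborel (cball 0 1 - {0}) :: (real^'n) measure"
  let ?g = "\<lambda>\<omega>. (\<omega> \<bullet> v) *\<^sub>R g \<omega>"
  have "(\<lambda>\<omega>. \<omega> \<bullet> v) \<in> borel_measurable (sphere_measure :: (real^'n) measure)"
    by (intro sphere_measurable_continuous continuous_intros)
  then have "?g \<in> borel_measurable sphere_measure" using g by (rule borel_measurable_scaleR)
  then have g': "?g \<in> borel_measurable (restrict_space borel (sphere 0 1))"
    unfolding measurable_cong_sets[OF sets_sphere_measure refl] .
  have m: "(\<lambda>\<xi>. ?g (sgn \<xi>)) \<in> borel_measurable ?R"
    by (rule measurable_compose[OF sgn_measurable_sphere g'])
  have "(\<integral>\<omega>. ?g \<omega> \<partial>sphere_measure) = (\<integral>\<xi>. ?g (sgn \<xi>) \<partial>density ?R (\<lambda>_. ennreal (real CARD('n))))"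
    unfolding sphere_measure_def scale_measure_eq_density ennreal_of_nat_eq_real_of_nat
    by (rule integral_distr[OF _ g']) (use sgn_measurable_sphere in simp)
  also have "\<dots> = (\<integral>\<xi>. real CARD('n) *\<^sub>R ?g (sgn \<xi>) \<partial>?R)"
    by (rule integral_density[OF m]) auto
  also have "\<dots> = real CARD('n) *\<^sub>R (\<integral>\<xi>. ?g (sgn \<xi>) \<partial>?R)" by (rule integral_scaleR_right)
  also have "(\<integral>\<xi>. ?g (sgn \<xi>) \<partial>?R) = (\<integral>\<xi>. indicator (cball 0 1 - {0}) \<xi> *\<^sub>R ?g (sgn \<xi>) \<partial>lborel)"
    by (rule integral_restrict_space) auto
  also have "(\<lambda>\<xi>. indicator (cball 0 1 - {0}) \<xi> *\<^sub>R ?g (sgn \<xi>)) = (\<lambda>\<xi>. indicator (cball 0 1) \<xi> *\<^sub>R ?g (sgn \<xi>))"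
    by (auto simp: fun_eq_iff indicator_def)
  finally show ?thesis unfolding set_lebesgue_integral_def .
qed

text \<open>The dimension factor produced by the shells is the one built into
  \<open>sphere_measure\<close>, so only R^(n-1) remains.\<close>

theorem divergence_theorem_cball:
  fixes f :: "real^'n::finite \<Rightarrow> 'b::{banach, second_countable_topology}"
  assumes f: "C1_function f f'" and "R > 0"
  shows "(LINT \<xi>:cball 0 R|lborel. f' \<xi> (axis i 1))
    = R ^ (CARD('n) - 1) *\<^sub>R (\<integral>\<omega>. (\<omega> $ i) *\<^sub>R f (R *\<^sub>R \<omega>) \<partial>sphere_measure)"
proof -
  have "continuous_on (sphere 0 1) (\<lambda>\<omega>. f (R *\<^sub>R \<omega>))"
    by (intro continuous_on_compose2[OF C1_function.continuous[OF f, of UNIV]] continuous_intros) auto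
  from sphere_integral_eq[OF sphere_measurable_continuous[OF this], of "axis i 1"]
  show ?thesis
    using C1_function.integral_cball_derivative[OF f \<open>R > 0\<close>, of "axis i 1"]
    by (simp add: inner_axis mult.commute)
qed

text \<open>By \<open>borel_prod\<close> the product sigma-algebra of two Borel algebras is the
  Borel algebra of the product space, so continuity on the restricted space suffices.\<close>

lemma continuous_imp_cosphere_measurable:
  fixes U :: "(real^'n::finite) set"
  assumes "continuous_on (U \<times> sphere 0 1) g"
  shows "g \<in> borel_measurable (cosphere_measure U)"
proof -
  have "(\<lambda>x. x) \<in> borel_measurable (restrict_space lborel U)"
    by (rule measurable_restrict_space1) simp
  moreover have "(\<lambda>\<omega>. \<omega>) \<in> borel_measurable (sphere_measure :: (real^'n) measure)"
    by (intro sphere_measurable_continuous continuous_on_id)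
  ultimately have "(\<lambda>p. (fst p, snd p)) \<in> measurable (cosphere_measure U) (borel \<Otimes>\<^sub>M borel)"
    unfolding cosphere_measure_def
    by (intro measurable_Pair measurable_compose[OF measurable_fst] measurable_compose[OF measurable_snd])
  then have "(\<lambda>p. p) \<in> measurable (cosphere_measure U) borel" by (simp add: borel_prod)
  then have "(\<lambda>p. p) \<in> measurable (cosphere_measure U) (restrict_space borel (U \<times> sphere 0 1))"
    by (rule measurable_restrict_space2[rotated])
       (auto simp: cosphere_measure_def space_pair_measure space_restrict_space space_sphere_measure)
  from measurable_compose[OF this borel_measurable_continuous_on_restrict[OF assms]] show ?thesis .
qed

lemma space_cosphere_measure: "space (cosphere_measure U) = U \<times> sphere 0 1"
  unfolding cosphere_measure_def by (simp add: space_pair_measure space_restrict_space space_sphere_measure)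

text \<open>U may have infinite volume, so integrability comes from K: g is bounded on K times the
  sphere by compactness, this set has finite product measure, and g vanishes off it.\<close>

theorem cosphere_Fubini:
  fixes g :: "'n::finite cotangent \<Rightarrow> complex"
  assumes "open U" "compact K" "K \<subseteq> U" and g: "continuous_on (U \<times> sphere 0 1) g"
    and supp: "\<And>x \<omega>. x \<in> U - K \<Longrightarrow> norm \<omega> = 1 \<Longrightarrow> g (x, \<omega>) = 0"
  shows "set_integrable lborel U (\<lambda>x. \<integral>\<omega>. g (x, \<omega>) \<partial>sphere_measure)"
    and "(LINT x:U|lborel. \<integral>\<omega>. g (x, \<omega>) \<partial>sphere_measure) = (\<integral>p. g p \<partial>cosphere_measure U)"
proof -
  let ?M = "restrict_space lborel U" and ?S = "sphere_measure :: (real^'n) measure"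
  have sets_U: "U \<inter> space lborel \<in> sets lborel" using assms(1) by simp
  interpret M: sigma_finite_measure ?M
    using assms(1) by (intro sigma_finite_measure_restrict_space lborel.sigma_finite_measure_axioms) auto
  interpret P: pair_sigma_finite ?M ?S ..
  have "bounded (g ` (K \<times> sphere 0 1))"
    using assms(2,3) by (intro compact_imp_bounded compact_continuous_image compact_Times continuous_on_subset[OF g]) auto
  then obtain B where B: "\<And>p. p \<in> K \<times> sphere 0 1 \<Longrightarrow> norm (g p) \<le> B"
    unfolding bounded_iff by blast
  have sets_K: "K \<in> sets ?M"
    using assms(1-3) by (auto simp: sets_restrict_space_iff borel_compact)
  have sets_S: "sphere 0 1 \<in> sets (sphere_measure :: (real^'n) measure)"
    using sets.top[of "sphere_measure :: (real^'n) measure"] unfolding space_sphere_measure .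
  have int: "integrable (?M \<Otimes>\<^sub>M ?S) g"
  proof (rule integrableI_bounded_set)
    show "K \<times> sphere 0 1 \<in> sets (?M \<Otimes>\<^sub>M ?S)" using sets_K sets_S by (rule pair_measureI)
    show "g \<in> borel_measurable (?M \<Otimes>\<^sub>M ?S)"
      using continuous_imp_cosphere_measurable[OF g] unfolding cosphere_measure_def .
    have "emeasure ?M K < \<infinity>"
      using assms(1-3) emeasure_lborel_cbox_finite emeasure_compact_finite[OF assms(2)]
      by (simp add: emeasure_restrict_space)
    moreover have "emeasure ?S (sphere 0 1) < \<infinity>"
      using sphere_measure.emeasure_finite[of "sphere (0 :: real^'n) 1"] unfolding infinity_ennreal_def less_top .
    ultimately show "emeasure (?M \<Otimes>\<^sub>M ?S) (K \<times> sphere 0 1) < \<infinity>"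
      unfolding sphere_measure.emeasure_pair_measure_Times[OF sets_K sets_S]
      by (simp add: ennreal_mult_less_top)
    show "AE p in ?M \<Otimes>\<^sub>M ?S. p \<in> K \<times> sphere 0 1 \<longrightarrow> norm (g p) \<le> B"
      using B by (intro AE_I2) blast
    show "AE p in ?M \<Otimes>\<^sub>M ?S. p \<notin> K \<times> sphere 0 1 \<longrightarrow> g p = 0"
    proof (intro AE_I2 impI)
      fix p assume "p \<in> space (?M \<Otimes>\<^sub>M ?S)" "p \<notin> K \<times> sphere 0 1"
      then have "fst p \<in> U - K" "norm (snd p) = 1"
        by (auto simp: space_pair_measure space_restrict_space space_sphere_measure)
      then show "g p = 0" using supp[of "fst p" "snd p"] by simp
    qed
  qed
  from P.integrable_fst'[OF int] show "set_integrable lborel U (\<lambda>x. \<integral>\<omega>. g (x, \<omega>) \<partial>sphere_measure)"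
    unfolding set_integrable_def integrable_restrict_space[OF sets_U] .
  from P.integral_fst'[OF int]
  show "(LINT x:U|lborel. \<integral>\<omega>. g (x, \<omega>) \<partial>sphere_measure) = (\<integral>p. g p \<partial>cosphere_measure U)"
    unfolding set_lebesgue_integral_def cosphere_measure_def integral_restrict_space[OF sets_U] .
qed


section \<open>The form omitting one covariable\<close>

text \<open>Bridges \<open>wedge\<close> to the determinant theory of matrices indexed by natural
  numbers, where omitting a covector and a vector becomes deletion of a row and a column.\<close>

definition wedge_matrix :: "('v \<Rightarrow> real) list \<Rightarrow> 'v list \<Rightarrow> real mat" where
  "wedge_matrix ls vs = Matrix.mat (length ls) (length ls) (\<lambda>(a, b). (ls ! a) (vs ! b))"

lemma wedge_matrix_carrier: "wedge_matrix ls vs \<in> carrier_mat (length ls) (length ls)"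
  unfolding wedge_matrix_def by simp

lemma wedge_eq_det: "wedge ls vs = Determinant.det (wedge_matrix ls vs)"
  unfolding det_def'[OF wedge_matrix_carrier] wedge_def lessThan_atLeast0
proof (rule sum.cong[OF refl])
  fix \<pi> assume "\<pi> \<in> {\<pi>. \<pi> permutes {0..<length ls}}"
  then have "\<pi> a < length ls" if "a < length ls" for a
    using that permutes_in_image[of \<pi> "{0..<length ls}" a] by simp
  then show "of_int (sign \<pi>) * (\<Prod>a = 0..<length ls. (ls ! a) (vs ! \<pi> a)) =
      of_int (sign \<pi>) * (\<Prod>a = 0..<length ls. wedge_matrix ls vs $$ (a, \<pi> a))"
    unfolding wedge_matrix_def by simp
qed

text \<open>Each permutation hits the index k exactly once, so every term of the Leibniz sum changes
  sign. This is used to reverse the orientation of a frame.\<close>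

lemma wedge_negate:
  assumes "k < length ls" "k < length vs" "\<And>l v. l \<in> set ls \<Longrightarrow> l (- v) = - l v"
  shows "wedge ls (vs[k := - vs ! k]) = - wedge ls vs"
proof -
  have "(\<Prod>a<length ls. (ls ! a) (vs[k := - vs ! k] ! \<pi> a)) = - (\<Prod>a<length ls. (ls ! a) (vs ! \<pi> a))"
    if \<pi>: "\<pi> permutes {..<length ls}" for \<pi>
  proof -
    let ?s = "\<lambda>b. if b = k then - 1 else (1 :: real)"
    have "(\<Prod>a<length ls. (ls ! a) (vs[k := - vs ! k] ! \<pi> a))
        = (\<Prod>a<length ls. ?s (\<pi> a) * (ls ! a) (vs ! \<pi> a))"
      using assms by (intro prod.cong) (auto simp: nth_list_update)
    also have "\<dots> = (\<Prod>a<length ls. ?s (\<pi> a)) * (\<Prod>a<length ls. (ls ! a) (vs ! \<pi> a))"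
      by (rule prod.distrib)
    also have "(\<Prod>a<length ls. ?s (\<pi> a)) = (\<Prod>b<length ls. ?s b)"
      using prod.permute[OF \<pi>, of ?s] by (simp add: o_def)
    also have "\<dots> = - 1" using assms(1) by (subst prod.delta) auto
    finally show ?thesis by simp
  qed
  then show ?thesis unfolding wedge_def sum_negf[symmetric] by (intro sum.cong) auto
qed

text \<open>The covectors act as orthonormal coordinates: the Parseval identity turns orthonormality
  of a frame into orthogonality of its coordinate matrix.\<close>

locale coordinate_list =
  fixes ls :: "('v::real_inner \<Rightarrow> real) list"
  assumes parseval: "(\<Sum>a<length ls. (ls ! a) v * (ls ! a) w) = v \<bullet> w"
begin

definition orthonormal :: "'v list \<Rightarrow> bool" where
  "orthonormal vs \<longleftrightarrow> length vs = length ls \<and>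
     (\<forall>a<length vs. \<forall>b<length vs. vs ! a \<bullet> vs ! b = (if a = b then 1 else 0))"

lemma orthonormal_Cons:
  "orthonormal (v # vs) \<longleftrightarrow> Suc (length vs) = length ls \<and> v \<bullet> v = 1 \<and>
     (\<forall>a<length vs. vs ! a \<bullet> v = 0) \<and>
     (\<forall>a<length vs. \<forall>b<length vs. vs ! a \<bullet> vs ! b = (if a = b then 1 else 0))"
proof -
  have "v \<bullet> vs ! b = vs ! b \<bullet> v" for b by (rule inner_commute)
  then show ?thesis unfolding orthonormal_def by (auto simp: All_less_Suc2)
qed

lemma orthonormal_transpose_mult:
  assumes "orthonormal vs"
  shows "transpose_mat (wedge_matrix ls vs) * wedge_matrix ls vs = 1\<^sub>m (length ls)"
proof (rule eq_matI)
  fix b c assume "b < dim_row (1\<^sub>m (length ls) :: real mat)" "c < dim_col (1\<^sub>m (length ls) :: real mat)"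
  then have bc: "b < length ls" "c < length ls" by simp_all
  then have "(transpose_mat (wedge_matrix ls vs) * wedge_matrix ls vs) $$ (b, c)
      = (\<Sum>a<length ls. (ls ! a) (vs ! b) * (ls ! a) (vs ! c))"
    unfolding wedge_matrix_def by (simp add: scalar_prod_def lessThan_atLeast0)
  then show "(transpose_mat (wedge_matrix ls vs) * wedge_matrix ls vs) $$ (b, c) = 1\<^sub>m (length ls) $$ (b, c)"
    using bc assms unfolding parseval orthonormal_def by simp
qed (simp_all add: wedge_matrix_def)

lemma orthonormal_wedge_square:
  assumes "orthonormal vs"
  shows "(wedge ls vs)\<^sup>2 = 1"
proof -
  let ?M = "wedge_matrix ls vs"
  have M: "?M \<in> carrier_mat (length ls) (length ls)" by (rule wedge_matrix_carrier)
  have "Determinant.det (transpose_mat ?M * ?M) = wedge ls vs * wedge ls vs"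
    unfolding wedge_eq_det
    using det_mult[of "transpose_mat ?M" "length ls" ?M] det_transpose[OF M] M by simp
  then show ?thesis
    unfolding orthonormal_transpose_mult[OF assms] by (simp add: power2_eq_square)
qed

text \<open>The matrix of an orthonormal frame of determinant one is its own cofactor matrix.\<close>
lemma wedge_omit_coordinate:
  assumes ls: "ls = ls1 @ l # ls2" and vs: "orthonormal (v # vs)" and pos: "wedge ls (v # vs) > 0"
  shows "wedge (ls1 @ ls2) vs = (- 1) ^ length ls1 * l v"
proof -
  let ?M = "wedge_matrix ls (v # vs)" and ?k = "length ls1" and ?m = "length ls"
  have M: "?M \<in> carrier_mat ?m ?m" by (rule wedge_matrix_carrier)
  have k: "?k < ?m" "0 < ?m" using ls by auto
  have det1: "Determinant.det ?M = 1"
    using orthonormal_wedge_square[OF vs] pos unfolding wedge_eq_det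
    by (simp add: power2_eq_1_iff)
  have inv: "?M * transpose_mat ?M = 1\<^sub>m ?m"
    using mat_mult_left_right_inverse[OF _ M orthonormal_transpose_mult[OF vs]] M by simp
  \<comment> \<open>Here M times its transpose is the identity and adj M times M is det M = 1, so
    the adjugate is the transpose.\<close>
  have "adj_mat ?M = adj_mat ?M * (?M * transpose_mat ?M)"
    unfolding inv using adj_mat(1)[OF M] by simp
  also have "\<dots> = (adj_mat ?M * ?M) * transpose_mat ?M"
    using adj_mat(1)[OF M] M by (intro assoc_mult_mat[symmetric]) auto
  also have "\<dots> = transpose_mat ?M"
    unfolding adj_mat(3)[OF M] det1 using M by (intro eq_matI) auto
  finally have "adj_mat ?M $$ (0, ?k) = transpose_mat ?M $$ (0, ?k)" by simp
  \<comment> \<open>Entry (0, k) of the adjugate is the cofactor at row k and column 0. Deleting the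
    row of l and the column of v leaves the matrix of the shortened wedge, with sign (-1)^k.\<close>
  then have "cofactor ?M ?k 0 = l v"
    using k ls unfolding adj_mat_def wedge_matrix_def by simp
  moreover have "mat_delete ?M ?k 0 = wedge_matrix (ls1 @ ls2) vs"
    unfolding mat_delete_def wedge_matrix_def
    by (rule eq_matI) (auto simp: ls nth_append Suc_diff_le not_less nth_Cons split: nat.split)
  ultimately have "(- 1) ^ ?k * wedge (ls1 @ ls2) vs = l v"
    unfolding cofactor_def wedge_eq_det by simp
  then have "(- 1) ^ ?k * ((- 1) ^ ?k * wedge (ls1 @ ls2) vs) = (- 1) ^ ?k * l v" by simp
  then show ?thesis by (simp add: mult.assoc[symmetric] power_add[symmetric])
qed

end

section \<open>Positive orthonormal frames of the cotangent space\<close>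

lemma indices_properties:
  "sorted (indices :: 'n::{finite,linorder} list)" "distinct (indices :: 'n list)"
  "set (indices :: 'n list) = UNIV" "length (indices :: 'n list) = CARD('n)"
  unfolding indices_def by simp_all

lemma sum_nth_eq_sum_list: "(\<Sum>a<length xs. g (xs ! a)) = sum_list (map g xs)" for g :: "'a \<Rightarrow> real"
  by (simp add: sum_list_sum_nth lessThan_atLeast0)

lemma sum_list_indices: "sum_list (map g indices) = (\<Sum>j\<in>UNIV. g j)"
  for g :: "'n::{finite,linorder} \<Rightarrow> real"
  using indices_properties(2,3)[where 'n = 'n] sum_list_distinct_conv_sum_set[of indices g] by simp

abbreviation cotangent_coordinates :: "('n::{finite,linorder} cotangent \<Rightarrow> real) list" where
  "cotangent_coordinates \<equiv> map dxi indices @ map dx indices"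

interpretation cotangent: coordinate_list "cotangent_coordinates :: ('n::{finite,linorder} cotangent \<Rightarrow> real) list"
proof
  fix v w :: "'n cotangent"
  let ?ls = "cotangent_coordinates :: ('n cotangent \<Rightarrow> real) list"
  have "(\<Sum>a<length ?ls. (?ls ! a) v * (?ls ! a) w) = sum_list (map (\<lambda>l. l v * l w) ?ls)"
    by (rule sum_nth_eq_sum_list)
  also have "\<dots> = (\<Sum>j\<in>UNIV. dxi j v * dxi j w) + (\<Sum>j\<in>UNIV. dx j v * dx j w)"
    by (simp add: o_def sum_list_indices)
  finally show "(\<Sum>a<length ?ls. (?ls ! a) v * (?ls ! a) w) = v \<bullet> w"
    by (simp add: inner_prod_def inner_vec_def dx_def dxi_def)
qed

text \<open>The number of covectors preceding \<open>dxi i\<close> is the position of i minus one,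
  which becomes the exponent of the sign.\<close>

lemma indices_split:
  fixes i :: "'n::{finite,linorder}"
  obtains js ks where "indices = js @ i # ks" "filter (\<lambda>j. j \<noteq> i) indices = js @ ks"
    "length js = card {j. j < i}"
proof -
  obtain js ks where eq: "indices = js @ i # ks"
    using indices_properties(3) by (metis UNIV_I split_list)
  have d: "distinct (js @ i # ks)" and s: "sorted (js @ i # ks)" and u: "set (js @ i # ks) = UNIV"
    using indices_properties(1-3)[where 'n = 'n] unfolding eq by blast+
  have "set js = {j. j < i}"
  proof (intro equalityI subsetI)
    fix j assume "j \<in> set js"
    then show "j \<in> {j. j < i}" using d s by (auto simp: sorted_append order_less_le)
  next
    fix j assume j: "j \<in> {j. j < i}"
    then have "j \<in> set (js @ i # ks)" unfolding u by simp
    then show "j \<in> set js" using j s by (auto simp: sorted_append)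
  qed
  then have "length js = card {j. j < i}" using d distinct_card[of js] by simp
  moreover have "filter (\<lambda>j. j \<noteq> i) indices = js @ ks"
  proof -
    have "filter (\<lambda>j. j \<noteq> i) js = js" "filter (\<lambda>j. j \<noteq> i) ks = ks"
      using d by (auto simp: filter_id_conv)
    then show ?thesis unfolding eq by simp
  qed
  ultimately show thesis using eq that by blast
qed

lemma orthonormal_Cons_iff_frame:
  fixes p :: "'n::{finite,linorder} cotangent"
  assumes "norm (snd p) = 1"
  shows "positive_orthonormal_frame p vs \<longleftrightarrow>
    cotangent.orthonormal ((0, snd p) # vs) \<and> orientation_form ((0, snd p) # vs) > 0"
proof -
  have len: "length (cotangent_coordinates :: ('n cotangent \<Rightarrow> real) list) = 2 * CARD('n)"
    by (simp add: indices_properties)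
  \<comment> \<open>Makes the truncated subtraction in \<open>2 * CARD('n) - 1\<close>
    exact.\<close>
  have "CARD('n) > 0" by simp
  then have "length vs = 2 * CARD('n) - 1 \<longleftrightarrow> Suc (length vs) = 2 * CARD('n)" by linarith
  moreover have "(0, snd p) \<bullet> ((0, snd p) :: 'n cotangent) = 1"
    using assms by (simp add: inner_prod_def dot_square_norm)
  ultimately show ?thesis
    unfolding positive_orthonormal_frame_def cotangent.orthonormal_Cons len by blast
qed

text \<open>An orthonormal basis of the hyperplane orthogonal to the normal, prefixed by the normal,
  has determinant 1 or -1. In the second case one vector is negated; there is one to negate because
  2n - 1 \<ge> 1.\<close>

lemma positive_orthonormal_frame_exists:
  fixes p :: "'n::{finite,linorder} cotangent"
  assumes "norm (snd p) = 1"
  shows "\<exists>vs. positive_orthonormal_frame p vs"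
proof -
  let ?N = "(0, snd p) :: 'n cotangent"
  let ?S = "{y. ?N \<bullet> y = 0}"
  have N: "?N \<noteq> 0" "?N \<bullet> ?N = 1" using assms by (auto simp: inner_prod_def dot_square_norm zero_prod_def)
  have len: "length (cotangent_coordinates :: ('n cotangent \<Rightarrow> real) list) = 2 * CARD('n)"
    by (simp add: indices_properties)
  obtain B where B: "B \<subseteq> ?S" "pairwise Linear_Algebra.orthogonal B" "\<And>x. x \<in> B \<Longrightarrow> norm x = 1"
    "independent B" "card B = dim ?S"
    using orthonormal_basis_subspace[OF subspace_hyperplane[of ?N]] by metis
  have card: "card B = 2 * CARD('n) - 1"
    unfolding B(5) dim_hyperplane[OF N(1)] by simp
  obtain vs where vs: "set vs = B" "distinct vs"
    using finite_distinct_list[OF independent_imp_finite[OF B(4)]] by blast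
  then have lvs: "length vs = 2 * CARD('n) - 1" using card distinct_card by metis
  have "CARD('n) > 0" by simp
  then have lvs': "length vs > 0" "Suc (length vs) = 2 * CARD('n)" using lvs by linarith+
  have on: "vs ! a \<bullet> vs ! b = (if a = b then 1 else 0)" if "a < length vs" "b < length vs" for a b
  proof (cases "a = b")
    case True
    then show ?thesis using B(3)[of "vs ! a"] that vs(1) nth_mem[of a vs] by (simp add: dot_square_norm)
  next
    case False
    then have "vs ! a \<noteq> vs ! b" using that vs(2) by (simp add: nth_eq_iff_index_eq)
    then show ?thesis using B(2) that vs(1) False by (auto simp: pairwise_def Linear_Algebra.orthogonal_def)
  qed
  have perp: "vs ! a \<bullet> ?N = 0" if "a < length vs" for a
    using B(1) that vs(1) nth_mem[OF that] inner_commute[of "vs ! a" ?N] by auto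
  have ortho: "cotangent.orthonormal (?N # vs)"
    unfolding cotangent.orthonormal_Cons len using on perp N(2) lvs'(2) by blast
  show ?thesis
  proof (cases "orientation_form (?N # vs) > 0")
    case True
    with ortho have "positive_orthonormal_frame p vs"
      unfolding orthonormal_Cons_iff_frame[OF assms] ..
    then show ?thesis by blast
  next
    case False
    let ?vs = "vs[0 := - vs ! 0]"
    \<comment> \<open>Position 1 of the list with the normal in front is position 0 of
      \<open>vs\<close>.\<close>
    have "wedge cotangent_coordinates ((?N # vs)[1 := - (?N # vs) ! 1])
      = - wedge cotangent_coordinates (?N # vs)"
    proof (rule wedge_negate)
      have "1 < 2 * CARD('n)" using lvs' by linarith
      then show "1 < length (cotangent_coordinates :: ('n cotangent \<Rightarrow> real) list)"
        "1 < length (?N # vs)" unfolding len using lvs'(2) by simp_all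
    qed (auto simp: dx_def dxi_def)
    then have "orientation_form (?N # ?vs) = - orientation_form (?N # vs)"
      unfolding orientation_form_def by simp
    moreover have "orientation_form (?N # vs) \<noteq> 0"
      using cotangent.orthonormal_wedge_square[OF ortho] unfolding orientation_form_def by auto
    moreover have "cotangent.orthonormal (?N # ?vs)"
    proof -
      have "?vs ! a \<bullet> ?N = 0" if "a < length vs" for a
        using perp[OF that] perp[OF lvs'(1)] that by (cases "a = 0") simp_all
      moreover have "?vs ! a \<bullet> ?vs ! b = (if a = b then 1 else 0)" if "a < length vs" "b < length vs" for a b
        using on[OF that] on[OF that(1) lvs'(1)] on[OF lvs'(1) that(2)] that
        by (auto simp: nth_list_update split: if_splits)
      ultimately show ?thesis
        unfolding cotangent.orthonormal_Cons len length_list_update using N(2) lvs'(2) by blast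
    qed
    ultimately have "positive_orthonormal_frame p ?vs"
      unfolding orthonormal_Cons_iff_frame[OF assms] using False by linarith
    then show ?thesis by blast
  qed
qed

text \<open>The cofactor argument works for whichever positive frame \<open>SOME\<close> returns;
  existence of such a frame is what makes the choice meaningful.\<close>

theorem omit_dxi_form_frame:
  fixes p :: "'n::{finite,linorder} cotangent"
  assumes "norm (snd p) = 1"
  shows "omit_dxi_form i (SOME vs. positive_orthonormal_frame p vs)
    = (- 1) ^ card {j. j < i} * snd p $ i"
proof -
  let ?vs = "SOME vs. positive_orthonormal_frame p vs"
  have "positive_orthonormal_frame p ?vs"
    using positive_orthonormal_frame_exists[OF assms] by (rule someI_ex)
  then have vs: "cotangent.orthonormal ((0, snd p) # ?vs)" "wedge cotangent_coordinates ((0, snd p) # ?vs) > 0"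
    unfolding orthonormal_Cons_iff_frame[OF assms] orientation_form_def by blast+
  obtain js ks where jk: "indices = js @ i # ks" "filter (\<lambda>j. j \<noteq> i) indices = js @ ks"
    "length js = card {j. j < i}"
    by (rule indices_split)
  have "cotangent_coordinates = map dxi js @ dxi i # (map dxi ks @ map dx indices)"
    by (simp add: jk(1))
  from cotangent.wedge_omit_coordinate[OF this vs] show ?thesis
    unfolding omit_dxi_form_def jk(2) by (simp add: jk(3) dxi_def)
qed


section \<open>Cut-off integrals of derivatives\<close>

context cutoff
begin

lemma C1_function_fibre:
  fixes \<sigma> :: "'n cotangent \<Rightarrow> complex"
  assumes "smooth_on (U \<times> UNIV) \<sigma>" "x \<in> U"
  shows "C1_function (\<lambda>\<xi>. \<sigma> (x, \<xi>)) (\<lambda>\<xi> h. dir_deriv (0, h) \<sigma> (x, \<xi>))"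
proof
  fix \<xi> w :: "real^'n"
  have "(\<sigma> has_derivative (\<lambda>v. dir_deriv v \<sigma> (x, \<xi>))) (at (x, \<xi>))"
    using assms by (intro dir_deriv_works smooth_on_imp_differentiable[of "U \<times> UNIV"]) auto
  then show "((\<lambda>\<xi>. \<sigma> (x, \<xi>)) has_derivative (\<lambda>h. dir_deriv (0, h) \<sigma> (x, \<xi>))) (at \<xi>)"
    by (rule has_derivative_compose[rotated]) (auto intro!: derivative_eq_intros)
  show "continuous_on UNIV (\<lambda>\<xi>. dir_deriv (0, w) \<sigma> (x, \<xi>))"
    using assms by (intro continuous_on_compose2[OF smooth_on_imp_continuous[OF smooth_on_dir_deriv]] continuous_intros) auto
qed

lemma fibre_ball_integral_deriv_xi:
  assumes "smooth_on (U \<times> UNIV) \<sigma>" "x \<in> U" "R > 0"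
  shows "fibre_ball_integral (deriv_xi i \<sigma>) x R
    = R ^ (CARD('n) - 1) *\<^sub>R (\<integral>\<omega>. (\<omega> $ i) *\<^sub>R \<sigma> (x, R *\<^sub>R \<omega>) \<partial>sphere_measure)"
  unfolding fibre_ball_integral_def deriv_xi_def
  by (rule divergence_theorem_cball[OF C1_function_fibre[OF assms(1,2)] assms(3)])

lemma set_integrable_deriv_xi:
  assumes "smooth_on (U \<times> UNIV) \<sigma>" "x \<in> U"
  shows "set_integrable lborel (cball 0 R) (\<lambda>\<xi>. deriv_xi i \<sigma> (x, \<xi>))"
  unfolding deriv_xi_def
  by (intro set_integrable_compact continuous_on_subset[OF C1_function.cont[OF C1_function_fibre[OF assms]]]) auto

text \<open>The flux through the unit sphere of the vector field with i-th component h and all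
  others 0.\<close>

definition sphere_component :: "'n \<Rightarrow> ('n cotangent \<Rightarrow> complex) \<Rightarrow> real^'n \<Rightarrow> complex" where
  "sphere_component i h x = (\<integral>\<omega>. (\<omega> $ i) *\<^sub>R h (x, \<omega>) \<partial>sphere_measure)"

lemma continuous_on_sphere_homogeneous:
  assumes "positively_homogeneous U d h" "x \<in> U"
  shows "continuous_on (sphere 0 1) (\<lambda>\<omega>. h (x, \<omega>))"
proof -
  have "continuous_on (U \<times> - {0}) h"
    using assms unfolding positively_homogeneous_def by (auto intro: smooth_on_imp_continuous)
  moreover have "continuous_on (sphere 0 1) (\<lambda>\<omega>::real^'n. (x, \<omega>))"
    by (intro continuous_intros)
  ultimately show ?thesis by (rule continuous_on_compose2) (use assms(2) in auto)
qed

text \<open>Formulated for any finite truncation and a bound at one x, so that it serves both the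
  chosen components and the classical expansion of a symbol of non-integer order. With a remainder
  of order -n, the flux error is at most a multiple of R^(n-1) R^(-n) = 1/R.\<close>

lemma has_constant_term_deriv_xi:
  assumes \<sigma>: "smooth_on (U \<times> UNIV) \<sigma>" and x: "x \<in> U"
    and D: "finite D" and hom: "\<And>d. d \<in> D \<Longrightarrow> positively_homogeneous U d (c d)"
    and bnd: "bounded_order {x} (- real CARD('n)) (\<lambda>p. \<sigma> p - (\<Sum>d\<in>D. \<psi> p * c d p))"
  defines "d0 \<equiv> 1 - of_nat CARD('n) :: complex"
  shows "has_constant_term (fibre_ball_integral (deriv_xi i \<sigma>) x)
           (if d0 \<in> D then sphere_component i (c d0) x else 0)"
proof -
  let ?N = "CARD('n)" and ?F = "fibre_ball_integral (deriv_xi i \<sigma>) x"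
  let ?I = "\<lambda>d. sphere_component i (c d) x"
  let ?A = "(\<lambda>d. d - d0) ` (D - {d0})"
  let ?s = "\<lambda>R. \<Sum>d\<in>D. ?I d * of_real R powr (d - d0)"
  \<comment> \<open>For R \<ge> 1 this is the remainder evaluated at
    \<open>R *\<^sub>R \<omega>\<close>: \<open>\<psi>\<close> is 1 there and the components scale
    by homogeneity.\<close>
  let ?\<rho> = "\<lambda>R \<omega>. \<sigma> (x, R *\<^sub>R \<omega>) - (\<Sum>d\<in>D. of_real R powr d * c d (x, \<omega>))"
  obtain C where C: "C \<ge> 0"
    "\<And>\<xi>. cmod (\<sigma> (x, \<xi>) - (\<Sum>d\<in>D. \<psi> (x, \<xi>) * c d (x, \<xi>))) \<le> C * (1 + norm \<xi>) powr (- real ?N)"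
    using bounded_order_nonneg[OF bnd] by (metis singletonI)
  define V where "V = measure (sphere_measure :: (real^'n) measure) (space sphere_measure)"
  have cont_c: "continuous_on (sphere 0 1) (\<lambda>\<omega>. c d (x, \<omega>))" if "d \<in> D" for d
    using continuous_on_sphere_homogeneous[OF hom[OF that] x] .
  have cont_\<sigma>: "continuous_on (sphere 0 1) (\<lambda>\<omega>. \<sigma> (x, R *\<^sub>R \<omega>))" for R
    by (intro continuous_on_compose2[OF C1_function.continuous[OF C1_function_fibre[OF \<sigma> x], of UNIV]]
        continuous_intros) auto
  have R_powr: "R ^ (?N - 1) *\<^sub>R (of_real R powr d * z) = z * of_real R powr (d - d0)"
    if "R > 0" for R d and z :: complex
  proof -
    have "of_real (R ^ (?N - 1)) = (of_real R :: complex) powr (of_nat (?N - 1))"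
      unfolding of_real_power by (subst powr_nat) (use that in simp)
    then have "R ^ (?N - 1) *\<^sub>R (of_real R powr d * z) = z * (of_real R powr of_nat (?N - 1) * of_real R powr d)"
      by (simp add: scaleR_conv_of_real)
    also have "of_real R powr of_nat (?N - 1) * of_real R powr d = (of_real R :: complex) powr (d - d0)"
      unfolding d0_def by (simp add: powr_add[symmetric] of_nat_diff Suc_leI algebra_simps)
    finally show ?thesis .
  qed
  have F_eq: "?F R - ?s R = R ^ (?N - 1) *\<^sub>R (\<integral>\<omega>. (\<omega> $ i) *\<^sub>R ?\<rho> R \<omega> \<partial>sphere_measure)" if "R > 0" for R
  proof -
    have int_c: "integrable sphere_measure (\<lambda>\<omega>. (\<omega> $ i) *\<^sub>R (of_real R powr d * c d (x, \<omega>)))" if "d \<in> D" for d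
      by (intro sphere_integrable_continuous continuous_intros cont_c that)
    have int_\<rho>: "integrable sphere_measure (\<lambda>\<omega>. (\<omega> $ i) *\<^sub>R ?\<rho> R \<omega>)"
      by (intro sphere_integrable_continuous continuous_intros cont_\<sigma> cont_c)
    have "(\<integral>\<omega>. (\<omega> $ i) *\<^sub>R \<sigma> (x, R *\<^sub>R \<omega>) \<partial>sphere_measure)
        = (\<integral>\<omega>. (\<omega> $ i) *\<^sub>R ?\<rho> R \<omega> + (\<Sum>d\<in>D. (\<omega> $ i) *\<^sub>R (of_real R powr d * c d (x, \<omega>))) \<partial>sphere_measure)"
      by (intro Bochner_Integration.integral_cong) (auto simp: scaleR_diff_right scaleR_sum_right)
    also have "\<dots> = (\<integral>\<omega>. (\<omega> $ i) *\<^sub>R ?\<rho> R \<omega> \<partial>sphere_measure)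
        + (\<Sum>d\<in>D. \<integral>\<omega>. (\<omega> $ i) *\<^sub>R (of_real R powr d * c d (x, \<omega>)) \<partial>sphere_measure)"
      using int_c by (subst Bochner_Integration.integral_add[OF int_\<rho>]) (auto intro: Bochner_Integration.integral_sum)
    also have "(\<Sum>d\<in>D. \<integral>\<omega>. (\<omega> $ i) *\<^sub>R (of_real R powr d * c d (x, \<omega>)) \<partial>sphere_measure)
        = (\<Sum>d\<in>D. of_real R powr d * ?I d)"
      unfolding sphere_component_def by (simp only: mult_scaleR_right[symmetric] integral_mult_right_zero)
    finally have "?F R = R ^ (?N - 1) *\<^sub>R (\<integral>\<omega>. (\<omega> $ i) *\<^sub>R ?\<rho> R \<omega> \<partial>sphere_measure)
        + (\<Sum>d\<in>D. R ^ (?N - 1) *\<^sub>R (of_real R powr d * ?I d))"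
      unfolding fibre_ball_integral_deriv_xi[OF \<sigma> x that] by (simp only: scaleR_add_right scaleR_sum_right)
    then show ?thesis unfolding R_powr[OF that] by simp
  qed
  have "((\<lambda>R. ?F R - ?s R) \<longlongrightarrow> 0) at_top"
  proof (rule Lim_null_comparison)
    show "eventually (\<lambda>R. norm (?F R - ?s R) \<le> C * V / R) at_top"
      using eventually_ge_at_top[of 1]
    proof eventually_elim
      case (elim R)
      then have R: "R > 0" by simp
      let ?b = "C * (1 + R) powr (- real ?N)"
      have "norm ((\<omega> $ i) *\<^sub>R ?\<rho> R \<omega>) \<le> ?b" if \<omega>: "\<omega> \<in> sphere 0 1" for \<omega>
      proof -
        have "\<omega> \<noteq> 0" using \<omega> by auto
        then have "c d (x, R *\<^sub>R \<omega>) = of_real R powr d * c d (x, \<omega>)" if "d \<in> D" for d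
          by (rule positively_homogeneousD[OF hom[OF that] x R])
        moreover have "\<psi> (x, R *\<^sub>R \<omega>) = 1" using elim \<omega> by (intro \<psi>_eq_1 x) auto
        ultimately have "norm (?\<rho> R \<omega>) \<le> ?b" using C(2)[of "R *\<^sub>R \<omega>"] R \<omega> by simp
        moreover have "\<bar>\<omega> $ i\<bar> \<le> 1" using component_le_norm_cart[of \<omega> i] \<omega> by simp
        ultimately have "\<bar>\<omega> $ i\<bar> * norm (?\<rho> R \<omega>) \<le> 1 * ?b" by (intro mult_mono) auto
        then show ?thesis by simp
      qed
      then have "norm (\<integral>\<omega>. (\<omega> $ i) *\<^sub>R ?\<rho> R \<omega> \<partial>sphere_measure) \<le> (LINT \<omega>|(sphere_measure :: (real^'n) measure). ?b)"
        by (intro Bochner_Integration.integral_norm_bound_integral sphere_integrable_continuous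
              continuous_intros cont_\<sigma> cont_c) (auto simp: space_sphere_measure)
      also have "\<dots> = ?b * V" unfolding V_def by simp
      finally have "norm (?F R - ?s R) \<le> R ^ (?N - 1) * (?b * V)"
        unfolding F_eq[OF R] norm_scaleR using R by (intro mult_mono) auto
      also have "\<dots> = C * V * (R ^ (?N - 1) * (1 + R) powr (- real ?N))" by simp
      also have "\<dots> \<le> C * V * (1 / R)"
      proof (rule mult_left_mono)
        have "R ^ (?N - 1) * (1 + R) powr (- real ?N) \<le> R ^ (?N - 1) * R powr (- real ?N)"
          using R by (intro mult_left_mono powr_mono2') auto
        also have "\<dots> = R powr (real (?N - 1) + - real ?N)"
          unfolding powr_add powr_realpow[OF R] ..
        also have "real (?N - 1) + - real ?N = - 1" by (simp add: of_nat_diff Suc_leI)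
        finally show "R ^ (?N - 1) * (1 + R) powr (- real ?N) \<le> 1 / R"
          using R by (simp add: powr_minus divide_inverse)
        show "0 \<le> C * V" using C(1) unfolding V_def by simp
      qed
      finally show ?case by simp
    qed
    show "((\<lambda>R. C * V / R) \<longlongrightarrow> 0) at_top"
      by (intro tendsto_divide_0[OF tendsto_const] filterlim_at_top_imp_at_infinity filterlim_ident)
  qed
  \<comment> \<open>The power with d = d0 is 1 and gives the constant term; all other exponents d -
    d0 are nonzero, and the logarithm has coefficient 0.\<close>
  moreover have s_eq: "?s R = (\<Sum>z\<in>?A. ?I (z + d0) * of_real R powr z) + 0 * of_real (ln R)
      + (if d0 \<in> D then ?I d0 else 0)" if "R > 0" for R
  proof -
    have "?s R = (\<Sum>d\<in>D - {d0}. ?I d * of_real R powr (d - d0)) + (if d0 \<in> D then ?I d0 else 0)"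
      using D that by (simp add: sum.remove[of D d0])
    also have "(\<Sum>d\<in>D - {d0}. ?I d * of_real R powr (d - d0)) = (\<Sum>z\<in>?A. ?I (z + d0) * of_real R powr z)"
      by (subst sum.reindex) (auto simp: inj_on_def)
    finally show ?thesis by simp
  qed
  have "eventually (\<lambda>R. ?F R - ?s R = ?F R - ((\<Sum>z\<in>?A. ?I (z + d0) * of_real R powr z)
      + 0 * of_real (ln R) + (if d0 \<in> D then ?I d0 else 0))) at_top"
    using eventually_gt_at_top[of "0::real"] by (rule eventually_mono) (simp only: s_eq)
  ultimately have "((\<lambda>R. ?F R - ((\<Sum>z\<in>?A. ?I (z + d0) * of_real R powr z)
      + 0 * of_real (ln R) + (if d0 \<in> D then ?I d0 else 0))) \<longlongrightarrow> 0) at_top"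
    by (rule Lim_transform_eventually)
  then show ?thesis
    unfolding has_constant_term_def using D
    by (intro exI[of _ ?A] exI[of _ "\<lambda>z. ?I (z + d0)"] exI[of _ 0]) auto
qed

section \<open>The chosen components and integration over the base\<close>

lemma CS_com_smooth:
  assumes "\<sigma> \<in> CS_com \<psi> U"
  shows "smooth_on (U \<times> UNIV) \<sigma>"
proof -
  obtain D c where "approximates 0 \<sigma> D c" using CS_com_approximates[OF assms] by blast
  then obtain M where "symbol U M \<sigma>" by (rule approximates_symbol)
  then show ?thesis by (rule symbol_imp_smooth)
qed

lemma CS_com_compact_x_support: "\<sigma> \<in> CS_com \<psi> U \<Longrightarrow> compact_x_support U \<sigma>"
proof (induction rule: CS_com.induct)
  case (generator \<sigma> m)
  then show ?case unfolding CS_com_of_order_def by blast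
next
  case (add \<sigma> \<tau>)
  then obtain K L where "compact K" "K \<subseteq> U" "\<And>x \<xi>. x \<in> U - K \<Longrightarrow> \<sigma> (x, \<xi>) = 0"
    "compact L" "L \<subseteq> U" "\<And>x \<xi>. x \<in> U - L \<Longrightarrow> \<tau> (x, \<xi>) = 0"
    unfolding compact_x_support_def by meson
  then show ?case
    unfolding compact_x_support_def by (intro exI[of _ "K \<union> L"]) auto
next
  case (scale \<sigma> a)
  then show ?case unfolding compact_x_support_def by (metis mult_zero_right)
next
  case (mult \<sigma> \<tau>)
  then show ?case unfolding compact_x_support_def by (metis mult_zero_left)
qed

lemma homogeneous_expansion_component:
  assumes "\<sigma> \<in> CS_com \<psi> U"
  shows "homogeneous_expansion \<psi> U \<sigma> (homogeneous_component \<psi> U \<sigma>)"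
  unfolding homogeneous_component_def
  using someI_ex[OF homogeneous_expansion_exists[OF assms]] by simp

lemma homogeneous_expansion_bounded_order:
  assumes "homogeneous_expansion \<psi> U \<sigma> c" "x \<in> U"
  defines "D \<equiv> \<lambda>r. {d. Re d > r \<and> (\<exists>p\<in>U \<times> - {0}. c d p \<noteq> 0)}"
  shows "finite (D r)" "positively_homogeneous U d (c d)"
    "bounded_order {x} r (\<lambda>p. \<sigma> p - (\<Sum>d\<in>D r. \<psi> p * c d p))"
  using assms symbol_imp_bounded_order[of U r _ "{x}"]
  unfolding homogeneous_expansion_def Let_def by auto

text \<open>Where \<sigma> vanishes on a whole fibre, the truncated sum of components is itself
  bounded to the remainder order Re d - 1, so its component of degree d vanishes. This gives the
  components compact support in x, as Fubini requires.\<close>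

lemma homogeneous_component_support:
  assumes c: "homogeneous_expansion \<psi> U \<sigma> c" and x: "x \<in> U" and \<sigma>: "\<And>\<xi>. \<sigma> (x, \<xi>) = 0" and "\<xi> \<noteq> 0"
  shows "c d (x, \<xi>) = 0"
proof (rule ccontr)
  assume nz: "c d (x, \<xi>) \<noteq> 0"
  let ?r = "Re d - 1" and ?D = "{e. Re e > Re d - 1 \<and> (\<exists>p\<in>U \<times> - {0}. c e p \<noteq> 0)}"
  note D = homogeneous_expansion_bounded_order(1,3)[OF c x, where r = ?r]
  have hom: "positively_homogeneous U e (c e)" for e
    by (rule homogeneous_expansion_bounded_order(2)[OF c x])
  have d: "d \<in> ?D" using nz x \<open>\<xi> \<noteq> 0\<close> by auto
  obtain C where "\<And>\<xi>. cmod (\<sigma> (x, \<xi>) - (\<Sum>e\<in>?D. \<psi> (x, \<xi>) * c e (x, \<xi>))) \<le> C * (1 + norm \<xi>) powr ?r"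
    using D(2) unfolding bounded_order_def by auto
  then have "bounded_order {x} ?r (\<lambda>p. \<Sum>e\<in>?D. \<psi> p * c e p)"
    unfolding bounded_order_def by (intro exI[of _ C]) (simp add: \<sigma>)
  from homogeneous_sum_bounded_order_imp_0[OF D(1) hom this x \<open>\<xi> \<noteq> 0\<close> d] nz show False by simp
qed

lemma has_constant_term_homogeneous_component:
  assumes \<sigma>: "smooth_on (U \<times> UNIV) \<sigma>" and c: "homogeneous_expansion \<psi> U \<sigma> c" and x: "x \<in> U"
  shows "has_constant_term (fibre_ball_integral (deriv_xi i \<sigma>) x)
    (sphere_component i (c (1 - of_nat CARD('n))) x)"
proof -
  let ?d = "1 - of_nat CARD('n) :: complex"
  let ?D = "{d. Re d > - real CARD('n) \<and> (\<exists>p\<in>U \<times> - {0}. c d p \<noteq> 0)}"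
  note D = homogeneous_expansion_bounded_order(1,3)[OF c x, where r = "- real CARD('n)"]
  have hom: "positively_homogeneous U d (c d)" for d
    by (rule homogeneous_expansion_bounded_order(2)[OF c x])
  \<comment> \<open>The degree 1 - n exceeds the truncation order -n, so it can be missing from
    \<open>?D\<close> only because its component vanishes off the zero section.\<close>
  have "sphere_component i (c ?d) x = 0" if no_d: "?d \<notin> ?D"
  proof -
    have "c ?d (x, \<omega>) = 0" if "\<omega> \<in> sphere 0 1" for \<omega>
      using no_d x that by force
    then have "sphere_component i (c ?d) x = (LINT \<omega>|(sphere_measure :: (real^'n) measure). 0)"
      unfolding sphere_component_def
      by (intro Bochner_Integration.integral_cong) (auto simp: space_sphere_measure)
    then show ?thesis by simp
  qed
  then show ?thesis
    using has_constant_term_deriv_xi[OF \<sigma> x D(1) hom D(2), of i] by (auto split: if_splits)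
qed

text \<open>Working with the classical expansion itself shows that the constant term is 0 on every
  fibre over U: a degree m - j equal to 1 - n would make m an integer.\<close>

lemma cutoff_integral_nonint:
  assumes "\<sigma> \<in> CS_com_nonint \<psi> U"
  shows "cutoff_integral U (deriv_xi i \<sigma>) = 0"
proof -
  obtain m where m: "m \<notin> \<int>" "classical_symbol \<psi> U m \<sigma>"
    using assms unfolding CS_com_nonint_def CS_com_of_order_def by auto
  obtain N c where Nc: "approximates (- real CARD('n)) \<sigma> ((\<lambda>i. m - of_nat i) ` {0..N::nat}) c"
    using classical_symbol_approximates[OF m(2)] by blast
  let ?D = "(\<lambda>i. m - of_nat i) ` {0..N::nat}" and ?d = "1 - of_nat CARD('n) :: complex"
  have "?d \<notin> ?D"
  proof
    assume "?d \<in> ?D"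
    then obtain j :: nat where "?d = m - of_nat j" by blast
    then have "m = 1 - of_nat CARD('n) + of_nat j" by (simp add: algebra_simps)
    also have "\<dots> \<in> \<int>" by (intro Ints_add Ints_diff Ints_1 Ints_of_nat)
    finally show False using m(1) by contradiction
  qed
  moreover have "smooth_on (U \<times> UNIV) \<sigma>"
    using m(2) unfolding classical_symbol_def by (auto intro: symbol_imp_smooth)
  moreover have "bounded_order {x} (- real CARD('n)) (\<lambda>p. \<sigma> p - (\<Sum>d\<in>?D. \<psi> p * c d p))" if "x \<in> U" for x
    by (rule symbol_imp_bounded_order) (use Nc that in \<open>auto simp: approximates_def\<close>)
  ultimately have "cutoff_fibre_integral (deriv_xi i \<sigma>) x = 0" if "x \<in> U" for x
    using has_constant_term_deriv_xi[of \<sigma> x ?D c i] Nc that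
    unfolding cutoff_fibre_integral_def approximates_def by (intro constant_term_eqI) auto
  then have "cutoff_integral U (deriv_xi i \<sigma>) = (LINT x:U|lborel. 0)"
    unfolding cutoff_integral_def set_lebesgue_integral_def
    by (intro Bochner_Integration.integral_cong) (auto simp: indicator_def)
  then show ?thesis by simp
qed

text \<open>The fibrewise constant term is known explicitly, so integrability over U reduces to
  \<open>cosphere_Fubini\<close> for a continuous function vanishing outside K.\<close>

lemma cutoff_integral_deriv_xi:
  assumes "\<sigma> \<in> CS_com \<psi> U"
  defines "h \<equiv> homogeneous_component \<psi> U \<sigma> (1 - of_nat CARD('n))"
  shows "cutoff_integrable U (deriv_xi i \<sigma>)"
    and "cutoff_integral U (deriv_xi i \<sigma>) = (\<integral>p. (snd p $ i) *\<^sub>R h p \<partial>cosphere_measure U)"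
proof -
  have sm: "smooth_on (U \<times> UNIV) \<sigma>" by (rule CS_com_smooth[OF assms(1)])
  note c = homogeneous_expansion_component[OF assms(1)]
  have h: "smooth_on (U \<times> - {0}) h"
    using c unfolding h_def homogeneous_expansion_def positively_homogeneous_def by blast
  have ct: "has_constant_term (fibre_ball_integral (deriv_xi i \<sigma>) x) (sphere_component i h x)" if "x \<in> U" for x
    unfolding h_def by (rule has_constant_term_homogeneous_component[OF sm c that])
  obtain K where K: "compact K" "K \<subseteq> U" "\<And>x \<xi>. x \<in> U - K \<Longrightarrow> \<sigma> (x, \<xi>) = 0"
    using CS_com_compact_x_support[OF assms(1)] unfolding compact_x_support_def by blast
  have "continuous_on (U \<times> sphere 0 1) (\<lambda>p. (snd p $ i) *\<^sub>R h p)"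
    by (intro continuous_intros continuous_on_subset[OF smooth_on_imp_continuous[OF h]]) auto
  moreover have "(snd (x, \<omega>) $ i) *\<^sub>R h (x, \<omega>) = 0" if "x \<in> U - K" "norm \<omega> = 1" for x \<omega>
    using homogeneous_component_support[OF c, of x \<omega>] K(3) that unfolding h_def by force
  ultimately have Fub: "set_integrable lborel U (sphere_component i h)"
    "(LINT x:U|lborel. sphere_component i h x) = (\<integral>p. (snd p $ i) *\<^sub>R h p \<partial>cosphere_measure U)"
    using cosphere_Fubini[OF U K(1,2), of "\<lambda>p. (snd p $ i) *\<^sub>R h p"]
    unfolding sphere_component_def by simp_all
  \<comment> \<open>The two functions of x are known to agree on U only, hence the comparison under
    the indicator.\<close>
  have eq: "(\<lambda>x. indicator U x *\<^sub>R cutoff_fibre_integral (deriv_xi i \<sigma>) x)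
      = (\<lambda>x. indicator U x *\<^sub>R sphere_component i h x)"
    using constant_term_eqI[OF ct] unfolding cutoff_fibre_integral_def
    by (intro ext) (simp split: split_indicator)
  have "\<exists>!c. has_constant_term (fibre_ball_integral (deriv_xi i \<sigma>) x) c" if "x \<in> U" for x
    using ct[OF that] has_constant_term_unique by blast
  moreover have "set_integrable lborel U (cutoff_fibre_integral (deriv_xi i \<sigma>))"
    using Fub(1) unfolding set_integrable_def eq .
  ultimately show "cutoff_integrable U (deriv_xi i \<sigma>)"
    unfolding cutoff_integrable_def using set_integrable_deriv_xi[OF sm] by blast
  show "cutoff_integral U (deriv_xi i \<sigma>) = (\<integral>p. (snd p $ i) *\<^sub>R h p \<partial>cosphere_measure U)"
    unfolding Fub(2)[symmetric] cutoff_integral_def set_lebesgue_integral_def eq ..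
qed

end

lemma cosphere_integral_omit_dxi_form:
  fixes U :: "(real^'n::{finite,linorder}) set"
  shows "cosphere_integral U f (omit_dxi_form i)
    = (- 1) ^ card {j. j < i} * (\<integral>p. (snd p $ i) *\<^sub>R f p \<partial>cosphere_measure U)"
proof -
  have "cosphere_integral U f (omit_dxi_form i)
      = (\<integral>p. (- 1) ^ card {j. j < i} * ((snd p $ i) *\<^sub>R f p) \<partial>cosphere_measure U)"
    unfolding cosphere_integral_def
    by (intro Bochner_Integration.integral_cong)
       (auto simp: space_cosphere_measure omit_dxi_form_frame scaleR_conv_of_real)
  also have "\<dots> = (- 1) ^ card {j. j < i} * (\<integral>p. (snd p $ i) *\<^sub>R f p \<partial>cosphere_measure U)"
    by (rule integral_mult_right_zero)
  finally show ?thesis .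
qed

theorem corollary3:
  fixes U :: "(real^'n::{finite,wellorder}) set"
    and \<psi> :: "'n cotangent \<Rightarrow> complex"
  assumes "open U"
    and "cutoff_function U \<psi>"
  shows "(\<forall>\<sigma>\<in>CS_com \<psi> U. \<forall>i.
            cutoff_integrable U (deriv_xi i \<sigma>) \<and>
            cutoff_integral U (deriv_xi i \<sigma>) =
              (-1) ^ card {j. j < i} *
              cosphere_integral U (homogeneous_component \<psi> U \<sigma> (1 - of_nat CARD('n))) (omit_dxi_form i))
       \<and> (\<forall>\<sigma>\<in>CS_com_nonint \<psi> U. \<forall>i. cutoff_integral U (deriv_xi i \<sigma>) = 0)"
proof -
  interpret cutoff U \<psi> by unfold_locales (fact assms)+
  show ?thesis
    \<comment> \<open>Both factors (-1)^(i-1) are now explicit, and their product is an even power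
      of -1.\<close>
    unfolding cosphere_integral_omit_dxi_form
    by (simp add: cutoff_integral_deriv_xi cutoff_integral_nonint mult.assoc[symmetric] power_add[symmetric])
qed

end
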